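(* Let $\Gamma$ be a groupoid, let $R$ be a $d$-finitely generated $\Gamma$-graded ring, and write $R=\sum_{e\in\Delta_0}R1_eR$ for a finite subset $\Delta_0\subseteq\Gamma_0$. Then the following are equivalent: $R$ is gr-semiprimary; $R$ is gr-semilocal and $\mathrm{rad}^{\mathrm{gr}}(R)$ is nilpotent; $1_eR1_e$ is gr-semiprimary for every $e\in\Delta_0$.
   Context: A groupoid $\Gamma$ is the set of morphisms of a small category in which all morphisms are invertible; $\Gamma_0\subseteq\Gamma$ is the set of identity morphisms; $d(\gamma)=\gamma^{-1}\gamma$, $r(\gamma)=\gamma\gamma^{-1}$; the product $\gamma\delta$ is defined iff $d(\gamma)=r(\delta)$. Rings are associative, not necessarily unital. A $\Gamma$-graded ring is a ring $R=\bigoplus_{\gamma\in\Gamma}R_\gamma$ (additive subgroups) with $R_\gamma R_\delta\subseteq R_{\gamma\delta}$ if $d(\gamma)=r(\delta)$ and $R_\gamma R_\delta=0$ otherwise; it is always assumed object unital: for each $e\in\Gamma_0$ the ring $R_e$ has an identity $1_e$ (possibly $0$) with $1_{r(\gamma)}a=a=a1_{d(\gamma)}$ for all $a\in R_\gamma$, $\gamma\in\Gamma$. One- or two-sided ideals $U$ are graded if $U=\bigoplus_\gamma (U\cap R_\gamma)$; if $U$ is two-sided, $R/U$ is graded by $(R/U)_\gamma=(R_\gamma+U)/U$. For $e\in\Gamma_0$, $1_eR1_e=\bigoplus_{r(\gamma)=d(\gamma)=e}R_\gamma$ is a unital ring graded by the group $e\Gamma e=\{\gamma: r(\gamma)=d(\gamma)=e\}$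 (a groupoid with one identity). $R$ is $d$-finitely generated if $R=\sum_{e\in\Delta_0}R1_eR$ for some finite $\Delta_0\subseteq\Gamma_0$. $\mathrm{rad}^{\mathrm{gr}}(R)$ is the intersection of all gr-maximal graded right ideals (those maximal among proper graded right ideals); it is a graded two-sided ideal. A nonzero graded right ideal is gr-simple if it contains no graded right ideals other than $0$ and itself; a graded ring is gr-semisimple if it is a sum of gr-simple graded right ideals; $R$ is gr-semilocal if the graded ring $R/\mathrm{rad}^{\mathrm{gr}}(R)$ is gr-semisimple. A graded ideal $U$ is nilpotent if $U^n=0$ for some positive integer $n$, and objectwise nilpotent if for each $e\in\Gamma_0$ there are positive integers $n_e,m_e$ with $1_eU^{n_e}=0$ and $U^{m_e}1_e=0$. $R$ is gr-semiprimary if it is gr-semilocal and $\mathrm{rad}^{\mathrm{gr}}(R)$ is objectwise nilpotent. *)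

theory Defs
  imports "HOL-Algebra.Ideal_Product" "HOL-Algebra.QuotRing" "HOL-Algebra.Generated_Groups"
begin

section \<open>Groupoids\<close>

text \<open>
  A groupoid is given by its set of morphisms, objects being identified with their identity
  morphisms. Thus \<open>src \<gamma>\<close> and \<open>tgt \<gamma>\<close> are identity morphisms and play the
  role of \<open>d(\<gamma>) = \<gamma>\<inverse>\<gamma>\<close> and \<open>r(\<gamma>) = \<gamma>\<gamma>\<inverse>\<close> (see axiom \<open>inverse\<close>);
  \<open>cmp \<gamma> \<delta>\<close> is meaningful only if \<open>src \<gamma> = tgt \<delta>\<close>.
\<close>

record 'g groupoid =
  arr :: "'g set"
  src :: "'g \<Rightarrow> 'g"
  tgt :: "'g \<Rightarrow> 'g"
  cmp :: "'g \<Rightarrow> 'g \<Rightarrow> 'g"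

definition ids :: "('g, 'x) groupoid_scheme \<Rightarrow> 'g set" where
  "ids \<Gamma> = {e \<in> arr \<Gamma>. src \<Gamma> e = e \<and> tgt \<Gamma> e = e}"

locale groupoid =
  fixes \<Gamma> :: "('g, 'x) groupoid_scheme"
  assumes src_ids: "\<gamma> \<in> arr \<Gamma> \<Longrightarrow> src \<Gamma> \<gamma> \<in> ids \<Gamma>"
    and tgt_ids: "\<gamma> \<in> arr \<Gamma> \<Longrightarrow> tgt \<Gamma> \<gamma> \<in> ids \<Gamma>"
    and cmp_closed: "\<lbrakk>\<gamma> \<in> arr \<Gamma>; \<delta> \<in> arr \<Gamma>; src \<Gamma> \<gamma> = tgt \<Gamma> \<delta>\<rbrakk> \<Longrightarrow> cmp \<Gamma> \<gamma> \<delta> \<in> arr \<Gamma>"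
    and src_cmp: "\<lbrakk>\<gamma> \<in> arr \<Gamma>; \<delta> \<in> arr \<Gamma>; src \<Gamma> \<gamma> = tgt \<Gamma> \<delta>\<rbrakk> \<Longrightarrow> src \<Gamma> (cmp \<Gamma> \<gamma> \<delta>) = src \<Gamma> \<delta>"
    and tgt_cmp: "\<lbrakk>\<gamma> \<in> arr \<Gamma>; \<delta> \<in> arr \<Gamma>; src \<Gamma> \<gamma> = tgt \<Gamma> \<delta>\<rbrakk> \<Longrightarrow> tgt \<Gamma> (cmp \<Gamma> \<gamma> \<delta>) = tgt \<Gamma> \<gamma>"
    and cmp_assoc: "\<lbrakk>\<gamma> \<in> arr \<Gamma>; \<delta> \<in> arr \<Gamma>; \<epsilon> \<in> arr \<Gamma>; src \<Gamma> \<gamma> = tgt \<Gamma> \<delta>; src \<Gamma> \<delta> = tgt \<Gamma> \<epsilon>\<rbrakk>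
      \<Longrightarrow> cmp \<Gamma> (cmp \<Gamma> \<gamma> \<delta>) \<epsilon> = cmp \<Gamma> \<gamma> (cmp \<Gamma> \<delta> \<epsilon>)"
    and cmp_src: "\<gamma> \<in> arr \<Gamma> \<Longrightarrow> cmp \<Gamma> \<gamma> (src \<Gamma> \<gamma>) = \<gamma>"
    and cmp_tgt: "\<gamma> \<in> arr \<Gamma> \<Longrightarrow> cmp \<Gamma> (tgt \<Gamma> \<gamma>) \<gamma> = \<gamma>"
    and inverse: "\<gamma> \<in> arr \<Gamma> \<Longrightarrow> \<exists>\<delta>\<in>arr \<Gamma>. src \<Gamma> \<delta> = tgt \<Gamma> \<gamma> \<and> tgt \<Gamma> \<delta> = src \<Gamma> \<gamma> \<and>
      cmp \<Gamma> \<delta> \<gamma> = src \<Gamma> \<gamma> \<and> cmp \<Gamma> \<gamma> \<delta> = tgt \<Gamma> \<gamma>"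

definition isotropy :: "('g, 'x) groupoid_scheme \<Rightarrow> 'g \<Rightarrow> ('g, 'x) groupoid_scheme" where
  "isotropy \<Gamma> e = \<Gamma>\<lparr>arr := {\<gamma> \<in> arr \<Gamma>. tgt \<Gamma> \<gamma> = e \<and> src \<Gamma> \<gamma> = e}\<rparr>"


section \<open>Groupoid graded rings\<close>

text \<open>
  Rings need not be unital, so \<^locale>\<open>ring\<close> is not applicable. We reuse the record type of
  HOL-Algebra, but its field \<open>one\<close> is never referred to for a general ring.
\<close>

locale nonunital_ring = abelian_group R for R (structure) +
  assumes m_closed: "\<lbrakk>x \<in> carrier R; y \<in> carrier R\<rbrakk> \<Longrightarrow> x \<otimes> y \<in> carrier R"
    and m_assoc: "\<lbrakk>x \<in> carrier R; y \<in> carrier R; z \<in> carrier R\<rbrakk> \<Longrightarrow> (x \<otimes> y) \<otimes> z = x \<otimes> (y \<otimes> z)"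
    and l_distr: "\<lbrakk>x \<in> carrier R; y \<in> carrier R; z \<in> carrier R\<rbrakk> \<Longrightarrow> (x \<oplus> y) \<otimes> z = x \<otimes> z \<oplus> y \<otimes> z"
    and r_distr: "\<lbrakk>x \<in> carrier R; y \<in> carrier R; z \<in> carrier R\<rbrakk> \<Longrightarrow> z \<otimes> (x \<oplus> y) = z \<otimes> x \<oplus> z \<otimes> y"

text \<open>
  \<open>U\<close> is the internal direct sum of the additive subgroups \<open>M i\<close>: every element of
  \<open>U\<close> is a sum of a unique finitely supported family, and all such sums lie in \<open>U\<close>.
\<close>

definition is_direct_sum :: "('a, 'm) ring_scheme \<Rightarrow> 'i set \<Rightarrow> ('i \<Rightarrow> 'a set) \<Rightarrow> 'a set \<Rightarrow> bool" where
  "is_direct_sum R I M U \<longleftrightarrow>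
     bij_betw (\<lambda>f. finsum R f {i \<in> I. f i \<noteq> \<zero>\<^bsub>R\<^esub>})
       {f \<in> Pi\<^sub>E I M. finite {i \<in> I. f i \<noteq> \<zero>\<^bsub>R\<^esub>}} U"

definition subgroups_sum :: "('a, 'm) ring_scheme \<Rightarrow> 'a set set \<Rightarrow> 'a set" where
  "subgroups_sum R S = generate (add_monoid R) (\<Union>S)"

locale graded_ring = groupoid \<Gamma> + nonunital_ring R
  for \<Gamma> :: "('g, 'x) groupoid_scheme"
    and R :: "('a, 'm) ring_scheme" (structure) +
  fixes A :: "'g \<Rightarrow> 'a set"
  assumes component_subgroup: "\<gamma> \<in> arr \<Gamma> \<Longrightarrow> additive_subgroup (A \<gamma>) R"
    and direct_sum: "is_direct_sum R (arr \<Gamma>) A (carrier R)"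
    and mult_component: "\<lbrakk>\<gamma> \<in> arr \<Gamma>; \<delta> \<in> arr \<Gamma>; src \<Gamma> \<gamma> = tgt \<Gamma> \<delta>; a \<in> A \<gamma>; b \<in> A \<delta>\<rbrakk>
      \<Longrightarrow> a \<otimes> b \<in> A (cmp \<Gamma> \<gamma> \<delta>)"
    and mult_zero: "\<lbrakk>\<gamma> \<in> arr \<Gamma>; \<delta> \<in> arr \<Gamma>; src \<Gamma> \<gamma> \<noteq> tgt \<Gamma> \<delta>; a \<in> A \<gamma>; b \<in> A \<delta>\<rbrakk>
      \<Longrightarrow> a \<otimes> b = \<zero>"
    and object_unital: "\<exists>u. (\<forall>e\<in>ids \<Gamma>. u e \<in> A e) \<and>
      (\<forall>\<gamma>\<in>arr \<Gamma>. \<forall>a\<in>A \<gamma>. u (tgt \<Gamma> \<gamma>) \<otimes> a = a \<and> a \<otimes> u (src \<Gamma> \<gamma>) = a)"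

text \<open>
  The identity of the ring \<open>A e\<close>. By \<open>object_unital\<close> (take \<open>\<gamma> = e\<close>) it exists,
  and it is the only possible choice for \<open>u e\<close> there.
\<close>

definition obj_one :: "('a, 'm) ring_scheme \<Rightarrow> ('g \<Rightarrow> 'a set) \<Rightarrow> 'g \<Rightarrow> 'a" where
  "obj_one R A e = (THE u. u \<in> A e \<and> (\<forall>a\<in>A e. u \<otimes>\<^bsub>R\<^esub> a = a \<and> a \<otimes>\<^bsub>R\<^esub> u = a))"

text \<open>
  The ring \<open>1\<^sub>e R 1\<^sub>e\<close>; its grading by \<open>isotropy \<Gamma> e\<close> is given by the same family
  \<open>A\<close>, which is only ever used on the morphisms of the grading groupoid.
\<close>

definition corner :: "('a, 'm) ring_scheme \<Rightarrow> ('g \<Rightarrow> 'a set) \<Rightarrow> 'g \<Rightarrow> ('a, 'm) ring_scheme" where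
  "corner R A e = R\<lparr>
     carrier := {obj_one R A e \<otimes>\<^bsub>R\<^esub> a \<otimes>\<^bsub>R\<^esub> obj_one R A e | a. a \<in> carrier R},
     one := obj_one R A e\<rparr>"

text \<open>
  The grading of \<open>R Quot U\<close>. The carrier, multiplication, zero and addition of
  \<^const>\<open>FactRing\<close> do not involve the field \<open>one\<close> of \<open>R\<close>.
\<close>

definition quot_grading ::
    "('a, 'm) ring_scheme \<Rightarrow> ('g \<Rightarrow> 'a set) \<Rightarrow> 'a set \<Rightarrow> 'g \<Rightarrow> 'a set set" where
  "quot_grading R A U \<gamma> = (\<lambda>x. U +>\<^bsub>R\<^esub> x) ` (A \<gamma> <+>\<^bsub>R\<^esub> U)"

text \<open>\<open>R = \<Sum>e\<in>\<Delta>. R 1\<^sub>e R\<close>\<close>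

definition d_generated_by :: "('a, 'm) ring_scheme \<Rightarrow> ('g \<Rightarrow> 'a set) \<Rightarrow> 'g set \<Rightarrow> bool" where
  "d_generated_by R A \<Delta> \<longleftrightarrow> carrier R =
     subgroups_sum R ((\<lambda>e. ideal_prod R (carrier R #>\<^bsub>R\<^esub> obj_one R A e) (carrier R)) ` \<Delta>)"

definition d_finitely_generated ::
    "('g, 'x) groupoid_scheme \<Rightarrow> ('a, 'm) ring_scheme \<Rightarrow> ('g \<Rightarrow> 'a set) \<Rightarrow> bool" where
  "d_finitely_generated \<Gamma> R A \<longleftrightarrow> (\<exists>\<Delta>. finite \<Delta> \<and> \<Delta> \<subseteq> ids \<Gamma> \<and> d_generated_by R A \<Delta>)"


section \<open>Graded ideals, radical, semiprimary rings\<close>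

definition gr_right_ideal ::
    "('g, 'x) groupoid_scheme \<Rightarrow> ('a, 'm) ring_scheme \<Rightarrow> ('g \<Rightarrow> 'a set) \<Rightarrow> 'a set \<Rightarrow> bool" where
  "gr_right_ideal \<Gamma> R A U \<longleftrightarrow>
     additive_subgroup U R \<and> (\<forall>u\<in>U. \<forall>x\<in>carrier R. u \<otimes>\<^bsub>R\<^esub> x \<in> U) \<and>
     is_direct_sum R (arr \<Gamma>) (\<lambda>\<gamma>. U \<inter> A \<gamma>) U"

definition gr_maximal ::
    "('g, 'x) groupoid_scheme \<Rightarrow> ('a, 'm) ring_scheme \<Rightarrow> ('g \<Rightarrow> 'a set) \<Rightarrow> 'a set \<Rightarrow> bool" where
  "gr_maximal \<Gamma> R A U \<longleftrightarrow>
     gr_right_ideal \<Gamma> R A U \<and> U \<noteq> carrier R \<and>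
     (\<forall>V. gr_right_ideal \<Gamma> R A V \<longrightarrow> V \<noteq> carrier R \<longrightarrow> U \<subseteq> V \<longrightarrow> V = U)"

text \<open>Intersecting with the carrier makes the empty intersection equal to the whole ring.\<close>

definition gr_rad ::
    "('g, 'x) groupoid_scheme \<Rightarrow> ('a, 'm) ring_scheme \<Rightarrow> ('g \<Rightarrow> 'a set) \<Rightarrow> 'a set" where
  "gr_rad \<Gamma> R A = carrier R \<inter> \<Inter>{U. gr_maximal \<Gamma> R A U}"

definition gr_simple ::
    "('g, 'x) groupoid_scheme \<Rightarrow> ('a, 'm) ring_scheme \<Rightarrow> ('g \<Rightarrow> 'a set) \<Rightarrow> 'a set \<Rightarrow> bool" where
  "gr_simple \<Gamma> R A U \<longleftrightarrow>
     gr_right_ideal \<Gamma> R A U \<and> U \<noteq> {\<zero>\<^bsub>R\<^esub>} \<and>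
     (\<forall>V. gr_right_ideal \<Gamma> R A V \<longrightarrow> V \<subseteq> U \<longrightarrow> V = {\<zero>\<^bsub>R\<^esub>} \<or> V = U)"

definition gr_semisimple ::
    "('g, 'x) groupoid_scheme \<Rightarrow> ('a, 'm) ring_scheme \<Rightarrow> ('g \<Rightarrow> 'a set) \<Rightarrow> bool" where
  "gr_semisimple \<Gamma> R A \<longleftrightarrow>
     (\<exists>S. (\<forall>U\<in>S. gr_simple \<Gamma> R A U) \<and> carrier R = subgroups_sum R S)"

definition gr_semilocal ::
    "('g, 'x) groupoid_scheme \<Rightarrow> ('a, 'm) ring_scheme \<Rightarrow> ('g \<Rightarrow> 'a set) \<Rightarrow> bool" where
  "gr_semilocal \<Gamma> R A \<longleftrightarrow>
     gr_semisimple \<Gamma> (R Quot gr_rad \<Gamma> R A) (quot_grading R A (gr_rad \<Gamma> R A))"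

text \<open>
  \<open>U\<^sup>n\<close> consists of the finite sums of products of \<open>n\<close> elements of \<open>U\<close>. Only
  \<open>n > 0\<close> matters; the value at \<open>0\<close> is a convention.
\<close>

fun ideal_pow :: "('a, 'm) ring_scheme \<Rightarrow> 'a set \<Rightarrow> nat \<Rightarrow> 'a set" where
  "ideal_pow R U 0 = carrier R"
| "ideal_pow R U (Suc 0) = U"
| "ideal_pow R U (Suc (Suc n)) = ideal_prod R (ideal_pow R U (Suc n)) U"

definition nilpotent_ideal :: "('a, 'm) ring_scheme \<Rightarrow> 'a set \<Rightarrow> bool" where
  "nilpotent_ideal R U \<longleftrightarrow> (\<exists>n>0. ideal_pow R U n = {\<zero>\<^bsub>R\<^esub>})"

definition objectwise_nilpotent ::
    "('g, 'x) groupoid_scheme \<Rightarrow> ('a, 'm) ring_scheme \<Rightarrow> ('g \<Rightarrow> 'a set) \<Rightarrow> 'a set \<Rightarrow> bool" where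
  "objectwise_nilpotent \<Gamma> R A U \<longleftrightarrow>
     (\<forall>e\<in>ids \<Gamma>. \<exists>n>0. \<exists>m>0.
        obj_one R A e <#\<^bsub>R\<^esub> ideal_pow R U n = {\<zero>\<^bsub>R\<^esub>} \<and>
        ideal_pow R U m #>\<^bsub>R\<^esub> obj_one R A e = {\<zero>\<^bsub>R\<^esub>})"

definition gr_semiprimary ::
    "('g, 'x) groupoid_scheme \<Rightarrow> ('a, 'm) ring_scheme \<Rightarrow> ('g \<Rightarrow> 'a set) \<Rightarrow> bool" where
  "gr_semiprimary \<Gamma> R A \<longleftrightarrow>
     gr_semilocal \<Gamma> R A \<and> objectwise_nilpotent \<Gamma> R A (gr_rad \<Gamma> R A)"

end

theory Submission
  imports Defs
begin

text \<open>
  Write \<open>J\<close> for the graded radical. By Zorn's lemma, an element \<open>a\<close> of degree \<open>\<gamma>\<close>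
  lies in \<open>J\<close> iff \<open>1\<^sub>e - a b\<close> with \<open>e = r(\<gamma>)\<close> is right invertible in \<open>A e\<close> for
  all homogeneous \<open>b\<close> with \<open>a b\<close> of degree \<open>e\<close>. The condition only involves \<open>1\<^sub>e R 1\<^sub>e\<close>
  when \<open>a\<close> does, so \<open>J\<close> meets each corner in the radical of the corner.

  Gr-semilocality says that \<open>R\<close> is spanned modulo \<open>J\<close> by homogeneous elements \<open>a\<close>
  generating a gr-simple right ideal. For \<open>a\<close> in a corner this property can be tested in the
  corner, since \<open>a c \<notin> J\<close> implies \<open>a c b \<notin> J\<close> for some homogeneous \<open>b\<close> with
  \<open>c b\<close> in the corner. The span is a two-sided ideal, so it is all of \<open>R\<close> as soon as it
  contains \<open>1\<^sub>e\<close> for \<open>e \<in> \<Delta>\<^sub>0\<close>.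

  As for nilpotency, \<open>R = \<Sum>R 1\<^sub>e R\<close> allows one to insert elements \<open>1\<^sub>e\<close> with
  \<open>e \<in> \<Delta>\<^sub>0\<close> between the factors of a long product in \<open>J\<close>; some \<open>e\<close> then
  occurs often enough for a product in \<open>1\<^sub>e J 1\<^sub>e\<close> to vanish.
\<close>

section \<open>Internal direct sums\<close>

text \<open>There is no global identity whose absence would express that an ideal is proper. Zorn's
  lemma is therefore run on graded right ideals that miss a single \<open>1_e\<close> and contain
  every \<open>x\<close> with \<open>1_e x = 0\<close>. An ideal containing these \<open>x\<close>
  and also \<open>1_e\<close> is all of \<open>R\<close>, so a maximal one among them is maximal
  among all proper ideals. This localisation at one object is what confines the invertibility
  criterion to \<open>A e\<close>.

  The criterion is one-sided, so closure of the radical under left multiplication needs its own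
  argument: a homogeneous factor is moved from the right of \<open>a b\<close> to its left.
  Two-sidedness then gives the quotient its product and absorbs the outer factors of
  \<open>r 1_e s\<close> into neighbouring radical elements.

  Comparison with a corner goes through the additive map \<open>x \<mapsto> 1_e x 1_e\<close>, which
  fixes or kills each homogeneous element. For this reason semilocality is phrased by elements and
  additive generation inside \<open>R\<close>, so that neither quotient rings nor sets of ideals
  have to be compared.\<close>

lemma (in abelian_group) additive_subgroup_criterion:
  assumes "H \<subseteq> carrier G" "\<zero> \<in> H"
    "\<And>x y. x \<in> H \<Longrightarrow> y \<in> H \<Longrightarrow> x \<oplus> y \<in> H" "\<And>x. x \<in> H \<Longrightarrow> \<ominus> x \<in> H"
  shows "additive_subgroup H G"
  using assms by (intro additive_subgroupI add.subgroupI) auto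

lemma (in abelian_group) additive_subgroup_generate:
  assumes "S \<subseteq> carrier G"
  shows "additive_subgroup (generate (add_monoid G) S) G"
  using assms by (intro additive_subgroupI add.generate_is_subgroup) auto

lemma (in abelian_group) generate_le:
  assumes "additive_subgroup H G" "S \<subseteq> H"
  shows "generate (add_monoid G) S \<subseteq> H"
  using assms additive_subgroup.a_subgroup add.generate_subgroup_incl by blast

lemma (in abelian_group) finsum_in_subgroup:
  assumes "additive_subgroup H G" "\<And>i. i \<in> S \<Longrightarrow> f i \<in> H"
  shows "finsum G f S \<in> H"
proof -
  interpret H: additive_subgroup H G by fact
  show ?thesis
    using assms(2)
  proof (induction S rule: infinite_finite_induct)
    case (insert i S)
    then have "f \<in> S \<rightarrow> carrier G" "f i \<in> carrier G" by auto
    with insert show ?case by (simp add: finsum_insert)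
  qed auto
qed

lemma (in abelian_group) finsum_support:
  assumes "finite T" "{i \<in> I. f i \<noteq> \<zero>} \<subseteq> T" "T \<subseteq> I" "\<And>i. i \<in> I \<Longrightarrow> f i \<in> carrier G"
  shows "finsum G f {i \<in> I. f i \<noteq> \<zero>} = finsum G f T"
  using assms by (intro add.finprod_mono_neutral_cong_left) auto

text \<open>An additive map that is the identity on \<open>M i\<close> and zero on the other
  summands reads off the coefficient at \<open>i\<close>, by induction over the index set.
  \<open>direct_sumI\<close> gets its uniqueness from this.\<close>

lemma (in abelian_group) projection_finsum:
  assumes M: "\<And>j. j \<in> I \<Longrightarrow> additive_subgroup (M j) G"
    and U: "additive_subgroup U G" and MU: "\<And>j. j \<in> I \<Longrightarrow> M j \<subseteq> U"
    and add: "\<And>x y. x \<in> U \<Longrightarrow> y \<in> U \<Longrightarrow> \<pi> (x \<oplus> y) = \<pi> x \<oplus> \<pi> y"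
    and hom: "\<And>j x. j \<in> I \<Longrightarrow> x \<in> M j \<Longrightarrow> \<pi> x = (if i = j then x else \<zero>)"
    and i: "i \<in> I"
    and S: "finite S" "S \<subseteq> I" "\<And>j. j \<in> S \<Longrightarrow> f j \<in> M j"
  shows "\<pi> (finsum G f S) = (if i \<in> S then f i else \<zero>)"
  using S
proof (induction S)
  case empty
  have "\<zero> \<in> M i" using M[OF i] by (simp add: additive_subgroup.zero_closed)
  then show ?case using hom[OF i] by simp
next
  case (insert j S)
  have fU: "f k \<in> U" if "k \<in> insert j S" for k
    using that insert MU by blast
  have c: "f k \<in> carrier G" if "k \<in> insert j S" for k
    using fU[OF that] U additive_subgroup.a_subset by blast
  have "finsum G f S \<in> U" using fU by (intro finsum_in_subgroup[OF U]) auto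
  moreover have "finsum G f (insert j S) = f j \<oplus> finsum G f S"
    using insert c by (intro finsum_insert) auto
  ultimately have "\<pi> (finsum G f (insert j S)) = \<pi> (f j) \<oplus> (if i \<in> S then f i else \<zero>)"
    using insert fU by (simp add: add)
  moreover have "\<pi> (f j) = (if i = j then f j else \<zero>)"
    using insert by (intro hom) auto
  ultimately show ?case using c insert.hyps by auto
qed

text \<open>Coordinate maps are what the applications have at hand. They yield the bijection of
  \<open>is_direct_sum\<close>: a family is recovered from its sum, and an element from its
  coordinates. Used for graded ideals, quotients and corners.\<close>

lemma (in abelian_group) direct_sumI:
  assumes M: "\<And>j. j \<in> I \<Longrightarrow> additive_subgroup (M j) G"
    and U: "additive_subgroup U G" and MU: "\<And>j. j \<in> I \<Longrightarrow> M j \<subseteq> U"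
    and closed: "\<And>i x. i \<in> I \<Longrightarrow> x \<in> U \<Longrightarrow> \<pi> i x \<in> M i"
    and fin: "\<And>x. x \<in> U \<Longrightarrow> finite {i \<in> I. \<pi> i x \<noteq> \<zero>}"
    and sum: "\<And>x. x \<in> U \<Longrightarrow> finsum G (\<lambda>i. \<pi> i x) {i \<in> I. \<pi> i x \<noteq> \<zero>} = x"
    and add: "\<And>i x y. i \<in> I \<Longrightarrow> x \<in> U \<Longrightarrow> y \<in> U \<Longrightarrow> \<pi> i (x \<oplus> y) = \<pi> i x \<oplus> \<pi> i y"
    and hom: "\<And>i j x. i \<in> I \<Longrightarrow> j \<in> I \<Longrightarrow> x \<in> M j \<Longrightarrow> \<pi> i x = (if i = j then x else \<zero>)"
  shows "is_direct_sum G I M U"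
  unfolding is_direct_sum_def bij_betw_def
proof
  let ?D = "{f \<in> Pi\<^sub>E I M. finite {i \<in> I. f i \<noteq> \<zero>}}"
  let ?s = "\<lambda>f. finsum G f {i \<in> I. f i \<noteq> \<zero>}"
  have val: "\<pi> i (?s f) = f i" if "f \<in> ?D" "i \<in> I" for f i
  proof -
    have "\<pi> i (?s f) = (if i \<in> {i \<in> I. f i \<noteq> \<zero>} then f i else \<zero>)"
      using that by (intro projection_finsum[where M = M, OF M U MU]) (auto simp: add hom)
    then show ?thesis using that by auto
  qed
  show "inj_on ?s ?D"
  proof (rule inj_onI)
    fix f g assume f: "f \<in> ?D" and g: "g \<in> ?D" and eq: "?s f = ?s g"
    have "f i = g i" if "i \<in> I" for i
      using val[OF f that] val[OF g that] eq by simp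
    with f g show "f = g" by (auto intro: PiE_ext)
  qed
  show "?s ` ?D = U"
  proof
    show "?s ` ?D \<subseteq> U"
    proof safe
      fix f assume f: "f \<in> Pi\<^sub>E I M"
      have "f i \<in> U" if "i \<in> I" for i using PiE_mem[OF f that] MU[OF that] by blast
      then show "?s f \<in> U" by (intro finsum_in_subgroup[OF U]) auto
    qed
    show "U \<subseteq> ?s ` ?D"
    proof
      fix x assume x: "x \<in> U"
      let ?f = "\<lambda>i\<in>I. \<pi> i x"
      have eq: "{i \<in> I. ?f i \<noteq> \<zero>} = {i \<in> I. \<pi> i x \<noteq> \<zero>}" by auto
      have c: "\<pi> i x \<in> carrier G" if "i \<in> I" for i
        using closed[OF that x] M[OF that] by (simp add: additive_subgroup.a_Hcarr)
      have "x = ?s ?f"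
        unfolding eq using c by (subst sum[OF x, symmetric]) (rule finsum_cong', auto)
      moreover have "?f \<in> ?D"
        unfolding mem_Collect_eq eq using x fin closed by auto
      ultimately show "x \<in> ?s ` ?D" by (rule image_eqI)
    qed
  qed
qed

text \<open>The coordinate map of a direct sum, obtained by inverting the bijection. Its value is
  meaningful only for \<open>x\<close> in the sum and \<open>i\<close> in \<open>I\<close>.\<close>

definition proj :: "('a, 'm) ring_scheme \<Rightarrow> 'i set \<Rightarrow> ('i \<Rightarrow> 'a set) \<Rightarrow> 'i \<Rightarrow> 'a \<Rightarrow> 'a" where
  "proj R I M i x = inv_into {f \<in> Pi\<^sub>E I M. finite {i \<in> I. f i \<noteq> \<zero>\<^bsub>R\<^esub>}}
     (\<lambda>f. finsum R f {i \<in> I. f i \<noteq> \<zero>\<^bsub>R\<^esub>}) x i"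

text \<open>In \<open>proj_unique\<close> the set \<open>T\<close> may contain indices with
  \<open>f i = 0\<close>, so a sum need not be normalised to its exact support before coordinates
  are read off.\<close>

lemma (in abelian_group) proj_props:
  assumes ds: "is_direct_sum G I M U"
    and M: "\<And>j. j \<in> I \<Longrightarrow> additive_subgroup (M j) G"
  shows proj_closed: "\<And>i x. x \<in> U \<Longrightarrow> i \<in> I \<Longrightarrow> proj G I M i x \<in> M i"
    and proj_finite: "\<And>x. x \<in> U \<Longrightarrow> finite {i \<in> I. proj G I M i x \<noteq> \<zero>}"
    and proj_sum: "\<And>x. x \<in> U \<Longrightarrow> finsum G (\<lambda>i. proj G I M i x) {i \<in> I. proj G I M i x \<noteq> \<zero>} = x"
    and proj_unique: "\<And>f i T. \<lbrakk>finite T; T \<subseteq> I; \<And>i. i \<in> T \<Longrightarrow> f i \<in> M i; i \<in> I\<rbrakk>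
      \<Longrightarrow> proj G I M i (finsum G f T) = (if i \<in> T then f i else \<zero>)"
proof -
  let ?D = "{f \<in> Pi\<^sub>E I M. finite {i \<in> I. f i \<noteq> \<zero>}}"
  let ?s = "\<lambda>f. finsum G f {i \<in> I. f i \<noteq> \<zero>}"
  have inj: "inj_on ?s ?D" and im: "?s ` ?D = U"
    using ds unfolding is_direct_sum_def bij_betw_def by auto
  have p: "proj G I M i x = inv_into ?D ?s x i" for i x by (simp add: proj_def)
  have m: "inv_into ?D ?s x \<in> ?D" and e: "?s (inv_into ?D ?s x) = x" if "x \<in> U" for x
    using that im by (auto intro!: inv_into_into[of _ ?s ?D, simplified] f_inv_into_f[of _ ?s ?D, simplified])
  show "proj G I M i x \<in> M i" if "x \<in> U" "i \<in> I" for i x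
    using m[OF that(1)] that(2) unfolding p by auto
  show "finite {i \<in> I. proj G I M i x \<noteq> \<zero>}" if "x \<in> U" for x
    using m[OF that] unfolding p by auto
  show "finsum G (\<lambda>i. proj G I M i x) {i \<in> I. proj G I M i x \<noteq> \<zero>} = x" if "x \<in> U" for x
    using e[OF that] unfolding p .
  show "proj G I M i (finsum G f T) = (if i \<in> T then f i else \<zero>)"
    if T: "finite T" "T \<subseteq> I" "\<And>i. i \<in> T \<Longrightarrow> f i \<in> M i" and i: "i \<in> I" for f i T
  proof -
    \<comment> \<open>The bijection only knows families on all of \<open>I\<close>, so
      \<open>f\<close> is extended by zero. The support may be smaller than \<open>T\<close>, which
      leaves the sum unchanged.\<close>
    let ?f = "\<lambda>i\<in>I. if i \<in> T then f i else \<zero>"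
    have z: "\<zero> \<in> M j" if "j \<in> I" for j using M[OF that] by (simp add: additive_subgroup.zero_closed)
    have sup: "{i \<in> I. ?f i \<noteq> \<zero>} \<subseteq> T" by auto
    then have fin: "finite {i \<in> I. ?f i \<noteq> \<zero>}" using T(1) finite_subset by blast
    have fD: "?f \<in> ?D" using T z fin by auto
    have c: "?f j \<in> carrier G" if "j \<in> I" for j
      using fD that M[OF that] additive_subgroup.a_subset by fastforce
    have "?s ?f = finsum G ?f T"
      using T sup c by (intro finsum_support) auto
    also have "\<dots> = finsum G f T"
    proof (rule finsum_cong')
      show "f \<in> T \<rightarrow> carrier G"
        using T M additive_subgroup.a_subset by blast
    qed (use T in auto)
    finally have "inv_into ?D ?s (finsum G f T) = ?f"
      using inv_into_f_f[OF inj fD] by simp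
    then show ?thesis unfolding p using i by simp
  qed
qed

section \<open>Homogeneous components\<close>

text \<open>Zero counts as homogeneous once there is a morphism, so products of homogeneous elements
  stay homogeneous even if their degrees do not compose.\<close>

definition homog :: "('g, 'x) groupoid_scheme \<Rightarrow> ('g \<Rightarrow> 'a set) \<Rightarrow> 'a set" where
  "homog \<Gamma> A = (\<Union>\<gamma>\<in>arr \<Gamma>. A \<gamma>)"

lemma (in groupoid) ids_simps [simp]:
  assumes "e \<in> ids \<Gamma>"
  shows "e \<in> arr \<Gamma>" "src \<Gamma> e = e" "tgt \<Gamma> e = e"
  using assms by (simp_all add: ids_def)

section \<open>Arithmetic in rings without identity\<close>

context nonunital_ring
begin

lemma l_null [simp]:
  assumes "x \<in> carrier R"
  shows "\<zero> \<otimes> x = \<zero>"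
proof -
  have "\<zero> \<otimes> x \<oplus> \<zero> \<otimes> x = \<zero> \<otimes> x"
    using assms l_distr[of \<zero> \<zero> x] by simp
  then show ?thesis using assms by (simp add: m_closed add.l_cancel_one)
qed

lemma r_null [simp]:
  assumes "x \<in> carrier R"
  shows "x \<otimes> \<zero> = \<zero>"
proof -
  have "x \<otimes> \<zero> \<oplus> x \<otimes> \<zero> = x \<otimes> \<zero>"
    using assms r_distr[of \<zero> \<zero> x] by simp
  then show ?thesis using assms by (simp add: m_closed add.l_cancel_one)
qed

lemma l_minus:
  assumes "x \<in> carrier R" "y \<in> carrier R"
  shows "\<ominus> x \<otimes> y = \<ominus> (x \<otimes> y)"
proof -
  have "\<ominus> x \<otimes> y \<oplus> x \<otimes> y = \<zero>"
    using assms by (simp add: l_distr[symmetric] l_neg)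
  then show ?thesis using assms by (simp add: minus_equality m_closed)
qed

lemma r_minus:
  assumes "x \<in> carrier R" "y \<in> carrier R"
  shows "x \<otimes> \<ominus> y = \<ominus> (x \<otimes> y)"
proof -
  have "x \<otimes> \<ominus> y \<oplus> x \<otimes> y = \<zero>"
    using assms by (simp add: r_distr[symmetric] l_neg)
  then show ?thesis using assms by (simp add: minus_equality m_closed)
qed

end

context graded_ring
begin

abbreviation pr :: "'g \<Rightarrow> 'a \<Rightarrow> 'a" where
  "pr \<equiv> proj R (arr \<Gamma>) A"

abbreviation obj :: "'g \<Rightarrow> 'a" where
  "obj \<equiv> obj_one R A"

lemma component_carrier: "\<gamma> \<in> arr \<Gamma> \<Longrightarrow> a \<in> A \<gamma> \<Longrightarrow> a \<in> carrier R"
  by (rule additive_subgroup.a_Hcarr[OF component_subgroup])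

lemma component_zero: "\<gamma> \<in> arr \<Gamma> \<Longrightarrow> \<zero> \<in> A \<gamma>"
  by (rule additive_subgroup.zero_closed[OF component_subgroup])

lemma homog_carrier: "a \<in> homog \<Gamma> A \<Longrightarrow> a \<in> carrier R"
  unfolding homog_def using component_carrier by auto

lemma homogI: "\<gamma> \<in> arr \<Gamma> \<Longrightarrow> a \<in> A \<gamma> \<Longrightarrow> a \<in> homog \<Gamma> A"
  unfolding homog_def by auto

lemma pr_mem: "x \<in> carrier R \<Longrightarrow> \<gamma> \<in> arr \<Gamma> \<Longrightarrow> pr \<gamma> x \<in> A \<gamma>"
  by (rule proj_closed[OF direct_sum component_subgroup])

lemma pr_carrier [simp]: "x \<in> carrier R \<Longrightarrow> \<gamma> \<in> arr \<Gamma> \<Longrightarrow> pr \<gamma> x \<in> carrier R"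
  by (rule component_carrier[OF _ pr_mem])

lemma pr_finite: "x \<in> carrier R \<Longrightarrow> finite {\<gamma> \<in> arr \<Gamma>. pr \<gamma> x \<noteq> \<zero>}"
  by (rule proj_finite[OF direct_sum component_subgroup])

lemma pr_sum:
  "x \<in> carrier R \<Longrightarrow> finsum R (\<lambda>\<gamma>. pr \<gamma> x) {\<gamma> \<in> arr \<Gamma>. pr \<gamma> x \<noteq> \<zero>} = x"
  by (rule proj_sum[OF direct_sum component_subgroup])

lemma pr_finsum:
  "\<lbrakk>finite T; T \<subseteq> arr \<Gamma>; \<And>\<gamma>. \<gamma> \<in> T \<Longrightarrow> f \<gamma> \<in> A \<gamma>; \<gamma> \<in> arr \<Gamma>\<rbrakk>
    \<Longrightarrow> pr \<gamma> (finsum R f T) = (if \<gamma> \<in> T then f \<gamma> else \<zero>)"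
  by (rule proj_unique[OF direct_sum component_subgroup])

lemma pr_component:
  assumes "\<gamma> \<in> arr \<Gamma>" "\<delta> \<in> arr \<Gamma>" "a \<in> A \<delta>"
  shows "pr \<gamma> a = (if \<gamma> = \<delta> then a else \<zero>)"
  using pr_finsum[of "{\<delta>}" "\<lambda>_. a" \<gamma>] assms component_carrier by simp

lemma pr_zero [simp]: "\<gamma> \<in> arr \<Gamma> \<Longrightarrow> pr \<gamma> \<zero> = \<zero>"
  using pr_component component_zero by fastforce

lemma pr_add:
  assumes x: "x \<in> carrier R" and y: "y \<in> carrier R" and \<gamma>: "\<gamma> \<in> arr \<Gamma>"
  shows "pr \<gamma> (x \<oplus> y) = pr \<gamma> x \<oplus> pr \<gamma> y"
proof -
  let ?S = "\<lambda>x. {\<gamma> \<in> arr \<Gamma>. pr \<gamma> x \<noteq> \<zero>}"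
  let ?T = "?S x \<union> ?S y"
  have T: "finite ?T" "?T \<subseteq> arr \<Gamma>" using pr_finite x y by auto
  have "x = finsum R (\<lambda>\<gamma>. pr \<gamma> x) ?T"
    using finsum_support[of ?T "arr \<Gamma>" "\<lambda>\<gamma>. pr \<gamma> x"] T x pr_sum[OF x] by auto
  moreover have "y = finsum R (\<lambda>\<gamma>. pr \<gamma> y) ?T"
    using finsum_support[of ?T "arr \<Gamma>" "\<lambda>\<gamma>. pr \<gamma> y"] T y pr_sum[OF y] by auto
  ultimately have "x \<oplus> y = finsum R (\<lambda>\<gamma>. pr \<gamma> x) ?T \<oplus> finsum R (\<lambda>\<gamma>. pr \<gamma> y) ?T"
    by simp
  also have "\<dots> = finsum R (\<lambda>\<gamma>. pr \<gamma> x \<oplus> pr \<gamma> y) ?T"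
    using x y by (intro finsum_addf[symmetric]) auto
  finally have "x \<oplus> y = finsum R (\<lambda>\<gamma>. pr \<gamma> x \<oplus> pr \<gamma> y) ?T" .
  moreover have "pr \<gamma> x \<oplus> pr \<gamma> y \<in> A \<gamma>" if "\<gamma> \<in> ?T" for \<gamma>
  proof -
    have "\<gamma> \<in> arr \<Gamma>" using that by auto
    then show ?thesis
      using additive_subgroup.a_closed[OF component_subgroup] pr_mem x y by auto
  qed
  ultimately have "pr \<gamma> (x \<oplus> y) = (if \<gamma> \<in> ?T then pr \<gamma> x \<oplus> pr \<gamma> y else \<zero>)"
    using pr_finsum[of ?T "\<lambda>\<gamma>. pr \<gamma> x \<oplus> pr \<gamma> y" \<gamma>] T \<gamma> by simp
  then show ?thesis using \<gamma> by auto
qed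

lemma in_subgroup_if_pr:
  assumes "additive_subgroup H R" "x \<in> carrier R" "\<And>\<gamma>. \<gamma> \<in> arr \<Gamma> \<Longrightarrow> pr \<gamma> x \<in> H"
  shows "x \<in> H"
  using finsum_in_subgroup[OF assms(1), of "{\<gamma> \<in> arr \<Gamma>. pr \<gamma> x \<noteq> \<zero>}" "\<lambda>\<gamma>. pr \<gamma> x"]
    pr_sum assms by simp

lemma in_subgroup_if_homog:
  assumes "additive_subgroup H R" "x \<in> carrier R" "homog \<Gamma> A \<subseteq> H"
  shows "x \<in> H"
proof (rule in_subgroup_if_pr[OF assms(1,2)])
  fix \<gamma> assume "\<gamma> \<in> arr \<Gamma>"
  from homogI[OF this pr_mem[OF assms(2) this]] show "pr \<gamma> x \<in> H" using assms(3) by auto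
qed

lemma eq_if_pr_eq:
  assumes x: "x \<in> carrier R" and y: "y \<in> carrier R"
    and "\<And>\<gamma>. \<gamma> \<in> arr \<Gamma> \<Longrightarrow> pr \<gamma> x = pr \<gamma> y"
  shows "x = y"
proof -
  have S: "{\<gamma> \<in> arr \<Gamma>. pr \<gamma> x \<noteq> \<zero>} = {\<gamma> \<in> arr \<Gamma>. pr \<gamma> y \<noteq> \<zero>}" using assms(3) by auto
  have "finsum R (\<lambda>\<gamma>. pr \<gamma> x) {\<gamma> \<in> arr \<Gamma>. pr \<gamma> y \<noteq> \<zero>}
    = finsum R (\<lambda>\<gamma>. pr \<gamma> y) {\<gamma> \<in> arr \<Gamma>. pr \<gamma> y \<noteq> \<zero>}"
    using assms by (intro finsum_cong') auto
  then show ?thesis by (fold S, unfold pr_sum[OF x], unfold S, unfold pr_sum[OF y])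
qed

lemma homog_induct [consumes 1, case_names homog zero add]:
  assumes x: "x \<in> carrier R"
    and h: "\<And>\<gamma> a. \<gamma> \<in> arr \<Gamma> \<Longrightarrow> a \<in> A \<gamma> \<Longrightarrow> P a"
    and z: "P \<zero>"
    and a: "\<And>y z. y \<in> carrier R \<Longrightarrow> z \<in> carrier R \<Longrightarrow> P y \<Longrightarrow> P z \<Longrightarrow> P (y \<oplus> z)"
  shows "P x"
proof -
  have "P (finsum R (\<lambda>\<gamma>. pr \<gamma> x) T)" if "finite T" "T \<subseteq> arr \<Gamma>" for T
    using that
  proof (induction T)
    case empty then show ?case using z by simp
  next
    case (insert \<gamma> T)
    then have c: "(\<lambda>\<gamma>. pr \<gamma> x) \<in> T \<rightarrow> carrier R" "pr \<gamma> x \<in> carrier R" using x by auto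
    then have "P (pr \<gamma> x \<oplus> finsum R (\<lambda>\<gamma>. pr \<gamma> x) T)"
      using insert by (intro a h[OF _ pr_mem[OF x]] finsum_closed) auto
    then show ?case using insert c by (simp add: finsum_insert)
  qed
  from this[OF pr_finite[OF x]] show ?thesis using pr_sum[OF x] by simp
qed

text \<open>A ring has at most one two-sided identity, so the description in \<open>obj_one\<close>
  selects the \<open>u e\<close> whose mere existence is postulated by
  \<open>object_unital\<close>.\<close>

lemma obj_one_props:
  shows obj_mem: "e \<in> ids \<Gamma> \<Longrightarrow> obj e \<in> A e"
    and obj_tgt_mult: "\<gamma> \<in> arr \<Gamma> \<Longrightarrow> a \<in> A \<gamma> \<Longrightarrow> obj (tgt \<Gamma> \<gamma>) \<otimes> a = a"
    and obj_src_mult: "\<gamma> \<in> arr \<Gamma> \<Longrightarrow> a \<in> A \<gamma> \<Longrightarrow> a \<otimes> obj (src \<Gamma> \<gamma>) = a"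
proof -
  obtain u where u: "\<And>e. e \<in> ids \<Gamma> \<Longrightarrow> u e \<in> A e"
    "\<And>\<gamma> a. \<gamma> \<in> arr \<Gamma> \<Longrightarrow> a \<in> A \<gamma> \<Longrightarrow> u (tgt \<Gamma> \<gamma>) \<otimes> a = a \<and> a \<otimes> u (src \<Gamma> \<gamma>) = a"
    using object_unital by blast
  have eq: "obj e = u e" if e: "e \<in> ids \<Gamma>" for e
    unfolding obj_one_def
  proof (rule the_equality)
    show "u e \<in> A e \<and> (\<forall>a\<in>A e. u e \<otimes> a = a \<and> a \<otimes> u e = a)"
      using u(1)[OF e] u(2)[of e] e by auto
    fix v assume v: "v \<in> A e \<and> (\<forall>a\<in>A e. v \<otimes> a = a \<and> a \<otimes> v = a)"
    then show "v = u e"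
      using u(1)[OF e] u(2)[of e v] u(2)[of e "u e"] e by auto
  qed
  show "e \<in> ids \<Gamma> \<Longrightarrow> obj e \<in> A e" using eq u by simp
  show "\<gamma> \<in> arr \<Gamma> \<Longrightarrow> a \<in> A \<gamma> \<Longrightarrow> obj (tgt \<Gamma> \<gamma>) \<otimes> a = a"
    using eq u tgt_ids by simp
  show "\<gamma> \<in> arr \<Gamma> \<Longrightarrow> a \<in> A \<gamma> \<Longrightarrow> a \<otimes> obj (src \<Gamma> \<gamma>) = a"
    using eq u src_ids by simp
qed

lemma obj_homog: "e \<in> ids \<Gamma> \<Longrightarrow> obj e \<in> homog \<Gamma> A"
  using obj_mem[of e] homogI[of e] by auto

lemma obj_carrier [simp]: "e \<in> ids \<Gamma> \<Longrightarrow> obj e \<in> carrier R"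
  by (rule homog_carrier[OF obj_homog])

lemma obj_mult_component:
  assumes "e \<in> ids \<Gamma>" "\<gamma> \<in> arr \<Gamma>" "a \<in> A \<gamma>"
  shows "obj e \<otimes> a = (if tgt \<Gamma> \<gamma> = e then a else \<zero>)"
    and "a \<otimes> obj e = (if src \<Gamma> \<gamma> = e then a else \<zero>)"
  using assms obj_tgt_mult obj_src_mult mult_zero[of e \<gamma> "obj e" a] mult_zero[of \<gamma> e a "obj e"]
    obj_mem[OF assms(1)] by auto

lemma obj_idem: "e \<in> ids \<Gamma> \<Longrightarrow> obj e \<otimes> obj e = obj e"
  using obj_mult_component(1)[of e e "obj e"] obj_mem[of e] by auto

text \<open>Composing with an identity morphism does not change a degree, so \<open>u\<close> maps
  each component into itself. Besides \<open>obj e\<close>, this will be applied to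
  \<open>1_e - a b\<close> of degree \<open>e\<close>, whose right inverses are to be cut down to
  degree \<open>e\<close>.\<close>

lemma pr_mult_left_id:
  assumes e: "e \<in> ids \<Gamma>" and u: "u \<in> A e" and \<gamma>: "\<gamma> \<in> arr \<Gamma>" and y: "y \<in> carrier R"
  shows "pr \<gamma> (u \<otimes> y) = u \<otimes> pr \<gamma> y"
  using y
proof (induction y rule: homog_induct)
  case (homog \<delta> a)
  have u': "u \<in> carrier R" using component_carrier[of e] u e by auto
  show ?case
  proof (cases "e = tgt \<Gamma> \<delta>")
    case True
    then have "u \<otimes> a \<in> A \<delta>"
      using mult_component[of e \<delta> u a] e homog u cmp_tgt[of \<delta>] by auto
    then show ?thesis using homog \<gamma> u' by (simp add: pr_component)
  next
    case False
    then have "u \<otimes> a = \<zero>" using mult_zero[of e \<delta> u a] e homog u by auto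
    then show ?thesis using homog \<gamma> u' by (simp add: pr_component)
  qed
next
  case zero
  then show ?case using component_carrier[of e] u e \<gamma> by simp
next
  case (add y z)
  have u': "u \<in> carrier R" using component_carrier[of e] u e by auto
  then show ?case using add \<gamma> by (simp add: r_distr pr_add m_closed)
qed

lemma pr_obj_mult:
  assumes e: "e \<in> ids \<Gamma>" and \<gamma>: "\<gamma> \<in> arr \<Gamma>" and y: "y \<in> carrier R"
  shows "pr \<gamma> (obj e \<otimes> y) = (if tgt \<Gamma> \<gamma> = e then pr \<gamma> y else \<zero>)"
  using assms pr_mult_left_id[OF e obj_mem[OF e] \<gamma> y] obj_mult_component(1)[OF e \<gamma>] pr_mem
  by simp

lemma pr_mult_obj:
  assumes e: "e \<in> ids \<Gamma>" and \<gamma>: "\<gamma> \<in> arr \<Gamma>" and y: "y \<in> carrier R"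
  shows "pr \<gamma> (y \<otimes> obj e) = (if src \<Gamma> \<gamma> = e then pr \<gamma> y else \<zero>)"
  using y
proof (induction y rule: homog_induct)
  case (homog \<delta> a)
  then show ?case using e \<gamma> by (auto simp: obj_mult_component pr_component)
next
  case zero
  then show ?case using e \<gamma> by simp
next
  case (add y z)
  then show ?case using e \<gamma> by (simp add: l_distr pr_add m_closed split: if_splits)
qed

lemma homog_mult:
  assumes "a \<in> homog \<Gamma> A" "b \<in> homog \<Gamma> A"
  shows "a \<otimes> b \<in> homog \<Gamma> A"
proof -
  obtain \<gamma> \<delta> where g: "\<gamma> \<in> arr \<Gamma>" "a \<in> A \<gamma>" "\<delta> \<in> arr \<Gamma>" "b \<in> A \<delta>"
    using assms unfolding homog_def by auto
  show ?thesis
  proof (cases "src \<Gamma> \<gamma> = tgt \<Gamma> \<delta>")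
    case True
    then show ?thesis using g mult_component cmp_closed homogI by metis
  next
    case False
    then show ?thesis using g mult_zero component_zero homogI by metis
  qed
qed

text \<open>Morphisms can be cancelled on the left, so at most one component of \<open>y\<close>
  contributes to degree \<delta>. As a consequence principal right ideals of homogeneous elements
  are graded, with homogeneous multipliers for their components.\<close>

lemma pr_mult_homog:
  assumes a: "a \<in> homog \<Gamma> A" and y: "y \<in> carrier R" and \<delta>: "\<delta> \<in> arr \<Gamma>"
  shows "\<exists>b\<in>homog \<Gamma> A. pr \<delta> (a \<otimes> y) = a \<otimes> b"
proof -
  obtain \<gamma> where \<gamma>: "\<gamma> \<in> arr \<Gamma>" "a \<in> A \<gamma>" using a unfolding homog_def by auto
  have ac: "a \<in> carrier R" using a homog_carrier by auto
  show ?thesis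
  proof (cases "tgt \<Gamma> \<delta> = tgt \<Gamma> \<gamma>")
    case True
    obtain \<eta> where \<eta>: "\<eta> \<in> arr \<Gamma>" "src \<Gamma> \<eta> = tgt \<Gamma> \<gamma>" "tgt \<Gamma> \<eta> = src \<Gamma> \<gamma>"
      "cmp \<Gamma> \<eta> \<gamma> = src \<Gamma> \<gamma>" "cmp \<Gamma> \<gamma> \<eta> = tgt \<Gamma> \<gamma>" using inverse \<gamma> by blast
    \<comment> \<open>With \<eta> the inverse of \<gamma>, this is the only degree that \<gamma>
      carries to \<delta>.\<close>
    let ?\<epsilon> = "cmp \<Gamma> \<eta> \<delta>"
    have \<epsilon>: "?\<epsilon> \<in> arr \<Gamma>" "tgt \<Gamma> ?\<epsilon> = src \<Gamma> \<gamma>" using \<eta> \<delta> True by (simp_all add: cmp_closed tgt_cmp)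
    have "cmp \<Gamma> \<gamma> ?\<epsilon> = \<delta>"
      using cmp_assoc[of \<gamma> \<eta> \<delta>] \<eta> \<gamma> \<delta> True cmp_tgt[of \<delta>] by simp
    moreover have "\<zeta> = ?\<epsilon>" if "\<zeta> \<in> arr \<Gamma>" "src \<Gamma> \<gamma> = tgt \<Gamma> \<zeta>" "cmp \<Gamma> \<gamma> \<zeta> = \<delta>" for \<zeta>
      using cmp_assoc[of \<eta> \<gamma> \<zeta>] \<eta> \<gamma> that cmp_tgt[of \<zeta>] by simp
    ultimately have iff: "cmp \<Gamma> \<gamma> \<zeta> = \<delta> \<longleftrightarrow> \<zeta> = ?\<epsilon>" if "\<zeta> \<in> arr \<Gamma>" "src \<Gamma> \<gamma> = tgt \<Gamma> \<zeta>" for \<zeta>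
      using that by blast
    have "pr \<delta> (a \<otimes> y) = a \<otimes> pr ?\<epsilon> y"
      using y
    proof (induction y rule: homog_induct)
      case (homog \<zeta> b)
      show ?case
      proof (cases "src \<Gamma> \<gamma> = tgt \<Gamma> \<zeta>")
        case True
        then have "a \<otimes> b \<in> A (cmp \<Gamma> \<gamma> \<zeta>)" "cmp \<Gamma> \<gamma> \<zeta> \<in> arr \<Gamma>"
          using mult_component \<gamma> homog cmp_closed by auto
        then show ?thesis using iff[OF _ True] homog \<delta> \<epsilon> ac by (auto simp: pr_component)
      next
        case False
        then have "a \<otimes> b = \<zero>" using mult_zero \<gamma> homog by auto
        moreover have "\<zeta> \<noteq> ?\<epsilon>" using False \<epsilon> by auto
        ultimately show ?thesis using homog \<delta> \<epsilon> ac by (auto simp: pr_component)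
      qed
    qed (use ac \<delta> \<epsilon> in \<open>simp_all add: r_distr pr_add m_closed\<close>)
    then show ?thesis using pr_mem[OF y \<epsilon>(1)] homogI[OF \<epsilon>(1)] by blast
  next
    case False
    have "a \<otimes> y = obj (tgt \<Gamma> \<gamma>) \<otimes> (a \<otimes> y)"
      using \<gamma> ac y tgt_ids by (simp add: m_assoc[symmetric] obj_tgt_mult)
    then have "pr \<delta> (a \<otimes> y) = \<zero>"
      using pr_obj_mult[OF tgt_ids[OF \<gamma>(1)] \<delta> m_closed[OF ac y]] False by simp
    then show ?thesis using ac component_zero[OF \<delta>] homogI[OF \<delta>] by (intro bexI[of _ \<zero>]) auto
  qed
qed

end

section \<open>Graded right ideals and the graded radical\<close>

context graded_ring
begin

text \<open>By uniqueness of coordinates, the decomposition of \<open>u\<close> inside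
  \<open>U\<close> is its decomposition in \<open>R\<close>. Closure under components passes to
  sums, unions of chains and intersections more easily than a direct sum does.\<close>

lemma gr_right_ideal_iff:
  "gr_right_ideal \<Gamma> R A U \<longleftrightarrow> additive_subgroup U R \<and>
     (\<forall>u\<in>U. \<forall>x\<in>carrier R. u \<otimes> x \<in> U) \<and> (\<forall>u\<in>U. \<forall>\<gamma>\<in>arr \<Gamma>. pr \<gamma> u \<in> U)"
proof -
  have "is_direct_sum R (arr \<Gamma>) (\<lambda>\<gamma>. U \<inter> A \<gamma>) U \<longleftrightarrow> (\<forall>u\<in>U. \<forall>\<gamma>\<in>arr \<Gamma>. pr \<gamma> u \<in> U)"
    if U: "additive_subgroup U R"
  proof -
    have sub: "additive_subgroup (U \<inter> A \<gamma>) R" if "\<gamma> \<in> arr \<Gamma>" for \<gamma>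
      using add.subgroups_Inter_pair[OF additive_subgroup.a_subgroup additive_subgroup.a_subgroup,
          OF U component_subgroup[OF that]] by (rule additive_subgroupI)
    have c: "u \<in> carrier R" if "u \<in> U" for u
      using additive_subgroup.a_Hcarr[OF U that] .
    show ?thesis
    proof
      assume ds: "is_direct_sum R (arr \<Gamma>) (\<lambda>\<gamma>. U \<inter> A \<gamma>) U"
      show "\<forall>u\<in>U. \<forall>\<gamma>\<in>arr \<Gamma>. pr \<gamma> u \<in> U"
      proof (intro ballI)
        fix u \<gamma> assume u: "u \<in> U" and \<gamma>: "\<gamma> \<in> arr \<Gamma>"
        let ?f = "\<lambda>\<gamma>. proj R (arr \<Gamma>) (\<lambda>\<gamma>. U \<inter> A \<gamma>) \<gamma> u"
        have m: "?f \<gamma> \<in> U \<inter> A \<gamma>" if "\<gamma> \<in> arr \<Gamma>" for \<gamma>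
          using proj_closed[OF ds sub u that] by simp
        have "pr \<gamma> (finsum R ?f {\<gamma> \<in> arr \<Gamma>. ?f \<gamma> \<noteq> \<zero>}) = ?f \<gamma>"
          using pr_finsum[OF proj_finite[OF ds sub u], of ?f \<gamma>] m \<gamma> by auto
        then show "pr \<gamma> u \<in> U" using proj_sum[OF ds sub u] m \<gamma> by auto
      qed
    next
      assume g: "\<forall>u\<in>U. \<forall>\<gamma>\<in>arr \<Gamma>. pr \<gamma> u \<in> U"
      show "is_direct_sum R (arr \<Gamma>) (\<lambda>\<gamma>. U \<inter> A \<gamma>) U"
        using U sub g c pr_mem by (intro direct_sumI[where \<pi> = pr])
          (auto simp: pr_finite pr_sum pr_add pr_component)
    qed
  qed
  then show ?thesis unfolding gr_right_ideal_def by auto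
qed

lemma gr_right_idealD:
  assumes "gr_right_ideal \<Gamma> R A U"
  shows gr_right_ideal_subgroup: "additive_subgroup U R"
    and gr_right_ideal_mult: "\<And>u x. u \<in> U \<Longrightarrow> x \<in> carrier R \<Longrightarrow> u \<otimes> x \<in> U"
    and gr_right_ideal_pr: "\<And>u \<gamma>. u \<in> U \<Longrightarrow> \<gamma> \<in> arr \<Gamma> \<Longrightarrow> pr \<gamma> u \<in> U"
    and gr_right_ideal_carrier: "\<And>u. u \<in> U \<Longrightarrow> u \<in> carrier R"
    and gr_right_ideal_zero: "\<zero> \<in> U"
    and gr_right_ideal_add: "\<And>u v. u \<in> U \<Longrightarrow> v \<in> U \<Longrightarrow> u \<oplus> v \<in> U"
    and gr_right_ideal_minus: "\<And>u. u \<in> U \<Longrightarrow> \<ominus> u \<in> U"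
proof -
  show sub: "additive_subgroup U R" using assms by (simp add: gr_right_ideal_iff)
  interpret U: additive_subgroup U R by (rule sub)
  show "u \<in> U \<Longrightarrow> x \<in> carrier R \<Longrightarrow> u \<otimes> x \<in> U" for u x
    using assms by (simp add: gr_right_ideal_iff)
  show "u \<in> U \<Longrightarrow> \<gamma> \<in> arr \<Gamma> \<Longrightarrow> pr \<gamma> u \<in> U" for u \<gamma>
    using assms by (simp add: gr_right_ideal_iff)
  show "u \<in> U \<Longrightarrow> u \<in> carrier R" for u by simp
  show "\<zero> \<in> U" by simp
  show "u \<in> U \<Longrightarrow> v \<in> U \<Longrightarrow> u \<oplus> v \<in> U" for u v by simp
  show "u \<in> U \<Longrightarrow> \<ominus> u \<in> U" for u by simp
qed

lemma gr_right_idealI: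
  assumes "U \<subseteq> carrier R" "\<zero> \<in> U" "\<And>u v. u \<in> U \<Longrightarrow> v \<in> U \<Longrightarrow> u \<oplus> v \<in> U"
    "\<And>u. u \<in> U \<Longrightarrow> \<ominus> u \<in> U" "\<And>u x. u \<in> U \<Longrightarrow> x \<in> carrier R \<Longrightarrow> u \<otimes> x \<in> U"
    "\<And>u \<gamma>. u \<in> U \<Longrightarrow> \<gamma> \<in> arr \<Gamma> \<Longrightarrow> pr \<gamma> u \<in> U"
  shows "gr_right_ideal \<Gamma> R A U"
  using assms unfolding gr_right_ideal_iff by (simp add: additive_subgroup_criterion)

text \<open>Gradedness is the point: by \<open>pr_mult_homog\<close> the components of
  \<open>a y\<close> are again multiples of \<open>a\<close>.\<close>

lemma gr_right_ideal_principal: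
  assumes a: "a \<in> homog \<Gamma> A"
  shows "gr_right_ideal \<Gamma> R A {a \<otimes> y | y. y \<in> carrier R}"
proof (rule gr_right_idealI)
  have ac: "a \<in> carrier R" using homog_carrier[OF a] .
  show "{a \<otimes> y | y. y \<in> carrier R} \<subseteq> carrier R" using ac by (auto intro: m_closed)
  show "\<zero> \<in> {a \<otimes> y | y. y \<in> carrier R}" using ac by (auto intro!: exI[of _ \<zero>])
  show "u \<oplus> v \<in> {a \<otimes> y | y. y \<in> carrier R}"
    if "u \<in> {a \<otimes> y | y. y \<in> carrier R}" "v \<in> {a \<otimes> y | y. y \<in> carrier R}" for u v
  proof -
    obtain y y' where y: "u = a \<otimes> y" "v = a \<otimes> y'" "y \<in> carrier R" "y' \<in> carrier R" using \<open>u \<in> _\<close> \<open>v \<in> _\<close> by auto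
    then have "u \<oplus> v = a \<otimes> (y \<oplus> y')" using ac by (simp add: r_distr)
    then show ?thesis using y by auto
  qed
  show "\<ominus> u \<in> {a \<otimes> y | y. y \<in> carrier R}" if "u \<in> {a \<otimes> y | y. y \<in> carrier R}" for u
    using that ac r_minus[OF ac, symmetric] by auto
  show "u \<otimes> x \<in> {a \<otimes> y | y. y \<in> carrier R}"
    if "u \<in> {a \<otimes> y | y. y \<in> carrier R}" "x \<in> carrier R" for u x
    using that m_assoc[OF ac] m_closed by auto
  show "pr \<gamma> u \<in> {a \<otimes> y | y. y \<in> carrier R}"
    if "u \<in> {a \<otimes> y | y. y \<in> carrier R}" "\<gamma> \<in> arr \<Gamma>" for u \<gamma>
  proof -
    obtain y where y: "u = a \<otimes> y" "y \<in> carrier R" using \<open>u \<in> _\<close> by auto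
    then show ?thesis using pr_mult_homog[OF a y(2) \<open>\<gamma> \<in> _\<close>] homog_carrier by auto
  qed
qed

text \<open>The local identity at the source of the degree of \<open>a\<close> stands in for a
  global one.\<close>

lemma homog_in_principal:
  assumes "a \<in> homog \<Gamma> A"
  shows "a \<in> {a \<otimes> y | y. y \<in> carrier R}"
proof -
  obtain \<gamma> where \<gamma>: "\<gamma> \<in> arr \<Gamma>" "a \<in> A \<gamma>" using assms unfolding homog_def by auto
  then have "a = a \<otimes> obj (src \<Gamma> \<gamma>)" by (simp add: obj_src_mult)
  then show ?thesis using obj_carrier[OF src_ids[OF \<gamma>(1)]] by blast
qed

lemma gr_right_ideal_sum:
  assumes U: "gr_right_ideal \<Gamma> R A U" and V: "gr_right_ideal \<Gamma> R A V"
  shows "gr_right_ideal \<Gamma> R A (set_add R U V)"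
  unfolding gr_right_ideal_iff
proof (intro conjI ballI)
  show "additive_subgroup (set_add R U V) R"
    by (rule add_additive_subgroups[OF gr_right_ideal_subgroup[OF U] gr_right_ideal_subgroup[OF V]])
  note c = gr_right_ideal_carrier[OF U] gr_right_ideal_carrier[OF V]
  fix w assume "w \<in> set_add R U V"
  then obtain u v where w: "w = u \<oplus> v" "u \<in> U" "v \<in> V" by (auto simp: set_add_def')
  have mem: "u' \<oplus> v' \<in> set_add R U V" if "u' \<in> U" "v' \<in> V" for u' v'
    using that by (auto simp: set_add_def')
  show "w \<otimes> x \<in> set_add R U V" if "x \<in> carrier R" for x
    using w c that mem[OF gr_right_ideal_mult[OF U] gr_right_ideal_mult[OF V]]
    by (simp add: l_distr)
  show "pr \<gamma> w \<in> set_add R U V" if "\<gamma> \<in> arr \<Gamma>" for \<gamma>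
    using w c that mem[OF gr_right_ideal_pr[OF U] gr_right_ideal_pr[OF V]]
    by (simp add: pr_add)
qed

end

text \<open>
  For \<open>a\<close> of degree \<open>\<gamma>\<close> and \<open>e = tgt \<gamma>\<close> this says that \<open>1\<^sub>e - a b\<close> has
  the right inverse \<open>z\<close> in \<open>A e\<close>, for all homogeneous \<open>b\<close> with \<open>a b\<close> of degree
  \<open>e\<close>. Subtraction is avoided because \<^const>\<open>a_minus\<close> depends on the carrier, which
  differs between a ring and its corners.
\<close>

definition quasi_regular ::
    "('g, 'x) groupoid_scheme \<Rightarrow> ('a, 'm) ring_scheme \<Rightarrow> ('g \<Rightarrow> 'a set) \<Rightarrow> 'g \<Rightarrow> 'a \<Rightarrow> bool" where
  "quasi_regular \<Gamma> R A e a \<longleftrightarrow> (\<forall>b\<in>homog \<Gamma> A. a \<otimes>\<^bsub>R\<^esub> b \<in> A e \<longrightarrow>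
     (\<exists>z\<in>A e. z = obj_one R A e \<oplus>\<^bsub>R\<^esub> a \<otimes>\<^bsub>R\<^esub> b \<otimes>\<^bsub>R\<^esub> z))"

section \<open>Radical membership as local right invertibility\<close>

context graded_ring
begin

text \<open>If \<open>a\<close> is not in \<open>M\<close>, then \<open>M + a R = R\<close>, so
  \<open>1_e = m + a b\<close> with \<open>m\<close> in \<open>M\<close>. Multiplying by a right
  inverse \<open>z\<close> of \<open>1_e - a b = m\<close> gives \<open>1_e = m z\<close>, so
  \<open>1_e\<close> and hence \<open>a = 1_e a\<close> would lie in \<open>M\<close>.\<close>

lemma quasi_regular_imp_maximal:
  assumes \<gamma>: "\<gamma> \<in> arr \<Gamma>" and a: "a \<in> A \<gamma>" and q: "quasi_regular \<Gamma> R A (tgt \<Gamma> \<gamma>) a"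
    and M: "gr_maximal \<Gamma> R A M"
  shows "a \<in> M"
proof (rule ccontr)
  assume aM: "a \<notin> M"
  let ?e = "tgt \<Gamma> \<gamma>"
  have e: "?e \<in> ids \<Gamma>" using \<gamma> tgt_ids by simp
  have ah: "a \<in> homog \<Gamma> A" using a \<gamma> homogI by simp
  have ac: "a \<in> carrier R" using ah homog_carrier by simp
  let ?V = "set_add R M {a \<otimes> y | y. y \<in> carrier R}"
  have Mi: "gr_right_ideal \<Gamma> R A M" using M by (simp add: gr_maximal_def)
  note Mc = gr_right_ideal_carrier[OF Mi]
  have V: "gr_right_ideal \<Gamma> R A ?V"
    using gr_right_ideal_sum[OF Mi gr_right_ideal_principal[OF ah]] .
  have "M \<subseteq> ?V"
  proof
    fix m assume m: "m \<in> M"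
    have "m \<oplus> a \<otimes> \<zero> \<in> ?V" using m unfolding set_add_def' by blast
    then show "m \<in> ?V" using ac Mc[OF m] by simp
  qed
  moreover have "a \<in> ?V"
    using homog_in_principal[OF ah] gr_right_ideal_zero[OF Mi] ac
    by (auto simp: set_add_def' intro!: bexI[of _ \<zero>])
  ultimately have "?V = carrier R" using M V aM unfolding gr_maximal_def by blast
  then have "obj ?e \<in> ?V" using e by simp
  then obtain m y where my: "obj ?e = m \<oplus> a \<otimes> y" "m \<in> M" "y \<in> carrier R"
    by (auto simp: set_add_def')
  \<comment> \<open>Passing to the component of degree \<open>e\<close> replaces \<open>y\<close> by
    a homogeneous multiplier, as \<open>quasi_regular\<close> requires.\<close>
  obtain b where b: "b \<in> homog \<Gamma> A" "pr ?e (a \<otimes> y) = a \<otimes> b"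
    using pr_mult_homog[OF ah my(3), of ?e] e by auto
  have bc: "b \<in> carrier R" using b homog_carrier by simp
  let ?m = "pr ?e m"
  have m: "?m \<in> M" "?m \<in> carrier R" using my(2) gr_right_ideal_pr[OF Mi] Mc e by auto
  have "pr ?e (obj ?e) = ?m \<oplus> a \<otimes> b"
    unfolding b(2)[symmetric] using my ac e Mc by (simp add: pr_add m_closed)
  then have 1: "obj ?e = ?m \<oplus> a \<otimes> b" using pr_component[OF _ _ obj_mem[OF e], of ?e] e by simp
  have "a \<otimes> b \<in> A ?e"
    unfolding b(2)[symmetric] using pr_mem[OF m_closed[OF ac my(3)]] e by simp
  then obtain z where z: "z \<in> A ?e" "z = obj ?e \<oplus> a \<otimes> b \<otimes> z"
    using q b(1) unfolding quasi_regular_def by blast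
  have zc: "z \<in> carrier R" using component_carrier[OF _ z(1)] e by simp
  have "z = obj ?e \<otimes> z" using z(1) e obj_mult_component(1)[OF e _ z(1)] by simp
  also have "\<dots> = ?m \<otimes> z \<oplus> a \<otimes> b \<otimes> z" using 1 m ac bc zc by (simp add: l_distr m_closed)
  finally have "obj ?e \<oplus> a \<otimes> b \<otimes> z = ?m \<otimes> z \<oplus> a \<otimes> b \<otimes> z" using z(2) by simp
  then have "obj ?e = ?m \<otimes> z" using m ac bc zc e by (simp add: m_closed)
  then have "obj ?e \<in> M" using gr_right_ideal_mult[OF Mi m(1) zc] by simp
  then have "obj ?e \<otimes> a \<in> M" using gr_right_ideal_mult[OF Mi _ ac] by simp
  then show False using aM \<gamma> a by (simp add: obj_tgt_mult)
qed

lemma gr_right_ideal_chain_Union: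
  assumes "C \<noteq> {}" "\<And>U. U \<in> C \<Longrightarrow> gr_right_ideal \<Gamma> R A U" "\<And>U V. U \<in> C \<Longrightarrow> V \<in> C \<Longrightarrow> U \<subseteq> V \<or> V \<subseteq> U"
  shows "gr_right_ideal \<Gamma> R A (\<Union>C)"
proof (rule gr_right_idealI)
  show "\<Union>C \<subseteq> carrier R" using assms(2) gr_right_ideal_carrier by blast
  show "\<zero> \<in> \<Union>C" using assms(1,2) gr_right_ideal_zero by blast
  show "u \<oplus> v \<in> \<Union>C" if uv: "u \<in> \<Union>C" "v \<in> \<Union>C" for u v
  proof -
    obtain U V where "u \<in> U" "v \<in> V" "U \<in> C" "V \<in> C" using uv by blast
    then obtain W where "u \<in> W" "v \<in> W" "W \<in> C" using assms(3)[of U V] by blast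
    then show ?thesis using gr_right_ideal_add[OF assms(2)] by blast
  qed
  show "\<ominus> u \<in> \<Union>C" if "u \<in> \<Union>C" for u
    using that gr_right_ideal_minus[OF assms(2)] by blast
  show "u \<otimes> x \<in> \<Union>C" if "u \<in> \<Union>C" "x \<in> carrier R" for u x
    using that gr_right_ideal_mult[OF assms(2)] by blast
  show "pr \<gamma> u \<in> \<Union>C" if "u \<in> \<Union>C" "\<gamma> \<in> arr \<Gamma>" for u \<gamma>
    using that gr_right_ideal_pr[OF assms(2)] by blast
qed

text \<open>By \<open>compl\<close>, an ideal above \<open>N\<close> that contains
  \<open>1_e\<close> is everything. Hence above \<open>N\<close> being proper means missing
  \<open>1_e\<close>, a condition preserved by unions of chains.\<close>

lemma gr_maximal_avoiding:
  assumes e: "e \<in> ids \<Gamma>" and N: "gr_right_ideal \<Gamma> R A N" and eN: "obj e \<notin> N"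
    and compl: "\<And>x. x \<in> carrier R \<Longrightarrow> obj e \<otimes> x = \<zero> \<Longrightarrow> x \<in> N"
  obtains M where "gr_maximal \<Gamma> R A M" "N \<subseteq> M" "obj e \<notin> M"
proof -
  let ?S = "{V. gr_right_ideal \<Gamma> R A V \<and> N \<subseteq> V \<and> obj e \<notin> V}"
  have "\<exists>M\<in>?S. \<forall>X\<in>?S. M \<subseteq> X \<longrightarrow> X = M"
  proof (rule subset_Zorn_nonempty)
    show "?S \<noteq> {}" using N eN by blast
    fix C assume C: "C \<noteq> {}" "subset.chain ?S C"
    then have sub: "C \<subseteq> ?S" and ch: "\<And>U V. U \<in> C \<Longrightarrow> V \<in> C \<Longrightarrow> U \<subseteq> V \<or> V \<subseteq> U"
      unfolding subset_chain_def by auto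
    have "gr_right_ideal \<Gamma> R A (\<Union>C)"
      using sub ch by (intro gr_right_ideal_chain_Union[OF C(1)]) auto
    then show "\<Union>C \<in> ?S" using sub C(1) by blast
  qed
  then obtain M where MS: "M \<in> ?S" and max: "\<forall>X\<in>?S. M \<subseteq> X \<longrightarrow> X = M" by (rule bexE)
  then have M: "gr_right_ideal \<Gamma> R A M" "N \<subseteq> M" "obj e \<notin> M" by auto
  have "V = M" if V: "gr_right_ideal \<Gamma> R A V" "V \<noteq> carrier R" "M \<subseteq> V" for V
  proof -
    have "obj e \<notin> V"
    proof
      assume eV: "obj e \<in> V"
      have "x \<in> V" if x: "x \<in> carrier R" for x
      proof -
        \<comment> \<open>Peirce decomposition: \<open>x\<close> is \<open>1_e x\<close>, which lies
          in \<open>V\<close>, plus an element killed by \<open>1_e\<close> on the left, which lies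
          in \<open>N\<close>.\<close>
        let ?y = "\<ominus> (obj e \<otimes> x) \<oplus> x"
        have "obj e \<otimes> ?y = \<zero>"
          using x e by (simp add: r_distr r_minus m_closed m_assoc[symmetric] obj_idem l_neg)
        then have "?y \<in> N" using x e by (intro compl) (simp_all add: m_closed)
        then have "?y \<in> V" using V(3) M(2) by blast
        moreover have "obj e \<otimes> x \<in> V" using gr_right_ideal_mult[OF V(1) eV x] .
        ultimately have "obj e \<otimes> x \<oplus> ?y \<in> V" using gr_right_ideal_add[OF V(1)] by blast
        then show ?thesis using x e by (simp add: m_closed a_assoc[symmetric] r_neg)
      qed
      then show False using V(2) gr_right_ideal_carrier[OF V(1)] by blast
    qed
    then have "V \<in> ?S" using V M by auto
    then show ?thesis using max V by blast
  qed
  moreover have "M \<noteq> carrier R" using M(3) e by auto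
  ultimately have "gr_maximal \<Gamma> R A M" unfolding gr_maximal_def using M by blast
  with M that show ?thesis by blast
qed

text \<open>If \<open>u = 1_e - a b\<close> had no right inverse in \<open>A e\<close>, then some
  gr-maximal \<open>M\<close> would contain \<open>u\<close>. It also contains \<open>a b\<close>,
  since \<open>a\<close> is in the radical, and so it would contain \<open>1_e\<close>, which it was
  built to miss. Here \<open>a\<close> need not be homogeneous.\<close>

lemma rad_imp_quasi_regular:
  assumes e: "e \<in> ids \<Gamma>" and ar: "a \<in> gr_rad \<Gamma> R A"
  shows "quasi_regular \<Gamma> R A e a"
  unfolding quasi_regular_def
proof (intro ballI impI)
  fix b assume b: "b \<in> homog \<Gamma> A" and ab: "a \<otimes> b \<in> A e"
  have ac: "a \<in> carrier R" using ar by (simp add: gr_rad_def)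
  have bc: "b \<in> carrier R" using b homog_carrier by simp
  have abc: "a \<otimes> b \<in> carrier R" using ac bc m_closed by simp
  let ?u = "obj e \<oplus> \<ominus> (a \<otimes> b)"
  interpret Ae: additive_subgroup "A e" R using e by (simp add: component_subgroup)
  have "\<ominus> (a \<otimes> b) \<in> A e"
    using subgroup.m_inv_closed[OF Ae.a_subgroup, of "a \<otimes> b"] ab unfolding a_inv_def by simp
  then have u: "?u \<in> A e" "?u \<in> carrier R"
    using ab obj_mem[OF e] by auto
  \<comment> \<open>This is \<open>u R\<close> enlarged by all \<open>x\<close> with
    \<open>1_e x = 0\<close>, the shape demanded by \<open>gr_maximal_avoiding\<close>.\<close>
  let ?N = "{x \<in> carrier R. \<exists>y\<in>carrier R. obj e \<otimes> x = ?u \<otimes> y}"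
  show "\<exists>z\<in>A e. z = obj e \<oplus> a \<otimes> b \<otimes> z"
  proof (rule ccontr)
    assume no: "\<not> ?thesis"
    have N: "gr_right_ideal \<Gamma> R A ?N"
    proof (rule gr_right_idealI)
      show "\<zero> \<in> ?N" using u e by (auto intro!: bexI[of _ \<zero>])
      fix x assume x: "x \<in> ?N"
      then obtain y where y: "y \<in> carrier R" "obj e \<otimes> x = ?u \<otimes> y" "x \<in> carrier R" by auto
      show "x \<oplus> x' \<in> ?N" if x': "x' \<in> ?N" for x'
      proof -
        obtain y' where y': "y' \<in> carrier R" "obj e \<otimes> x' = ?u \<otimes> y'" "x' \<in> carrier R" using x' by auto
        have "obj e \<otimes> (x \<oplus> x') = ?u \<otimes> (y \<oplus> y')"
          using y y' e r_distr[OF y(3) y'(3), of "obj e"] r_distr[OF y(1) y'(1) u(2)] by simp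
        then show ?thesis using y y' by auto
      qed
      show "\<ominus> x \<in> ?N"
      proof -
        have "obj e \<otimes> (\<ominus> x) = ?u \<otimes> (\<ominus> y)"
          using y e r_minus[OF _ y(3), of "obj e"] r_minus[OF u(2) y(1)] by simp
        then show ?thesis using y by auto
      qed
      show "x \<otimes> t \<in> ?N" if t: "t \<in> carrier R" for t
      proof -
        have "obj e \<otimes> (x \<otimes> t) = ?u \<otimes> (y \<otimes> t)"
          using y e m_assoc[OF _ y(3) t, of "obj e"] m_assoc[OF u(2) y(1) t] by simp
        then show ?thesis using y t by (auto simp: m_closed)
      qed
      show "pr \<gamma> x \<in> ?N" if \<gamma>: "\<gamma> \<in> arr \<Gamma>" for \<gamma>
      proof -
        have "obj e \<otimes> pr \<gamma> x = ?u \<otimes> pr \<gamma> y"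
          using pr_mult_left_id[OF e u(1) \<gamma> y(1)] pr_mult_left_id[OF e obj_mem[OF e] \<gamma> y(3)] y(2)
          by simp
        then show ?thesis using y \<gamma> by auto
      qed
    qed auto
    have eN: "obj e \<notin> ?N"
    proof
      assume "obj e \<in> ?N"
      then obtain y where y: "y \<in> carrier R" "obj e \<otimes> obj e = ?u \<otimes> y" by auto
      \<comment> \<open>Left multiplication by \<open>u\<close> commutes with taking components, so
        the component of degree \<open>e\<close> of a right inverse is again a right
        inverse.\<close>
      let ?z = "pr e y"
      have z: "?z \<in> A e" "?z \<in> carrier R" using y e pr_mem by auto
      have "pr e (obj e) = ?u \<otimes> ?z"
        using pr_mult_left_id[OF e u(1) _ y(1), of e] y(2) e by (simp add: obj_idem)
      then have "obj e = ?u \<otimes> ?z" using pr_component[of e e "obj e"] obj_mem[OF e] e by simp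
      also have "\<dots> = obj e \<otimes> ?z \<oplus> \<ominus> (a \<otimes> b) \<otimes> ?z"
        using z e abc by (simp add: l_distr)
      also have "\<dots> = ?z \<oplus> \<ominus> (a \<otimes> b \<otimes> ?z)"
        using z e abc obj_mult_component(1)[OF e _ z(1)] by (simp add: l_minus)
      finally have eq: "obj e = ?z \<oplus> \<ominus> (a \<otimes> b \<otimes> ?z)" .
      have "obj e \<oplus> a \<otimes> b \<otimes> ?z = ?z"
        by (subst eq) (use z abc in \<open>simp add: a_assoc m_closed l_neg\<close>)
      then show False using no z(1) by force
    qed
    obtain M where M: "gr_maximal \<Gamma> R A M" "?N \<subseteq> M" "obj e \<notin> M"
    proof (rule gr_maximal_avoiding[OF e N eN])
      fix x assume "x \<in> carrier R" "obj e \<otimes> x = \<zero>"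
      then show "x \<in> ?N" using u by (auto intro!: bexI[of _ \<zero>])
    qed auto
    have Mi: "gr_right_ideal \<Gamma> R A M" using M by (simp add: gr_maximal_def)
    have "?u \<in> ?N"
    proof -
      have "obj e \<otimes> ?u = ?u" using obj_mult_component(1)[OF e _ u(1)] e by simp
      moreover have "?u \<otimes> obj e = ?u" using obj_mult_component(2)[OF e _ u(1)] e by simp
      ultimately show ?thesis using u e by (auto intro!: bexI[of _ "obj e"])
    qed
    then have "?u \<in> M" using M by blast
    moreover have "a \<otimes> b \<in> M"
      using ar M(1) gr_right_ideal_mult[OF Mi _ bc] unfolding gr_rad_def by auto
    ultimately have "?u \<oplus> a \<otimes> b \<in> M" using gr_right_ideal_add[OF Mi] by blast
    then have "obj e \<in> M" using abc e by (simp add: a_assoc l_neg)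
    then show False using M(3) by blast
  qed
qed

text \<open>Trades gr-maximal ideals, which a ring and its corner do not share, for equations in
  \<open>A e\<close>, which they do.\<close>

lemma rad_component_iff:
  assumes "\<gamma> \<in> arr \<Gamma>" "a \<in> A \<gamma>"
  shows "a \<in> gr_rad \<Gamma> R A \<longleftrightarrow> quasi_regular \<Gamma> R A (tgt \<Gamma> \<gamma>) a"
  using rad_imp_quasi_regular tgt_ids quasi_regular_imp_maximal assms component_carrier
  unfolding gr_rad_def by blast

section \<open>The radical as a two-sided graded ideal\<close>

lemma rad_right_ideal: "gr_right_ideal \<Gamma> R A (gr_rad \<Gamma> R A)"
proof (rule gr_right_idealI)
  have i: "gr_right_ideal \<Gamma> R A M" if "gr_maximal \<Gamma> R A M" for M
    using that by (simp add: gr_maximal_def)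
  show "gr_rad \<Gamma> R A \<subseteq> carrier R" by (auto simp: gr_rad_def)
  show "\<zero> \<in> gr_rad \<Gamma> R A" using gr_right_ideal_zero[OF i] by (auto simp: gr_rad_def)
  fix u assume u: "u \<in> gr_rad \<Gamma> R A"
  then have uM: "u \<in> carrier R" "\<And>M. gr_maximal \<Gamma> R A M \<Longrightarrow> u \<in> M" by (auto simp: gr_rad_def)
  show "u \<oplus> v \<in> gr_rad \<Gamma> R A" if v: "v \<in> gr_rad \<Gamma> R A" for v
    using gr_right_ideal_add[OF i] uM v by (auto simp: gr_rad_def)
  show "\<ominus> u \<in> gr_rad \<Gamma> R A"
    using gr_right_ideal_minus[OF i] uM by (auto simp: gr_rad_def)
  show "u \<otimes> x \<in> gr_rad \<Gamma> R A" if x: "x \<in> carrier R" for x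
    using gr_right_ideal_mult[OF i] uM x by (auto simp: gr_rad_def m_closed)
  show "pr \<gamma> u \<in> gr_rad \<Gamma> R A" if \<gamma>: "\<gamma> \<in> arr \<Gamma>" for \<gamma>
    using gr_right_ideal_pr[OF i] uM \<gamma> by (auto simp: gr_rad_def)
qed

text \<open>If \<open>1 - a b x\<close> has the right inverse \<open>z\<close>, then \<open>1 - x a b\<close> has the right
  inverse \<open>1 + x z a b\<close>.\<close>

lemma rad_left_mult_homog:
  assumes \<delta>: "\<delta> \<in> arr \<Gamma>" "x \<in> A \<delta>" and \<gamma>: "\<gamma> \<in> arr \<Gamma>" "a \<in> A \<gamma>" and ar: "a \<in> gr_rad \<Gamma> R A"
  shows "x \<otimes> a \<in> gr_rad \<Gamma> R A"
proof (cases "src \<Gamma> \<delta> = tgt \<Gamma> \<gamma>")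
  case False
  then show ?thesis using mult_zero \<delta> \<gamma> gr_right_ideal_zero[OF rad_right_ideal] by simp
next
  case True
  have ac: "a \<in> carrier R" and xc: "x \<in> carrier R" using \<delta> \<gamma> component_carrier by auto
  let ?f = "tgt \<Gamma> \<delta>" and ?e = "tgt \<Gamma> \<gamma>"
  have f: "?f \<in> ids \<Gamma>" and e: "?e \<in> ids \<Gamma>" using \<delta> \<gamma> tgt_ids by auto
  have xa: "x \<otimes> a \<in> A (cmp \<Gamma> \<delta> \<gamma>)" "cmp \<Gamma> \<delta> \<gamma> \<in> arr \<Gamma>" "tgt \<Gamma> (cmp \<Gamma> \<delta> \<gamma>) = ?f"
    using mult_component \<delta> \<gamma> True cmp_closed tgt_cmp by auto
  have "quasi_regular \<Gamma> R A ?f (x \<otimes> a)"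
    unfolding quasi_regular_def
  proof (intro ballI impI)
    fix b assume b: "b \<in> homog \<Gamma> A" and xab: "x \<otimes> a \<otimes> b \<in> A ?f"
    have bc: "b \<in> carrier R" using b homog_carrier by simp
    obtain \<beta> where \<beta>: "\<beta> \<in> arr \<Gamma>" "b \<in> A \<beta>" using b unfolding homog_def by auto
    show "\<exists>z\<in>A ?f. z = obj ?f \<oplus> x \<otimes> a \<otimes> b \<otimes> z"
    \<comment> \<open>If \<open>x a b\<close> vanishes, its degree carries no information, but then
      the identity at the target of \<delta> is itself the required \<open>z\<close>.\<close>
    proof (cases "x \<otimes> a \<otimes> b = \<zero>")
      case True
      then show ?thesis using f obj_mem by (auto intro!: bexI[of _ "obj ?f"])
    next
      case nz: False
      then have "a \<otimes> b \<noteq> \<zero>" using xc ac bc by (auto simp: m_assoc)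
      then have 1: "src \<Gamma> \<gamma> = tgt \<Gamma> \<beta>" using mult_zero \<gamma> \<beta> by blast
      let ?\<zeta> = "cmp \<Gamma> \<gamma> \<beta>"
      have z: "?\<zeta> \<in> arr \<Gamma>" "a \<otimes> b \<in> A ?\<zeta>" "tgt \<Gamma> ?\<zeta> = ?e" "src \<Gamma> ?\<zeta> = src \<Gamma> \<beta>"
        using cmp_closed mult_component tgt_cmp src_cmp \<gamma> \<beta> 1 by auto
      have dz: "x \<otimes> (a \<otimes> b) \<in> A (cmp \<Gamma> \<delta> ?\<zeta>)" "cmp \<Gamma> \<delta> ?\<zeta> \<in> arr \<Gamma>"
        using mult_component[of \<delta> ?\<zeta>] \<delta> z True cmp_closed by auto
      \<comment> \<open>A nonzero element determines its degree. So \<open>a b\<close> has degree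
        inverse to that of \<open>x\<close>, and the reordered product \<open>a b x\<close> has an
        identity as degree.\<close>
      have "cmp \<Gamma> \<delta> ?\<zeta> = ?f"
        using pr_component[OF dz(2) _ xab] pr_component[OF dz(2,2,1)] nz f m_assoc[OF xc ac bc]
        by (auto split: if_splits)
      moreover obtain \<eta> where \<eta>: "\<eta> \<in> arr \<Gamma>" "src \<Gamma> \<eta> = tgt \<Gamma> \<delta>" "tgt \<Gamma> \<eta> = src \<Gamma> \<delta>"
        "cmp \<Gamma> \<eta> \<delta> = src \<Gamma> \<delta>" using inverse \<delta> by blast
      ultimately have "?\<zeta> = \<eta>"
        using cmp_assoc[of \<eta> \<delta> ?\<zeta>] \<delta> z True cmp_tgt[of ?\<zeta>] cmp_src[of \<eta>] by simp
      then have "a \<otimes> b \<otimes> x \<in> A ?e"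
        using mult_component[of \<eta> \<delta> "a \<otimes> b" x] \<eta> \<delta> z True by simp
      then have "a \<otimes> (b \<otimes> x) \<in> A ?e" using ac bc xc by (simp add: m_assoc)
      moreover have "b \<otimes> x \<in> homog \<Gamma> A" using homog_mult b homogI \<delta> by simp
      ultimately obtain z where z: "z \<in> A ?e" "z = obj ?e \<oplus> a \<otimes> (b \<otimes> x) \<otimes> z"
        using rad_imp_quasi_regular[OF e ar] unfolding quasi_regular_def by blast
      have zc: "z \<in> carrier R" using component_carrier[OF _ z(1)] e by simp
      have xe: "x \<otimes> obj ?e = x" using obj_src_mult \<delta> True by metis
      let ?w = "x \<otimes> z \<otimes> (a \<otimes> b)"
      have fab: "obj ?f \<otimes> (x \<otimes> a \<otimes> b) = x \<otimes> a \<otimes> b" "(x \<otimes> a \<otimes> b) \<otimes> obj ?f = x \<otimes> a \<otimes> b"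
        using obj_mult_component[OF f _ xab] f by simp_all
      have "x \<otimes> z = x \<otimes> obj ?e \<oplus> x \<otimes> (a \<otimes> (b \<otimes> x) \<otimes> z)"
        using z(2) xc ac bc zc e r_distr[of "obj ?e" "a \<otimes> (b \<otimes> x) \<otimes> z" x]
        by (simp add: m_closed)
      then have "?w = (x \<oplus> x \<otimes> (a \<otimes> (b \<otimes> x) \<otimes> z)) \<otimes> (a \<otimes> b)" using xe by simp
      also have "\<dots> = x \<otimes> a \<otimes> b \<oplus> x \<otimes> a \<otimes> b \<otimes> ?w"
        using xc ac bc zc by (simp add: l_distr m_closed m_assoc)
      also have "\<dots> = x \<otimes> a \<otimes> b \<otimes> (obj ?f \<oplus> ?w)"
        using xc ac bc zc f fab by (simp add: r_distr m_closed)
      finally have "obj ?f \<oplus> ?w = obj ?f \<oplus> x \<otimes> a \<otimes> b \<otimes> (obj ?f \<oplus> ?w)" by simp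
      moreover have "obj ?f \<oplus> ?w \<in> A ?f"
      proof -
        have "x \<otimes> z \<in> A \<delta>"
          using mult_component[of \<delta> ?e x z] \<delta> e z(1) True cmp_src[of \<delta>] by simp
        then have "x \<otimes> z \<otimes> (a \<otimes> b) \<in> A (cmp \<Gamma> \<delta> ?\<zeta>)"
          using mult_component[of \<delta> ?\<zeta> "x \<otimes> z" "a \<otimes> b"] \<delta> True \<open>?\<zeta> = \<eta>\<close> \<eta>
            mult_component[of \<gamma> \<beta> a b] \<gamma> \<beta> 1 by simp
        then show ?thesis
          using \<open>cmp \<Gamma> \<delta> ?\<zeta> = ?f\<close> additive_subgroup.a_closed[OF component_subgroup] obj_mem[OF f] f
          by simp
      qed
      ultimately show ?thesis by blast
    qed
  qed
  then show ?thesis using rad_component_iff[OF xa(2,1)] xa(3) by simp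
qed

end

section \<open>Graded ideals and semisimplicity\<close>

definition gr_ideal ::
    "('g, 'x) groupoid_scheme \<Rightarrow> ('a, 'm) ring_scheme \<Rightarrow> ('g \<Rightarrow> 'a set) \<Rightarrow> 'a set \<Rightarrow> bool" where
  "gr_ideal \<Gamma> R A K \<longleftrightarrow> gr_right_ideal \<Gamma> R A K \<and> (\<forall>x\<in>carrier R. \<forall>k\<in>K. x \<otimes>\<^bsub>R\<^esub> k \<in> K)"

text \<open>The homogeneous \<open>a\<close> such that \<open>(a R + K) / K\<close> is gr-simple.\<close>

definition simple_elems ::
    "('g, 'x) groupoid_scheme \<Rightarrow> ('a, 'm) ring_scheme \<Rightarrow> ('g \<Rightarrow> 'a set) \<Rightarrow> 'a set \<Rightarrow> 'a set" where
  "simple_elems \<Gamma> R A K = {a \<in> homog \<Gamma> A. a \<notin> K \<and>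
     (\<forall>c\<in>homog \<Gamma> A. a \<otimes>\<^bsub>R\<^esub> c \<notin> K \<longrightarrow>
       (\<exists>d\<in>carrier R. \<exists>k\<in>K. a = a \<otimes>\<^bsub>R\<^esub> c \<otimes>\<^bsub>R\<^esub> d \<oplus>\<^bsub>R\<^esub> k))}"

context nonunital_ring
begin

text \<open>With its mirror image below, this makes membership of a product in \<open>H\<close> an
  additive condition on either factor, to be tested on generators only.\<close>

lemma left_quotient_subgroup:
  assumes "additive_subgroup H R" "x \<in> carrier R"
  shows "additive_subgroup {t \<in> carrier R. x \<otimes> t \<in> H} R"
proof -
  interpret H: additive_subgroup H R by fact
  show ?thesis using assms(2) by (intro additive_subgroup_criterion) (auto simp: r_distr r_minus)
qed

lemma right_quotient_subgroup:
  assumes "additive_subgroup H R" "x \<in> carrier R"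
  shows "additive_subgroup {t \<in> carrier R. t \<otimes> x \<in> H} R"
proof -
  interpret H: additive_subgroup H R by fact
  show ?thesis using assms(2) by (intro additive_subgroup_criterion) (auto simp: l_distr l_minus)
qed

end

context graded_ring
begin

text \<open>Both factors may be taken homogeneous, because membership in the radical is additive in
  each of them and the radical contains the components of its elements.\<close>

lemma rad_ideal: "gr_ideal \<Gamma> R A (gr_rad \<Gamma> R A)"
  unfolding gr_ideal_def
proof (intro conjI ballI)
  let ?J = "gr_rad \<Gamma> R A"
  show "gr_right_ideal \<Gamma> R A ?J" by (rule rad_right_ideal)
  note J = gr_right_ideal_subgroup[OF rad_right_ideal]
  fix x a assume x: "x \<in> carrier R" and a: "a \<in> ?J"
  have ac: "a \<in> carrier R" using gr_right_ideal_carrier[OF rad_right_ideal a] .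
  have "x \<in> {t \<in> carrier R. t \<otimes> a \<in> ?J}"
  proof (rule in_subgroup_if_homog[OF right_quotient_subgroup[OF J ac] x])
    show "homog \<Gamma> A \<subseteq> {t \<in> carrier R. t \<otimes> a \<in> ?J}"
    proof
      fix t assume t: "t \<in> homog \<Gamma> A"
      then obtain \<delta> where \<delta>: "\<delta> \<in> arr \<Gamma>" "t \<in> A \<delta>" unfolding homog_def by auto
      have tc: "t \<in> carrier R" using homog_carrier[OF t] .
      have "a \<in> {s \<in> carrier R. t \<otimes> s \<in> ?J}"
      proof (rule in_subgroup_if_pr[OF left_quotient_subgroup[OF J tc] ac])
        fix \<gamma> assume \<gamma>: "\<gamma> \<in> arr \<Gamma>"
        show "pr \<gamma> a \<in> {s \<in> carrier R. t \<otimes> s \<in> ?J}"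
          using rad_left_mult_homog[OF \<delta> \<gamma> pr_mem[OF ac \<gamma>] gr_right_ideal_pr[OF rad_right_ideal a \<gamma>]]
            pr_carrier[OF ac \<gamma>] by simp
      qed
      then show "t \<in> {t \<in> carrier R. t \<otimes> a \<in> ?J}" using tc by simp
    qed
  qed
  then show "x \<otimes> a \<in> ?J" by simp
qed

text \<open>The nonzero graded right ideal \<open>a c R\<close> inside \<open>U\<close> must be
  \<open>U\<close>, and so contains \<open>a\<close>.\<close>

lemma homog_in_simple:
  assumes U: "gr_simple \<Gamma> R A U" and a: "a \<in> U" "a \<in> homog \<Gamma> A" "a \<noteq> \<zero>"
  shows "a \<in> simple_elems \<Gamma> R A {\<zero>}"
  unfolding simple_elems_def
proof (intro CollectI conjI ballI impI)
  have Ui: "gr_right_ideal \<Gamma> R A U" using U by (simp add: gr_simple_def)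
  have ac: "a \<in> carrier R" using a homog_carrier by simp
  fix c assume c: "c \<in> homog \<Gamma> A" "a \<otimes> c \<notin> {\<zero>}"
  have cc: "c \<in> carrier R" using c homog_carrier by simp
  have ach: "a \<otimes> c \<in> homog \<Gamma> A" using homog_mult a c by simp
  let ?V = "{a \<otimes> c \<otimes> y | y. y \<in> carrier R}"
  have "?V \<subseteq> U" using gr_right_ideal_mult[OF Ui] a cc by auto
  moreover have "?V \<noteq> {\<zero>}" using homog_in_principal[OF ach] c by blast
  ultimately have "?V = U" using U gr_right_ideal_principal[OF ach] unfolding gr_simple_def by blast
  then obtain y where "a = a \<otimes> c \<otimes> y" "y \<in> carrier R" using a(1) by blast
  then have "a = a \<otimes> c \<otimes> y \<oplus> \<zero>" using ac by simp
  then show "\<exists>d\<in>carrier R. \<exists>k\<in>{\<zero>}. a = a \<otimes> c \<otimes> d \<oplus> k" using \<open>y \<in> carrier R\<close> by blast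
qed (use a in auto)

text \<open>A nonzero graded \<open>V\<close> inside \<open>a R\<close> contains a nonzero
  component, which is \<open>a c\<close> with \<open>c\<close> homogeneous. The condition on
  \<open>a\<close> recovers \<open>a\<close> from \<open>a c\<close>, so \<open>V\<close> is all of
  \<open>a R\<close>.\<close>

lemma gr_simple_principal:
  assumes a: "a \<in> simple_elems \<Gamma> R A {\<zero>}"
  shows "gr_simple \<Gamma> R A {a \<otimes> y | y. y \<in> carrier R}"
  unfolding gr_simple_def
proof (intro conjI allI impI)
  let ?U = "{a \<otimes> y | y. y \<in> carrier R}"
  have ah: "a \<in> homog \<Gamma> A" "a \<noteq> \<zero>" using a by (auto simp: simple_elems_def)
  have ac: "a \<in> carrier R" using ah homog_carrier by simp
  show "gr_right_ideal \<Gamma> R A ?U" by (rule gr_right_ideal_principal[OF ah(1)])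
  show "?U \<noteq> {\<zero>}" using homog_in_principal[OF ah(1)] ah by blast
  fix V assume V: "gr_right_ideal \<Gamma> R A V" "V \<subseteq> ?U"
  have "V = ?U" if "V \<noteq> {\<zero>}"
  proof -
    have "{\<zero>} \<subset> V" using that gr_right_ideal_zero[OF V(1)] by (intro psubsetI) simp_all
    then obtain v where v: "v \<in> V" "v \<noteq> \<zero>" using psubset_imp_ex_mem by blast
    have vc: "v \<in> carrier R" using gr_right_ideal_carrier[OF V(1) v(1)] .
    obtain \<gamma> where \<gamma>: "\<gamma> \<in> arr \<Gamma>" "pr \<gamma> v \<noteq> \<zero>"
      using eq_if_pr_eq[OF vc, of \<zero>] v(2) by auto
    obtain y where y: "y \<in> carrier R" "v = a \<otimes> y" using V(2) v(1) by blast
    obtain c where c: "c \<in> homog \<Gamma> A" "pr \<gamma> v = a \<otimes> c"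
      using pr_mult_homog[OF ah(1) y(1) \<gamma>(1)] y(2) by blast
    have "a \<otimes> c \<notin> {\<zero>}" using c \<gamma> by simp
    then obtain d where d: "d \<in> carrier R" "a = a \<otimes> c \<otimes> d \<oplus> \<zero>"
      using a c(1) unfolding simple_elems_def by blast
    have "a \<otimes> c \<in> V" using gr_right_ideal_pr[OF V(1) v(1) \<gamma>(1)] c by simp
    then have "a \<otimes> c \<otimes> d \<in> V" using gr_right_ideal_mult[OF V(1) _ d(1)] by simp
    moreover have "a = a \<otimes> c \<otimes> d" using d ac homog_carrier[OF c(1)] by (simp add: m_closed)
    ultimately have "a \<in> V" by simp
    then show ?thesis using V(2) gr_right_ideal_mult[OF V(1)] by blast
  qed
  then show "V = {\<zero>} \<or> V = ?U" by blast
qed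

text \<open>A gr-simple ideal is spanned by its nonzero homogeneous elements, each of which is in
  \<open>simple_elems\<close>. Conversely each such element lies in the gr-simple ideal that it
  generates.\<close>

lemma gr_semisimple_iff:
  "gr_semisimple \<Gamma> R A \<longleftrightarrow>
     carrier R = generate (add_monoid R) (simple_elems \<Gamma> R A {\<zero>})"
proof
  let ?E = "simple_elems \<Gamma> R A {\<zero>}"
  have E: "?E \<subseteq> carrier R" using homog_carrier by (auto simp: simple_elems_def)
  note G = additive_subgroup_generate[OF E]
  {
    assume "gr_semisimple \<Gamma> R A"
    then obtain S where S: "\<And>U. U \<in> S \<Longrightarrow> gr_simple \<Gamma> R A U" "carrier R = generate (add_monoid R) (\<Union>S)"
      unfolding gr_semisimple_def subgroups_sum_def by blast
    have "\<Union>S \<subseteq> generate (add_monoid R) ?E"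
    proof
      fix u assume "u \<in> \<Union>S"
      then obtain U where U: "u \<in> U" "gr_simple \<Gamma> R A U" using S by blast
      have Ui: "gr_right_ideal \<Gamma> R A U" using U by (simp add: gr_simple_def)
      note uc = gr_right_ideal_carrier[OF Ui U(1)]
      show "u \<in> generate (add_monoid R) ?E"
      proof (rule in_subgroup_if_pr[OF G uc])
        fix \<gamma> assume \<gamma>: "\<gamma> \<in> arr \<Gamma>"
        show "pr \<gamma> u \<in> generate (add_monoid R) ?E"
        proof (cases "pr \<gamma> u = \<zero>")
          case True
          then show ?thesis using additive_subgroup.zero_closed[OF G] by simp
        next
          case False
          then show ?thesis
            using homog_in_simple[OF U(2) gr_right_ideal_pr[OF Ui U(1) \<gamma>] homogI[OF \<gamma> pr_mem[OF uc \<gamma>]]]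
            by (simp add: generate.incl)
        qed
      qed
    qed
    then show "carrier R = generate (add_monoid R) ?E"
      using generate_le[OF G] S(2) additive_subgroup.a_subset[OF G] by blast
  next
    assume eq: "carrier R = generate (add_monoid R) ?E"
    let ?S = "(\<lambda>a. {a \<otimes> y | y. y \<in> carrier R}) ` ?E"
    have "\<Union>?S \<subseteq> carrier R" using E m_closed by blast
    note G' = additive_subgroup_generate[OF this]
    have "?E \<subseteq> \<Union>?S" using homog_in_principal by (auto simp: simple_elems_def)
    then have "?E \<subseteq> generate (add_monoid R) (\<Union>?S)" by (meson generate.incl subset_iff)
    then have "carrier R = generate (add_monoid R) (\<Union>?S)"
      using generate_le[OF G'] eq additive_subgroup.a_subset[OF G'] by blast
    moreover have "\<forall>U\<in>?S. gr_simple \<Gamma> R A U" using gr_simple_principal by auto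
    ultimately show "gr_semisimple \<Gamma> R A"
      unfolding gr_semisimple_def subgroups_sum_def by (intro exI[of _ ?S] conjI)
  }
qed

end


section \<open>Quotients by graded ideals\<close>

locale graded_ring_ideal = graded_ring \<Gamma> R A for \<Gamma> and R (structure) and A +
  fixes K
  assumes gr_ideal: "gr_ideal \<Gamma> R A K"
begin

lemma K_right_ideal: "gr_right_ideal \<Gamma> R A K"
  using gr_ideal by (simp add: gr_ideal_def)

sublocale K: abelian_subgroup K R
  by (rule abelian_subgroupI3[OF gr_right_ideal_subgroup[OF K_right_ideal] abelian_group_axioms])

lemma K_r: "k \<in> K \<Longrightarrow> x \<in> carrier R \<Longrightarrow> k \<otimes> x \<in> K"
  using gr_right_ideal_mult[OF K_right_ideal] .

lemma K_l: "k \<in> K \<Longrightarrow> x \<in> carrier R \<Longrightarrow> x \<otimes> k \<in> K"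
  using gr_ideal by (simp add: gr_ideal_def)

abbreviation Q where "Q \<equiv> R Quot K"
abbreviation q where "q x \<equiv> K +> x"
abbreviation B where "B \<equiv> quot_grading R A K"

lemma q_eq_iff:
  assumes "x \<in> carrier R" "y \<in> carrier R"
  shows "q x = q y \<longleftrightarrow> (\<exists>k\<in>K. x = k \<oplus> y)"
proof
  assume "q x = q y"
  then have "x \<in> q y" using K.a_rcos_self[OF assms(1)] by simp
  then show "\<exists>k\<in>K. x = k \<oplus> y" by (auto simp: a_r_coset_def')
next
  assume "\<exists>k\<in>K. x = k \<oplus> y"
  then have "x \<in> q y" by (auto simp: a_r_coset_def')
  then show "q x = q y" using K.a_repr_independence' assms(2) by blast
qed

lemma q_eq_K_iff: "x \<in> carrier R \<Longrightarrow> q x = K \<longleftrightarrow> x \<in> K"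
  using K.a_rcos_const K.a_rcos_self by blast

lemma q_of_zero: "q \<zero> = K"
  using q_eq_K_iff[of \<zero>] by simp

lemma q_carrier: "carrier Q = q ` carrier R"
  by (auto simp: FactRing_def A_RCOSETS_def')

lemma q_zero: "\<zero>\<^bsub>Q\<^esub> = K"
  by (simp add: FactRing_def)

lemma q_add: "x \<in> carrier R \<Longrightarrow> y \<in> carrier R \<Longrightarrow> q x \<oplus>\<^bsub>Q\<^esub> q y = q (x \<oplus> y)"
  by (simp add: FactRing_def K.a_rcos_sum)

text \<open>\<open>FactRing\<close> multiplies cosets by a union over all pairs of representatives.
  As \<open>K\<close> is two-sided, all cosets in that union coincide.\<close>

lemma q_mult:
  assumes x: "x \<in> carrier R" and y: "y \<in> carrier R"
  shows "q x \<otimes>\<^bsub>Q\<^esub> q y = q (x \<otimes> y)"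
proof -
  have eq: "q (x' \<otimes> y') = q (x \<otimes> y)" if x': "x' \<in> q x" and y': "y' \<in> q y" for x' y'
  proof -
    obtain k where "k \<in> K" "x' = k \<oplus> x" using x' by (auto simp: a_r_coset_def')
    moreover obtain l where "l \<in> K" "y' = l \<oplus> y" using y' by (auto simp: a_r_coset_def')
    ultimately have kl: "x' = k \<oplus> x" "y' = l \<oplus> y" "k \<in> K" "l \<in> K" by auto
    have "x' \<otimes> y' = (k \<otimes> l \<oplus> k \<otimes> y \<oplus> x \<otimes> l) \<oplus> x \<otimes> y"
      using kl x y K.a_Hcarr by (simp add: l_distr r_distr m_closed a_ac)
    moreover have "k \<otimes> l \<oplus> k \<otimes> y \<oplus> x \<otimes> l \<in> K"
      using kl x y K_l K_r K.a_Hcarr by simp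
    ultimately show ?thesis
      using kl x y K.a_Hcarr by (subst q_eq_iff) (auto simp: m_closed)
  qed
  have "q x \<otimes>\<^bsub>Q\<^esub> q y = (\<Union>a\<in>q x. \<Union>b\<in>q y. q (a \<otimes> b))"
    by (simp add: FactRing_def rcoset_mult_def)
  also have "\<dots> = (\<Union>a\<in>q x. \<Union>b\<in>q y. q (x \<otimes> y))"
    by (intro SUP_cong refl eq)
  also have "\<dots> = q (x \<otimes> y)"
    using K.a_rcos_self[OF x] K.a_rcos_self[OF y] by blast
  finally show ?thesis .
qed

lemma quot_abelian_group: "abelian_group Q"
  by (rule comm_group_abelian_groupI)
    (simp add: FactRing_def K.a_factorgroup_is_comm_group[unfolded A_FactGroup_def'])

lemma quot_nonunital_ring: "nonunital_ring Q"
proof -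
  interpret Q: abelian_group Q by (rule quot_abelian_group)
  show ?thesis
    by unfold_locales
      (auto simp: q_carrier q_mult q_add m_closed m_assoc l_distr r_distr)
qed

lemma B_eq:
  assumes \<gamma>: "\<gamma> \<in> arr \<Gamma>"
  shows "B \<gamma> = q ` A \<gamma>"
proof -
  have eq: "q (a \<oplus> k) = q a" if "a \<in> A \<gamma>" "k \<in> K" for a k
    using component_carrier[OF \<gamma> that(1)] that(2)
    by (subst q_eq_iff) (auto intro!: bexI[of _ k] simp: a_comm)
  have "B \<gamma> = (\<Union>a\<in>A \<gamma>. \<Union>k\<in>K. {q (a \<oplus> k)})"
    by (auto simp: quot_grading_def set_add_def')
  also have "\<dots> = (\<Union>a\<in>A \<gamma>. \<Union>k\<in>K. {q a})"
    by (intro SUP_cong refl) (simp add: eq)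
  also have "\<dots> = q ` A \<gamma>" using K.zero_closed by blast
  finally show ?thesis .
qed

lemma q_finsum:
  assumes "finite T" "f \<in> T \<rightarrow> carrier R"
  shows "finsum Q (\<lambda>i. q (f i)) T = q (finsum R f T)"
proof -
  interpret Q: abelian_group Q by (rule quot_abelian_group)
  show ?thesis
    using assms
  proof (induction T)
    case empty
    then show ?case by (simp add: q_zero q_of_zero)
  next
    case (insert i T)
    then have c: "f \<in> T \<rightarrow> carrier R" "f i \<in> carrier R" "(\<lambda>i. q (f i)) \<in> T \<rightarrow> carrier Q"
      "q (f i) \<in> carrier Q"
      by (auto simp: q_carrier)
    then show ?case
      using insert by (simp add: finsum_insert Q.finsum_insert q_add finsum_closed)
  qed
qed

text \<open>The chosen representative does not matter, since \<open>K\<close> is closed under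
  components; \<open>quot_pr_q\<close> shows this. These are the coordinate maps handed to
  \<open>direct_sumI\<close> for the quotient.\<close>

definition quot_pr where "quot_pr \<gamma> X = q (pr \<gamma> (SOME x. x \<in> carrier R \<and> q x = X))"

lemma quot_pr_q:
  assumes x: "x \<in> carrier R" and \<gamma>: "\<gamma> \<in> arr \<Gamma>"
  shows "quot_pr \<gamma> (q x) = q (pr \<gamma> x)"
proof -
  let ?y = "SOME y. y \<in> carrier R \<and> q y = q x"
  have y: "?y \<in> carrier R \<and> q ?y = q x" by (rule someI[of _ x]) (simp add: x)
  then obtain k where k: "k \<in> K" "?y = k \<oplus> x" using q_eq_iff x by blast
  have "pr \<gamma> ?y = pr \<gamma> k \<oplus> pr \<gamma> x" unfolding k(2) using k x \<gamma> by (simp add: pr_add)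
  then show ?thesis
    unfolding quot_pr_def using k x y \<gamma> gr_right_ideal_pr[OF K_right_ideal]
    by (subst q_eq_iff) auto
qed

lemma quot_graded_ring: "graded_ring \<Gamma> Q B"
proof -
  interpret Q: nonunital_ring Q by (rule quot_nonunital_ring)
  have Bsub: "additive_subgroup (B \<gamma>) Q" if \<gamma>: "\<gamma> \<in> arr \<Gamma>" for \<gamma>
  proof -
    interpret Ag: additive_subgroup "A \<gamma>" R using \<gamma> by (rule component_subgroup)
    have "\<ominus>\<^bsub>Q\<^esub> q a = q (\<ominus> a)" if "a \<in> A \<gamma>" for a
      using that by (intro Q.minus_equality) (auto simp: q_add q_carrier l_neg q_zero q_of_zero)
    moreover have "K \<in> q ` A \<gamma>" using q_of_zero Ag.zero_closed by (metis imageI)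
    ultimately show ?thesis
      unfolding B_eq[OF \<gamma>]
      by (intro Q.additive_subgroup_criterion) (auto simp: q_carrier q_add q_zero)
  qed
  have Bc: "B \<gamma> \<subseteq> carrier Q" if "\<gamma> \<in> arr \<Gamma>" for \<gamma>
    using additive_subgroup.a_subset[OF Bsub[OF that]] .
  have fin: "finite {\<gamma> \<in> arr \<Gamma>. q (pr \<gamma> x) \<noteq> K}" and
    sum: "finsum Q (\<lambda>\<gamma>. q (pr \<gamma> x)) {\<gamma> \<in> arr \<Gamma>. q (pr \<gamma> x) \<noteq> K} = q x"
    if x: "x \<in> carrier R" for x
  proof -
    let ?T = "{\<gamma> \<in> arr \<Gamma>. pr \<gamma> x \<noteq> \<zero>}"
    have sub: "{\<gamma> \<in> arr \<Gamma>. q (pr \<gamma> x) \<noteq> K} \<subseteq> ?T" by (auto simp: q_of_zero)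
    then show "finite {\<gamma> \<in> arr \<Gamma>. q (pr \<gamma> x) \<noteq> K}" using pr_finite[OF x] finite_subset by blast
    have "finsum Q (\<lambda>\<gamma>. q (pr \<gamma> x)) {\<gamma> \<in> arr \<Gamma>. q (pr \<gamma> x) \<noteq> K}
      = finsum Q (\<lambda>\<gamma>. q (pr \<gamma> x)) ?T"
      using sub x
      by (intro Q.finsum_support[OF pr_finite[OF x], unfolded q_zero]) (simp_all add: q_carrier)
    also have "\<dots> = q (finsum R (\<lambda>\<gamma>. pr \<gamma> x) ?T)"
      using pr_finite[OF x] x by (intro q_finsum) auto
    finally show "finsum Q (\<lambda>\<gamma>. q (pr \<gamma> x)) {\<gamma> \<in> arr \<Gamma>. q (pr \<gamma> x) \<noteq> K} = q x"
      using pr_sum[OF x] by simp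
  qed
  have ds: "is_direct_sum Q (arr \<Gamma>) B (carrier Q)"
  proof (rule Q.direct_sumI[where \<pi> = quot_pr])
    show "additive_subgroup (carrier Q) Q"
      by (rule Q.additive_subgroup_criterion) auto
    fix X assume "X \<in> carrier Q"
    then obtain x where x: "x \<in> carrier R" "X = q x" by (auto simp: q_carrier)
    show "quot_pr \<gamma> X \<in> B \<gamma>" if "\<gamma> \<in> arr \<Gamma>" for \<gamma>
      using that x pr_mem by (simp add: quot_pr_q B_eq)
    have eq: "{\<gamma> \<in> arr \<Gamma>. quot_pr \<gamma> X \<noteq> \<zero>\<^bsub>Q\<^esub>} = {\<gamma> \<in> arr \<Gamma>. q (pr \<gamma> x) \<noteq> K}"
      by (rule Collect_cong) (use x in \<open>simp add: quot_pr_q q_zero cong: conj_cong\<close>)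
    show "finite {\<gamma> \<in> arr \<Gamma>. quot_pr \<gamma> X \<noteq> \<zero>\<^bsub>Q\<^esub>}" unfolding eq using fin x by simp
    have "finsum Q (\<lambda>\<gamma>. quot_pr \<gamma> X) {\<gamma> \<in> arr \<Gamma>. q (pr \<gamma> x) \<noteq> K}
      = finsum Q (\<lambda>\<gamma>. q (pr \<gamma> x)) {\<gamma> \<in> arr \<Gamma>. q (pr \<gamma> x) \<noteq> K}"
      using x by (intro Q.finsum_cong' refl) (simp_all add: quot_pr_q q_carrier)
    then show "finsum Q (\<lambda>\<gamma>. quot_pr \<gamma> X) {\<gamma> \<in> arr \<Gamma>. quot_pr \<gamma> X \<noteq> \<zero>\<^bsub>Q\<^esub>} = X"
      unfolding eq using sum x by simp
    fix \<gamma> Y assume \<gamma>: "\<gamma> \<in> arr \<Gamma>" and "Y \<in> carrier Q"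
    then obtain y where y: "y \<in> carrier R" "Y = q y" by (auto simp: q_carrier)
    show "quot_pr \<gamma> (X \<oplus>\<^bsub>Q\<^esub> Y) = quot_pr \<gamma> X \<oplus>\<^bsub>Q\<^esub> quot_pr \<gamma> Y"
      using x y \<gamma> by (simp add: q_add quot_pr_q pr_add)
  next
    fix \<gamma> \<delta> X assume "\<gamma> \<in> arr \<Gamma>" "\<delta> \<in> arr \<Gamma>" "X \<in> B \<delta>"
    then obtain a where "a \<in> A \<delta>" "X = q a" by (auto simp: B_eq)
    then show "quot_pr \<gamma> X = (if \<gamma> = \<delta> then X else \<zero>\<^bsub>Q\<^esub>)"
      using \<open>\<gamma> \<in> arr \<Gamma>\<close> \<open>\<delta> \<in> arr \<Gamma>\<close> component_carrier[of \<delta> a]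
      by (simp add: quot_pr_q pr_component q_zero q_of_zero)
  qed (use Bsub Bc in auto)
  have mc: "X \<otimes>\<^bsub>Q\<^esub> Y \<in> B (cmp \<Gamma> \<gamma> \<delta>)"
    if "\<gamma> \<in> arr \<Gamma>" "\<delta> \<in> arr \<Gamma>" "src \<Gamma> \<gamma> = tgt \<Gamma> \<delta>" "X \<in> B \<gamma>" "Y \<in> B \<delta>" for \<gamma> \<delta> X Y
    using that component_carrier mult_component cmp_closed by (auto simp: B_eq q_mult)
  have mz: "X \<otimes>\<^bsub>Q\<^esub> Y = \<zero>\<^bsub>Q\<^esub>"
    if "\<gamma> \<in> arr \<Gamma>" "\<delta> \<in> arr \<Gamma>" "src \<Gamma> \<gamma> \<noteq> tgt \<Gamma> \<delta>" "X \<in> B \<gamma>" "Y \<in> B \<delta>" for \<gamma> \<delta> X Y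
    using that component_carrier mult_zero by (auto simp: B_eq q_mult q_zero q_of_zero)
  have ou: "\<exists>u. (\<forall>e\<in>ids \<Gamma>. u e \<in> B e) \<and>
      (\<forall>\<gamma>\<in>arr \<Gamma>. \<forall>a\<in>B \<gamma>. u (tgt \<Gamma> \<gamma>) \<otimes>\<^bsub>Q\<^esub> a = a \<and> a \<otimes>\<^bsub>Q\<^esub> u (src \<Gamma> \<gamma>) = a)"
    using obj_mem obj_tgt_mult obj_src_mult component_carrier src_ids tgt_ids
    by (intro exI[of _ "\<lambda>e. q (obj e)"]) (auto simp: B_eq q_mult)
  show ?thesis
    by (intro graded_ring.intro graded_ring_axioms.intro groupoid_axioms quot_nonunital_ring)
      (fact Bsub ds mc mz ou)+
qed

lemma quot_homog: "homog \<Gamma> B = q ` homog \<Gamma> A"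
  unfolding homog_def using B_eq by auto

text \<open>The summand \<open>k\<close> in \<open>simple_elems\<close> turns equality into equality
  modulo \<open>K\<close>, so the condition on \<open>a\<close> is literally the condition for the
  zero ideal on the coset of \<open>a\<close>.\<close>

lemma quot_simple_elems: "simple_elems \<Gamma> Q B {K} = q ` simple_elems \<Gamma> R A K"
proof -
  have iff: "q a \<in> simple_elems \<Gamma> Q B {K} \<longleftrightarrow> a \<in> simple_elems \<Gamma> R A K" if a: "a \<in> homog \<Gamma> A" for a
  proof -
    have ac: "a \<in> carrier R" using homog_carrier[OF a] .
    have 1: "q a \<otimes>\<^bsub>Q\<^esub> q c = q (a \<otimes> c)" "q a \<otimes>\<^bsub>Q\<^esub> q c \<notin> {K} \<longleftrightarrow> a \<otimes> c \<notin> K"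
      if "c \<in> carrier R" for c
      using that ac q_eq_K_iff by (auto simp: q_mult m_closed)
    have 2: "(\<exists>D\<in>carrier Q. \<exists>k\<in>{K}. q a = q a \<otimes>\<^bsub>Q\<^esub> q c \<otimes>\<^bsub>Q\<^esub> D \<oplus>\<^bsub>Q\<^esub> k)
      \<longleftrightarrow> (\<exists>d\<in>carrier R. \<exists>k\<in>K. a = a \<otimes> c \<otimes> d \<oplus> k)" if c: "c \<in> carrier R" for c
    proof -
      have "q a \<otimes>\<^bsub>Q\<^esub> q c \<otimes>\<^bsub>Q\<^esub> q d \<oplus>\<^bsub>Q\<^esub> K = q (a \<otimes> c \<otimes> d)" if "d \<in> carrier R" for d
        using q_add[of "a \<otimes> c \<otimes> d" \<zero>] q_of_zero that c ac by (simp add: q_mult m_closed)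
      moreover have "q a = q (a \<otimes> c \<otimes> d) \<longleftrightarrow> (\<exists>k\<in>K. a = a \<otimes> c \<otimes> d \<oplus> k)" if "d \<in> carrier R" for d
        using that c ac K.a_Hcarr by (subst q_eq_iff) (auto simp: m_closed a_comm)
      ultimately show ?thesis unfolding q_carrier by simp
    qed
    show ?thesis
      unfolding simple_elems_def quot_homog using a ac q_eq_K_iff 1 2 homog_carrier by auto
  qed
  show ?thesis
  proof
    show "simple_elems \<Gamma> Q B {K} \<subseteq> q ` simple_elems \<Gamma> R A K"
    proof
      fix X assume X: "X \<in> simple_elems \<Gamma> Q B {K}"
      then obtain a where "a \<in> homog \<Gamma> A" "X = q a"
        unfolding simple_elems_def quot_homog by blast
      then show "X \<in> q ` simple_elems \<Gamma> R A K" using iff X by blast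
    qed
    show "q ` simple_elems \<Gamma> R A K \<subseteq> simple_elems \<Gamma> Q B {K}"
    proof
      fix X assume "X \<in> q ` simple_elems \<Gamma> R A K"
      then obtain a where a: "a \<in> simple_elems \<Gamma> R A K" "X = q a" by blast
      then have "a \<in> homog \<Gamma> A" by (simp add: simple_elems_def)
      then show "X \<in> simple_elems \<Gamma> Q B {K}" using iff a by simp
    qed
  qed
qed

text \<open>Images of subgroups of \<open>R\<close>, and preimages of subgroups of the quotient, are
  subgroups; the preimages contain \<open>K\<close>.\<close>

lemma quot_generate:
  assumes S: "S \<subseteq> carrier R"
  shows "carrier Q = generate (add_monoid Q) (q ` S) \<longleftrightarrow>
    carrier R = generate (add_monoid R) (S \<union> K)"
proof -
  interpret Q: abelian_group Q by (rule quot_abelian_group)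
  have SK: "S \<union> K \<subseteq> carrier R" using S K.a_subset by blast
  have qS: "q ` S \<subseteq> carrier Q" using S q_carrier by auto
  interpret H: additive_subgroup "generate (add_monoid R) (S \<union> K)" R
    by (rule additive_subgroup_generate[OF SK])
  interpret H': additive_subgroup "generate (add_monoid Q) (q ` S)" Q
    by (rule Q.additive_subgroup_generate[OF qS])
  have minus: "\<ominus>\<^bsub>Q\<^esub> q a = q (\<ominus> a)" if "a \<in> carrier R" for a
    using that by (intro Q.minus_equality) (auto simp: q_add q_carrier l_neg q_zero q_of_zero)
  note Kz = q_of_zero[symmetric]
  show ?thesis
  proof
    assume eq: "carrier Q = generate (add_monoid Q) (q ` S)"
    have "additive_subgroup (q ` generate (add_monoid R) (S \<union> K)) Q"
    proof (rule Q.additive_subgroup_criterion)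
      show "\<zero>\<^bsub>Q\<^esub> \<in> q ` generate (add_monoid R) (S \<union> K)" unfolding q_zero using Kz by auto
    qed (auto simp: q_carrier q_add minus)
    then have "generate (add_monoid Q) (q ` S) \<subseteq> q ` generate (add_monoid R) (S \<union> K)"
      by (rule Q.generate_le) (auto intro: generate.incl)
    with eq have "carrier Q \<subseteq> q ` generate (add_monoid R) (S \<union> K)"
      by (rule ord_eq_le_trans)
    then have le: "q x \<in> q ` generate (add_monoid R) (S \<union> K)" if "x \<in> carrier R" for x
      using that q_carrier by blast
    have "carrier R \<subseteq> generate (add_monoid R) (S \<union> K)"
    proof
      fix x assume x: "x \<in> carrier R"
      obtain h where h: "h \<in> generate (add_monoid R) (S \<union> K)" "q x = q h" using le[OF x] by blast
      then obtain k where "k \<in> K" "x = k \<oplus> h" using q_eq_iff x by auto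
      then show "x \<in> generate (add_monoid R) (S \<union> K)"
        using h by (auto intro: H.a_closed generate.incl)
    qed
    then show "carrier R = generate (add_monoid R) (S \<union> K)" using H.a_subset by blast
  next
    assume eq: "carrier R = generate (add_monoid R) (S \<union> K)"
    let ?P = "{x \<in> carrier R. q x \<in> generate (add_monoid Q) (q ` S)}"
    have z: "K \<in> generate (add_monoid Q) (q ` S)" using H'.zero_closed q_zero by simp
    have "additive_subgroup ?P R"
    proof (rule additive_subgroup_criterion)
      show "\<zero> \<in> ?P" using z Kz by simp
      fix x assume x: "x \<in> ?P"
      show "x \<oplus> y \<in> ?P" if "y \<in> ?P" for y
        using x that H'.a_closed[of "q x" "q y"] by (auto simp: q_add)
      show "\<ominus> x \<in> ?P" using x H'.a_inv_closed[of "q x"] by (auto simp: minus)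
    qed auto
    moreover have "S \<union> K \<subseteq> ?P"
      using SK z K.a_rcos_const by (auto intro: generate.incl)
    ultimately have "generate (add_monoid R) (S \<union> K) \<subseteq> ?P" by (rule generate_le)
    with eq have "carrier R \<subseteq> ?P" by (rule ord_eq_le_trans)
    then have "carrier Q \<subseteq> generate (add_monoid Q) (q ` S)" unfolding q_carrier by blast
    then show "carrier Q = generate (add_monoid Q) (q ` S)" using H'.a_subset by blast
  qed
qed

lemma quot_semisimple_iff:
  "gr_semisimple \<Gamma> Q B \<longleftrightarrow>
     carrier R = generate (add_monoid R) (simple_elems \<Gamma> R A K \<union> K)"
proof -
  interpret Q: graded_ring \<Gamma> Q B by (rule quot_graded_ring)
  have "simple_elems \<Gamma> R A K \<subseteq> carrier R" using homog_carrier by (auto simp: simple_elems_def)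
  then show ?thesis
    using Q.gr_semisimple_iff quot_generate quot_simple_elems q_zero by simp
qed

end

text \<open>Eliminates the quotient ring: what remains is a spanning condition inside
  \<open>R\<close> that can be compared with the one inside a corner.\<close>

lemma (in graded_ring) gr_semilocal_iff:
  "gr_semilocal \<Gamma> R A \<longleftrightarrow> carrier R =
     generate (add_monoid R) (simple_elems \<Gamma> R A (gr_rad \<Gamma> R A) \<union> gr_rad \<Gamma> R A)"
proof -
  interpret graded_ring_ideal \<Gamma> R A "gr_rad \<Gamma> R A"
    by unfold_locales (rule rad_ideal)
  show ?thesis unfolding gr_semilocal_def by (rule quot_semisimple_iff)
qed

section \<open>The socle modulo a graded ideal\<close>

context graded_ring_ideal
begin

text \<open>The preimage in \<open>R\<close> of the sum of all gr-simple right ideals of the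
  quotient by \<open>K\<close>.\<close>

abbreviation socle where
  "socle \<equiv> generate (add_monoid R) (simple_elems \<Gamma> R A K \<union> K)"

lemma simple_elems_carrier: "simple_elems \<Gamma> R A K \<subseteq> carrier R"
  using homog_carrier by (auto simp: simple_elems_def)

text \<open>Modulo \<open>K\<close>, the nonzero ideal generated by \<open>a b\<close> lies in the
  gr-simple one generated by \<open>a\<close>. Concretely, the relation for \<open>a\<close> with
  multiplier \<open>b c\<close> is multiplied by \<open>b\<close> on the right.\<close>

lemma simple_elems_right_mult:
  assumes a: "a \<in> simple_elems \<Gamma> R A K" and b: "b \<in> homog \<Gamma> A" and ab: "a \<otimes> b \<notin> K"
  shows "a \<otimes> b \<in> simple_elems \<Gamma> R A K"
  unfolding simple_elems_def
proof (intro CollectI conjI ballI impI)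
  have ah: "a \<in> homog \<Gamma> A" using a by (simp add: simple_elems_def)
  have ac: "a \<in> carrier R" and bc: "b \<in> carrier R" using ah b homog_carrier by auto
  show "a \<otimes> b \<in> homog \<Gamma> A" using homog_mult ah b .
  fix c assume c: "c \<in> homog \<Gamma> A" "a \<otimes> b \<otimes> c \<notin> K"
  have cc: "c \<in> carrier R" using c homog_carrier by simp
  have "a \<otimes> (b \<otimes> c) \<notin> K" "b \<otimes> c \<in> homog \<Gamma> A"
    using c ac bc cc homog_mult b by (auto simp: m_assoc)
  then obtain d k where d: "d \<in> carrier R" "k \<in> K" "a = a \<otimes> (b \<otimes> c) \<otimes> d \<oplus> k"
    using a unfolding simple_elems_def by blast
  then have "a \<otimes> b = (a \<otimes> (b \<otimes> c) \<otimes> d \<oplus> k) \<otimes> b" by simp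
  also have "\<dots> = a \<otimes> b \<otimes> c \<otimes> (d \<otimes> b) \<oplus> k \<otimes> b"
    using ac bc cc d(1,2) by (simp add: l_distr m_closed m_assoc)
  finally show "\<exists>d\<in>carrier R. \<exists>k\<in>K. a \<otimes> b = a \<otimes> b \<otimes> c \<otimes> d \<oplus> k"
    using d(1,2) bc K_r m_closed by blast
qed (rule ab)

text \<open>Modulo \<open>K\<close>, left multiplication by \<open>b\<close> maps the gr-simple
  ideal generated by \<open>a\<close> onto a nonzero image, which is again simple.\<close>

lemma simple_elems_left_mult:
  assumes a: "a \<in> simple_elems \<Gamma> R A K" and b: "b \<in> homog \<Gamma> A" and ba: "b \<otimes> a \<notin> K"
  shows "b \<otimes> a \<in> simple_elems \<Gamma> R A K"
  unfolding simple_elems_def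
proof (intro CollectI conjI ballI impI)
  have ah: "a \<in> homog \<Gamma> A" using a by (simp add: simple_elems_def)
  have ac: "a \<in> carrier R" and bc: "b \<in> carrier R" using ah b homog_carrier by auto
  show "b \<otimes> a \<in> homog \<Gamma> A" using homog_mult ah b by simp
  fix c assume c: "c \<in> homog \<Gamma> A" "b \<otimes> a \<otimes> c \<notin> K"
  have cc: "c \<in> carrier R" using c homog_carrier by simp
  have "a \<otimes> c \<notin> K"
    using c ac bc cc K_l[of "a \<otimes> c" b] by (auto simp: m_assoc)
  then obtain d k where d: "d \<in> carrier R" "k \<in> K" "a = a \<otimes> c \<otimes> d \<oplus> k"
    using a c(1) unfolding simple_elems_def by blast
  then have "b \<otimes> a = b \<otimes> (a \<otimes> c \<otimes> d \<oplus> k)" by simp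
  also have "\<dots> = b \<otimes> a \<otimes> c \<otimes> d \<oplus> b \<otimes> k"
    using ac bc cc d(1,2) by (simp add: r_distr m_closed m_assoc)
  finally show "\<exists>d\<in>carrier R. \<exists>k\<in>K. b \<otimes> a = b \<otimes> a \<otimes> c \<otimes> d \<oplus> k"
    using d(1,2) bc K_l by blast
qed (rule ba)

lemma socle_subgroup: "additive_subgroup socle R"
  using simple_elems_carrier K.a_subset by (intro additive_subgroup_generate) blast

text \<open>Homogeneous multiples of a generator are generators or lie in \<open>K\<close>;
  additivity in both factors does the rest.\<close>

lemma socle_mult:
  assumes x: "x \<in> carrier R" and s: "s \<in> socle"
  shows "x \<otimes> s \<in> socle" "s \<otimes> x \<in> socle"
proof -
  interpret S: additive_subgroup socle R by (rule socle_subgroup)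
  have incl: "t \<in> socle" if "t \<in> simple_elems \<Gamma> R A K \<or> t \<in> K" for t
    using that by (auto intro: generate.incl)
  have "simple_elems \<Gamma> R A K \<union> K \<subseteq> {t \<in> carrier R. x \<otimes> t \<in> socle}"
  proof
    fix t assume t: "t \<in> simple_elems \<Gamma> R A K \<union> K"
    then have tc: "t \<in> carrier R" using simple_elems_carrier by auto
    have "homog \<Gamma> A \<subseteq> {y \<in> carrier R. y \<otimes> t \<in> socle}"
      using t simple_elems_left_mult incl K_l homog_carrier by blast
    then have "x \<in> {y \<in> carrier R. y \<otimes> t \<in> socle}"
      by (rule in_subgroup_if_homog[OF right_quotient_subgroup[OF socle_subgroup tc] x])
    then show "t \<in> {t \<in> carrier R. x \<otimes> t \<in> socle}" using tc by simp
  qed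
  from generate_le[OF left_quotient_subgroup[OF socle_subgroup x] this]
  show "x \<otimes> s \<in> socle" using s by blast
  have "simple_elems \<Gamma> R A K \<union> K \<subseteq> {t \<in> carrier R. t \<otimes> x \<in> socle}"
  proof
    fix t assume t: "t \<in> simple_elems \<Gamma> R A K \<union> K"
    then have tc: "t \<in> carrier R" using simple_elems_carrier by auto
    have "homog \<Gamma> A \<subseteq> {y \<in> carrier R. t \<otimes> y \<in> socle}"
      using t simple_elems_right_mult incl K_r homog_carrier by blast
    then have "x \<in> {y \<in> carrier R. t \<otimes> y \<in> socle}"
      by (rule in_subgroup_if_homog[OF left_quotient_subgroup[OF socle_subgroup tc] x])
    then show "t \<in> {t \<in> carrier R. t \<otimes> x \<in> socle}" using tc by simp
  qed
  from generate_le[OF right_quotient_subgroup[OF socle_subgroup x] this]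
  show "s \<otimes> x \<in> socle" using s by blast
qed

end


section \<open>Corners\<close>

text \<open>Failure of quasi-regularity supplies \<open>b\<close> such that \<open>1_e - x b\<close>
  has no right inverse. Then \<open>x b\<close> fails the criterion as well, with multiplier
  \<open>1_e\<close>, and so is not in the radical.\<close>

lemma (in graded_ring) not_rad_witness:
  assumes \<gamma>: "\<gamma> \<in> arr \<Gamma>" and x: "x \<in> A \<gamma>" "x \<notin> gr_rad \<Gamma> R A"
  shows "\<exists>b\<in>homog \<Gamma> A. x \<otimes> b \<in> A (tgt \<Gamma> \<gamma>) \<and> x \<otimes> b \<notin> gr_rad \<Gamma> R A"
proof -
  let ?e = "tgt \<Gamma> \<gamma>"
  have e: "?e \<in> ids \<Gamma>" using \<gamma> tgt_ids by simp
  obtain b where b: "b \<in> homog \<Gamma> A" "x \<otimes> b \<in> A ?e"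
    and no: "\<not> (\<exists>z\<in>A ?e. z = obj ?e \<oplus> x \<otimes> b \<otimes> z)"
    using rad_component_iff[OF \<gamma> x(1)] x(2) unfolding quasi_regular_def by blast
  have "x \<otimes> b \<notin> gr_rad \<Gamma> R A"
  proof
    assume "x \<otimes> b \<in> gr_rad \<Gamma> R A"
    from rad_imp_quasi_regular[OF e this]
    have "x \<otimes> b \<otimes> obj ?e \<in> A ?e \<longrightarrow> (\<exists>z\<in>A ?e. z = obj ?e \<oplus> x \<otimes> b \<otimes> obj ?e \<otimes> z)"
      using obj_homog[OF e] unfolding quasi_regular_def by blast
    moreover have "x \<otimes> b \<otimes> obj ?e = x \<otimes> b" using obj_mult_component(2)[OF e _ b(2)] e by simp
    ultimately show False using no b(2) by simp
  qed
  then show ?thesis using b by blast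
qed

locale graded_corner = graded_ring \<Gamma> R A for \<Gamma> and R (structure) and A +
  fixes e
  assumes e: "e \<in> ids \<Gamma>"
begin

abbreviation C where "C \<equiv> corner R A e"
abbreviation G where "G \<equiv> isotropy \<Gamma> e"
abbreviation w where "w \<equiv> obj e"
abbreviation cut where "cut x \<equiv> w \<otimes> x \<otimes> w"

lemma corner_ops [simp]:
  "mult C = mult R" "add C = add R" "zero C = zero R"
  by (simp_all add: corner_def)

lemma w_idem: "w \<otimes> w = w"
  by (rule obj_idem[OF e])

lemma w_carrier [simp]: "w \<in> carrier R"
  using e by simp

lemma cut_corner: "x \<in> carrier R \<Longrightarrow> cut x \<in> carrier C"
  unfolding corner_def by auto

lemma corner_carrier: "carrier C = {x \<in> carrier R. w \<otimes> x = x \<and> x \<otimes> w = x}"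
proof -
  have cut: "w \<otimes> cut a = cut a \<and> cut a \<otimes> w = cut a" if "a \<in> carrier R" for a
  proof -
    have "w \<otimes> cut a = w \<otimes> w \<otimes> a \<otimes> w" "cut a \<otimes> w = w \<otimes> a \<otimes> (w \<otimes> w)"
      using that by (simp_all add: m_assoc m_closed)
    then show ?thesis by (simp only: w_idem)
  qed
  show ?thesis
  proof (intro equalityI subsetI)
    fix x assume "x \<in> carrier C"
    then obtain a where "a \<in> carrier R" "x = cut a" by (auto simp: corner_def)
    then show "x \<in> {x \<in> carrier R. w \<otimes> x = x \<and> x \<otimes> w = x}"
      using cut by (simp add: m_closed)
  next
    fix x assume "x \<in> {x \<in> carrier R. w \<otimes> x = x \<and> x \<otimes> w = x}"
    then have "x \<in> carrier R" "cut x = x" by simp_all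
    then show "x \<in> carrier C" using cut_corner by metis
  qed
qed

lemma corner_carrierD: "x \<in> carrier C \<Longrightarrow> x \<in> carrier R \<and> w \<otimes> x = x \<and> x \<otimes> w = x"
  by (simp add: corner_carrier)

lemma cut_eq: "x \<in> carrier C \<Longrightarrow> cut x = x"
  by (simp add: corner_carrier)

lemma cut_add: "x \<in> carrier R \<Longrightarrow> y \<in> carrier R \<Longrightarrow> cut (x \<oplus> y) = cut x \<oplus> cut y"
  by (simp add: r_distr l_distr m_closed)

lemma cut_minus: "x \<in> carrier R \<Longrightarrow> cut (\<ominus> x) = \<ominus> cut x"
  by (simp add: r_minus l_minus m_closed)

lemma corner_subgroup: "additive_subgroup (carrier C) R"
  unfolding corner_carrier
  by (rule additive_subgroup_criterion) (auto simp: l_distr r_distr l_minus r_minus)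

sublocale C: nonunital_ring C
proof -
  interpret S: additive_subgroup "carrier C" R by (rule corner_subgroup)
  have "abelian_group C"
  proof (rule abelian_groupI)
    fix x assume x: "x \<in> carrier C"
    then have "\<ominus> x \<in> carrier C" "\<ominus> x \<oplus> x = \<zero>" by (simp_all add: l_neg)
    then show "\<exists>y\<in>carrier C. y \<oplus>\<^bsub>C\<^esub> x = \<zero>\<^bsub>C\<^esub>" by auto
  qed (auto simp: a_ac)
  moreover have "x \<otimes> y \<in> carrier C" if x: "x \<in> carrier C" and y: "y \<in> carrier C" for x y
  proof -
    note xy = corner_carrierD[OF x] corner_carrierD[OF y]
    then have "w \<otimes> (x \<otimes> y) = x \<otimes> y" "x \<otimes> y \<otimes> w = x \<otimes> y"
      using m_assoc[of w x y] m_assoc[of x y w] by simp_all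
    then show ?thesis unfolding corner_carrier using xy by (simp add: m_closed)
  qed
  ultimately show "nonunital_ring C"
    by (intro nonunital_ring.intro nonunital_ring_axioms.intro)
      (simp_all add: l_distr r_distr m_assoc)
qed

lemma corner_minus: "x \<in> carrier C \<Longrightarrow> \<ominus>\<^bsub>C\<^esub> x = \<ominus> x"
proof -
  assume x: "x \<in> carrier C"
  interpret S: additive_subgroup "carrier C" R by (rule corner_subgroup)
  show ?thesis using x by (intro C.minus_equality) (simp_all add: l_neg)
qed

lemma corner_subgroup_iff:
  "additive_subgroup H C \<longleftrightarrow> additive_subgroup H R \<and> H \<subseteq> carrier C"
proof (intro iffI conjI)
  assume H: "additive_subgroup H C"
  then interpret H: additive_subgroup H C .
  show sub: "H \<subseteq> carrier C" by (rule H.a_subset)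
  show "additive_subgroup H R"
    using sub H.a_closed H.zero_closed H.a_inv_closed corner_minus corner_carrierD
    by (intro additive_subgroup_criterion) (auto simp: subset_iff)
next
  assume H: "additive_subgroup H R \<and> H \<subseteq> carrier C"
  then interpret H: additive_subgroup H R by simp
  show "additive_subgroup H C"
    using H H.a_closed H.zero_closed H.a_inv_closed corner_minus
    by (intro C.additive_subgroup_criterion) (auto simp: subset_iff)
qed

lemma corner_inter_subgroup:
  assumes "additive_subgroup H R"
  shows "additive_subgroup (H \<inter> carrier C) C"
proof -
  have "additive_subgroup (H \<inter> carrier C) R"
    by (rule additive_subgroupI[OF add.subgroups_Inter_pair[OF
          assms[THEN additive_subgroup.a_subgroup] corner_subgroup[THEN additive_subgroup.a_subgroup]]])
  then show ?thesis unfolding corner_subgroup_iff by simp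
qed

lemma isotropy_simps [simp]:
  "arr G = {\<gamma> \<in> arr \<Gamma>. tgt \<Gamma> \<gamma> = e \<and> src \<Gamma> \<gamma> = e}"
  "src G = src \<Gamma>" "tgt G = tgt \<Gamma>" "cmp G = cmp \<Gamma>"
  by (simp_all add: isotropy_def)

lemma isotropy_ids: "ids G = {e}"
proof (intro equalityI subsetI)
  fix f assume "f \<in> ids G"
  then have "tgt \<Gamma> f = f \<and> tgt \<Gamma> f = e" unfolding ids_def isotropy_simps by blast
  then show "f \<in> {e}" by auto
qed (use ids_simps[OF e] in \<open>simp add: ids_def del: ids_simps\<close>)

lemma isotropy_groupoid: "groupoid G"
proof
  show "\<gamma> \<in> arr G \<Longrightarrow> \<exists>\<delta>\<in>arr G. src G \<delta> = tgt G \<gamma> \<and> tgt G \<delta> = src G \<gamma> \<and>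
      cmp G \<delta> \<gamma> = src G \<gamma> \<and> cmp G \<gamma> \<delta> = tgt G \<gamma>" for \<gamma>
    using inverse[of \<gamma>] by auto
qed (auto simp: isotropy_ids cmp_closed src_cmp tgt_cmp cmp_assoc intro: cmp_src cmp_tgt
  dest: cmp_src cmp_tgt)

lemma component_corner:
  assumes "\<gamma> \<in> arr G"
  shows "A \<gamma> \<subseteq> carrier C"
  using assms component_carrier obj_mult_component[OF e] by (auto simp: corner_carrier)

lemma pr_corner_zero:
  assumes x: "x \<in> carrier C" and \<gamma>: "\<gamma> \<in> arr \<Gamma>" "\<gamma> \<notin> arr G"
  shows "pr \<gamma> x = \<zero>"
  using pr_obj_mult[OF e \<gamma>(1), of x] pr_mult_obj[OF e \<gamma>(1), of x] corner_carrierD[OF x] \<gamma>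
  by (auto split: if_splits)

text \<open>Infinite \<open>T\<close> is covered too, since both sums are then zero by
  convention.\<close>

lemma corner_finsum: "f \<in> T \<rightarrow> carrier C \<Longrightarrow> finsum C f T = finsum R f T"
proof (induction T rule: infinite_finite_induct)
  case (insert i T)
  then have "f \<in> T \<rightarrow> carrier C" "f i \<in> carrier C" by auto
  moreover from this have "f \<in> T \<rightarrow> carrier R" "f i \<in> carrier R" using corner_carrierD by auto
  ultimately show ?case using insert by (simp add: finsum_insert C.finsum_insert)
qed (simp_all add: finsum_infinite C.finsum_infinite)

lemma corner_obj: "obj_one C A = obj"
  by (simp add: obj_one_def fun_eq_iff)

text \<open>The coordinate maps of \<open>R\<close> serve for the corner, because on its elements
  all components outside the isotropy group vanish.\<close>

lemma corner_graded_ring: "graded_ring G C A"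
proof -
  have sub: "additive_subgroup (A \<gamma>) C" if "\<gamma> \<in> arr G" for \<gamma>
    using that component_corner[OF that] component_subgroup[of \<gamma>] by (simp add: corner_subgroup_iff)
  have ds: "is_direct_sum C (arr G) A (carrier C)"
  proof (rule C.direct_sumI[where \<pi> = pr])
    show "additive_subgroup (carrier C) C" using corner_subgroup by (simp add: corner_subgroup_iff)
    fix x assume x: "x \<in> carrier C"
    then have xc: "x \<in> carrier R" by (simp add: corner_carrier)
    show "pr \<gamma> x \<in> A \<gamma>" if "\<gamma> \<in> arr G" for \<gamma> using that pr_mem[OF xc] by simp
    have eq: "{\<gamma> \<in> arr G. pr \<gamma> x \<noteq> \<zero>\<^bsub>C\<^esub>} = {\<gamma> \<in> arr \<Gamma>. pr \<gamma> x \<noteq> \<zero>}"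
      using pr_corner_zero[OF x] by auto
    show "finite {\<gamma> \<in> arr G. pr \<gamma> x \<noteq> \<zero>\<^bsub>C\<^esub>}" unfolding eq by (rule pr_finite[OF xc])
    have "(\<lambda>\<gamma>. pr \<gamma> x) \<in> {\<gamma> \<in> arr G. pr \<gamma> x \<noteq> \<zero>\<^bsub>C\<^esub>} \<rightarrow> carrier C"
      using component_corner pr_mem[OF xc] by auto
    then have "finsum C (\<lambda>\<gamma>. pr \<gamma> x) {\<gamma> \<in> arr G. pr \<gamma> x \<noteq> \<zero>\<^bsub>C\<^esub>} =
      finsum R (\<lambda>\<gamma>. pr \<gamma> x) {\<gamma> \<in> arr G. pr \<gamma> x \<noteq> \<zero>\<^bsub>C\<^esub>}" by (rule corner_finsum)
    then show "finsum C (\<lambda>\<gamma>. pr \<gamma> x) {\<gamma> \<in> arr G. pr \<gamma> x \<noteq> \<zero>\<^bsub>C\<^esub>} = x"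
      unfolding eq using pr_sum[OF xc] by simp
    show "pr \<gamma> (x \<oplus>\<^bsub>C\<^esub> y) = pr \<gamma> x \<oplus>\<^bsub>C\<^esub> pr \<gamma> y" if "\<gamma> \<in> arr G" "y \<in> carrier C" for \<gamma> y
      using that xc pr_add by (simp add: corner_carrier)
  qed (use sub component_corner pr_component in auto)
  have ou: "\<exists>u. (\<forall>e\<in>ids G. u e \<in> A e) \<and>
      (\<forall>\<gamma>\<in>arr G. \<forall>a\<in>A \<gamma>. u (tgt G \<gamma>) \<otimes>\<^bsub>C\<^esub> a = a \<and> a \<otimes>\<^bsub>C\<^esub> u (src G \<gamma>) = a)"
    using obj_mem[OF e] obj_mult_component[OF e]
    by (intro exI[of _ obj]) (auto simp: isotropy_ids)
  show ?thesis
    using sub ds ou mult_component mult_zero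
    by (intro graded_ring.intro isotropy_groupoid C.nonunital_ring_axioms graded_ring_axioms.intro)
      auto
qed

sublocale C: graded_ring G C A
  by (rule corner_graded_ring)

lemma corner_homog: "homog G A = homog \<Gamma> A \<inter> carrier C"
proof
  show "homog G A \<subseteq> homog \<Gamma> A \<inter> carrier C"
    using C.homog_carrier by (auto simp: homog_def)
  show "homog \<Gamma> A \<inter> carrier C \<subseteq> homog G A"
  proof
    fix h assume h: "h \<in> homog \<Gamma> A \<inter> carrier C"
    then obtain \<gamma> where \<gamma>: "\<gamma> \<in> arr \<Gamma>" "h \<in> A \<gamma>" by (auto simp: homog_def)
    show "h \<in> homog G A"
    proof (cases "\<gamma> \<in> arr G")
      case True
      then show ?thesis using \<gamma> C.homogI by blast
    next
      case False
      then have "h = \<zero>" using pr_corner_zero[of h \<gamma>] h \<gamma> pr_component[of \<gamma> \<gamma> h] by auto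
      then show ?thesis using C.homogI[of e \<zero>] component_zero[of e] e by simp
    qed
  qed
qed

lemma cut_component:
  assumes \<gamma>: "\<gamma> \<in> arr \<Gamma>" and a: "a \<in> A \<gamma>"
  shows "cut a = (if \<gamma> \<in> arr G then a else \<zero>)"
  using obj_mult_component[OF e \<gamma> a] \<gamma> by auto

lemma cut_homog: "h \<in> homog \<Gamma> A \<Longrightarrow> cut h \<in> homog G A"
  using cut_corner[OF homog_carrier] homog_mult[OF homog_mult] obj_homog[OF e]
  by (simp add: corner_homog)

text \<open>As \<open>a = a 1_e\<close>, and \<open>a b\<close> of degree \<open>e\<close> is fixed
  by \<open>1_e\<close>, the multiplier \<open>b\<close> can be replaced by \<open>1_e b 1_e\<close>
  without changing \<open>a b\<close>.\<close>

lemma corner_quasi_regular: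
  assumes a: "a \<in> carrier C"
  shows "quasi_regular G C A e a \<longleftrightarrow> quasi_regular \<Gamma> R A e a"
proof -
  have ac: "a \<in> carrier R" "a \<otimes> w = a" using corner_carrierD[OF a] by auto
  have cut: "a \<otimes> cut b = a \<otimes> b" if "b \<in> carrier R" "a \<otimes> b \<in> A e" for b
  proof -
    have "a \<otimes> cut b = a \<otimes> w \<otimes> b \<otimes> w" using ac(1) that by (simp add: m_assoc m_closed)
    also have "\<dots> = a \<otimes> b" using obj_mult_component(2)[OF e _ that(2)] e ac(2) by simp
    finally show ?thesis .
  qed
  show ?thesis
    unfolding quasi_regular_def corner_obj corner_ops
  proof (intro iffI ballI impI)
    fix b assume all: "\<forall>b\<in>homog G A. a \<otimes> b \<in> A e \<longrightarrow> (\<exists>z\<in>A e. z = w \<oplus> a \<otimes> b \<otimes> z)"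
      and b: "b \<in> homog \<Gamma> A" "a \<otimes> b \<in> A e"
    then show "\<exists>z\<in>A e. z = w \<oplus> a \<otimes> b \<otimes> z"
      using cut_homog[OF b(1)] cut[OF homog_carrier[OF b(1)] b(2)] by metis
  next
    fix b assume "\<forall>b\<in>homog \<Gamma> A. a \<otimes> b \<in> A e \<longrightarrow> (\<exists>z\<in>A e. z = w \<oplus> a \<otimes> b \<otimes> z)"
      and "b \<in> homog G A" "a \<otimes> b \<in> A e"
    then show "\<exists>z\<in>A e. z = w \<oplus> a \<otimes> b \<otimes> z" using corner_homog by blast
  qed
qed

text \<open>For homogeneous elements of the corner the criterion agrees in both rings, and both
  sides contain the components of their elements.\<close>

lemma corner_rad: "gr_rad G C A = gr_rad \<Gamma> R A \<inter> carrier C"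
proof -
  let ?J = "gr_rad \<Gamma> R A" and ?J' = "gr_rad G C A"
  have iff: "a \<in> ?J' \<longleftrightarrow> a \<in> ?J" if "\<gamma> \<in> arr G" "a \<in> A \<gamma>" for \<gamma> a
    using C.rad_component_iff[OF that] rad_component_iff[of \<gamma> a] corner_quasi_regular[of a]
      component_corner[OF that(1)] that by auto
  have J: "additive_subgroup ?J R" by (rule gr_right_ideal_subgroup[OF rad_right_ideal])
  have J': "additive_subgroup ?J' C" by (rule C.gr_right_ideal_subgroup[OF C.rad_right_ideal])
  note JC = corner_inter_subgroup[OF J]
  show ?thesis
  proof (intro equalityI subsetI)
    fix x assume x: "x \<in> ?J'"
    have xc: "x \<in> carrier C" using C.gr_right_ideal_carrier[OF C.rad_right_ideal x] .
    show "x \<in> ?J \<inter> carrier C"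
    proof (rule C.in_subgroup_if_pr[OF JC xc])
      fix \<gamma> assume \<gamma>: "\<gamma> \<in> arr G"
      show "C.pr \<gamma> x \<in> ?J \<inter> carrier C"
        using C.gr_right_ideal_pr[OF C.rad_right_ideal x \<gamma>] C.pr_mem[OF xc \<gamma>] iff[OF \<gamma>]
          C.pr_carrier[OF xc \<gamma>] by blast
    qed
  next
    fix x assume x: "x \<in> ?J \<inter> carrier C"
    then have xc: "x \<in> carrier R" using corner_carrierD by blast
    have J'R: "additive_subgroup ?J' R" using J' corner_subgroup_iff by blast
    show "x \<in> ?J'"
    proof (rule in_subgroup_if_pr[OF J'R xc])
      fix \<gamma> assume \<gamma>: "\<gamma> \<in> arr \<Gamma>"
      show "pr \<gamma> x \<in> ?J'"
      proof (cases "\<gamma> \<in> arr G")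
        case True
        then show ?thesis
          using iff[OF True pr_mem[OF xc \<gamma>]] gr_right_ideal_pr[OF rad_right_ideal _ \<gamma>] x by blast
      next
        case False
        then show ?thesis
          using pr_corner_zero[OF _ \<gamma> False] x additive_subgroup.zero_closed[OF J'R] by simp
      qed
    qed
  qed
qed

sublocale J: graded_ring_ideal \<Gamma> R A "gr_rad \<Gamma> R A"
  by unfold_locales (rule rad_ideal)

lemma corner_simple_elems:
  "simple_elems G C A (gr_rad G C A) = simple_elems \<Gamma> R A (gr_rad \<Gamma> R A) \<inter> carrier C"
proof (intro equalityI subsetI)
  let ?J = "gr_rad \<Gamma> R A" and ?J' = "gr_rad G C A"
  fix a assume a: "a \<in> simple_elems G C A ?J'"
  then have ah: "a \<in> homog \<Gamma> A" and aC: "a \<in> carrier C" and aJ: "a \<notin> ?J"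
    by (auto simp: simple_elems_def corner_homog corner_rad)
  have ac: "a \<in> carrier R" "w \<otimes> a = a" "a \<otimes> w = a" using corner_carrierD[OF aC] by auto
  have "\<exists>d\<in>carrier R. \<exists>k\<in>?J. a = a \<otimes> c \<otimes> d \<oplus> k" if c: "c \<in> homog \<Gamma> A" "a \<otimes> c \<notin> ?J" for c
  proof -
    have cc: "c \<in> carrier R" using homog_carrier c by simp
    obtain \<gamma> where \<gamma>: "\<gamma> \<in> arr \<Gamma>" "a \<otimes> c \<in> A \<gamma>"
      using homog_mult[OF ah c(1)] by (auto simp: homog_def)
    have "w \<otimes> (a \<otimes> c) = a \<otimes> c" using ac cc by (simp add: m_assoc[symmetric])
    \<comment> \<open>A nonzero homogeneous element fixed by \<open>1_e\<close> on the left must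
      have target \<open>e\<close>.\<close>
    moreover have "a \<otimes> c \<noteq> \<zero>" using c(2) J.K.zero_closed by auto
    ultimately have t: "tgt \<Gamma> \<gamma> = e" using obj_mult_component(1)[OF e \<gamma>] by (auto split: if_splits)
    \<comment> \<open>The multiplier \<open>c\<close> may lead out of the corner; \<open>b\<close>
      leads back without falling into the radical. Only then does simplicity in the corner apply,
      and \<open>b d\<close> is the resulting multiplier in \<open>R\<close>.\<close>
    obtain b where b: "b \<in> homog \<Gamma> A" "a \<otimes> c \<otimes> b \<in> A e" "a \<otimes> c \<otimes> b \<notin> ?J"
      using not_rad_witness[OF \<gamma> c(2)] t by auto
    have bc: "b \<in> carrier R" using homog_carrier b by simp
    have "a \<otimes> cut (c \<otimes> b) = a \<otimes> w \<otimes> c \<otimes> b \<otimes> w" using ac(1) cc bc by (simp add: m_assoc m_closed)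
    also have "\<dots> = a \<otimes> c \<otimes> b" using ac(3) obj_mult_component(2)[OF e _ b(2)] e by simp
    finally have eq: "a \<otimes> cut (c \<otimes> b) = a \<otimes> c \<otimes> b" .
    have "cut (c \<otimes> b) \<in> homog G A" using cut_homog homog_mult c b by simp
    moreover have "a \<otimes> cut (c \<otimes> b) \<notin> ?J'" using eq b corner_rad by simp
    ultimately obtain d k where dk: "d \<in> carrier C" "k \<in> ?J'" "a = a \<otimes> cut (c \<otimes> b) \<otimes> d \<oplus> k"
      using a unfolding simple_elems_def by (auto simp: corner_ops)
    then have "a = a \<otimes> c \<otimes> (b \<otimes> d) \<oplus> k"
      unfolding eq using ac cc bc corner_carrierD[OF dk(1)] by (simp add: m_assoc m_closed)
    then show ?thesis using dk bc corner_carrierD[OF dk(1)] corner_rad m_closed by blast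
  qed
  then show "a \<in> simple_elems \<Gamma> R A ?J \<inter> carrier C"
    using ah aC aJ by (simp add: simple_elems_def)
next
  let ?J = "gr_rad \<Gamma> R A" and ?J' = "gr_rad G C A"
  fix a assume a: "a \<in> simple_elems \<Gamma> R A ?J \<inter> carrier C"
  then have ah: "a \<in> homog G A" and aC: "a \<in> carrier C" and aJ: "a \<notin> ?J'"
    by (auto simp: simple_elems_def corner_homog corner_rad)
  have ac: "a \<in> carrier R" "w \<otimes> a = a" "a \<otimes> w = a" using corner_carrierD[OF aC] by auto
  have "\<exists>d\<in>carrier C. \<exists>k\<in>?J'. a = a \<otimes> c \<otimes> d \<oplus> k" if c: "c \<in> homog G A" "a \<otimes> c \<notin> ?J'" for c
  proof -
    have cC: "c \<in> carrier C" "c \<in> homog \<Gamma> A" using c(1) corner_homog by auto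
    have cc: "c \<in> carrier R" "c \<otimes> w = c" using corner_carrierD[OF cC(1)] by auto
    have "a \<otimes> c \<in> carrier C" using C.m_closed[OF aC cC(1)] by simp
    then have "a \<otimes> c \<notin> ?J" using c(2) corner_rad by blast
    then obtain d k where dk: "d \<in> carrier R" "k \<in> ?J" "a = a \<otimes> c \<otimes> d \<oplus> k"
      using a cC(2) unfolding simple_elems_def by blast
    have kc: "k \<in> carrier R" using dk(2) by simp
    \<comment> \<open>Cutting the relation moves it into the corner; since \<open>c = c 1_e\<close>,
      the cut reaches \<open>d\<close> itself.\<close>
    have "a = cut (a \<otimes> c \<otimes> d \<oplus> k)" using dk(3) cut_eq[OF aC] by simp
    also have "\<dots> = cut (a \<otimes> c \<otimes> d) \<oplus> cut k" using ac(1) cc dk(1) kc by (intro cut_add m_closed)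
    also have "cut (a \<otimes> c \<otimes> d) = (w \<otimes> a) \<otimes> c \<otimes> d \<otimes> w"
      using ac(1) cc(1) dk(1) by (simp add: m_assoc m_closed)
    also have "\<dots> = a \<otimes> (c \<otimes> w) \<otimes> d \<otimes> w" using ac(2) cc(2) by simp
    also have "\<dots> = a \<otimes> c \<otimes> cut d" using ac(1) cc(1) dk(1) by (simp add: m_assoc m_closed)
    finally have "a = a \<otimes> c \<otimes> cut d \<oplus> cut k" .
    moreover have "cut k \<in> ?J'"
      using J.K_l J.K_r dk(2) kc cut_corner corner_rad by simp
    ultimately show ?thesis using cut_corner[OF dk(1)] by blast
  qed
  then show "a \<in> simple_elems G C A ?J'"
    using ah aJ by (simp add: simple_elems_def)
qed

text \<open>Cutting is additive, maps radical elements into the radical of the corner, and maps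
  every other generator to itself or to zero. A spanning set of \<open>R\<close> is thus cut to one
  of the corner.\<close>

lemma corner_semilocal:
  assumes "gr_semilocal \<Gamma> R A"
  shows "gr_semilocal G C A"
proof -
  let ?S = "simple_elems \<Gamma> R A (gr_rad \<Gamma> R A) \<union> gr_rad \<Gamma> R A"
  let ?S' = "simple_elems G C A (gr_rad G C A) \<union> gr_rad G C A"
  have S': "?S' = ?S \<inter> carrier C" using corner_simple_elems corner_rad by blast
  define H where "H = generate (add_monoid C) ?S'"
  have sub: "additive_subgroup H C"
    unfolding H_def using S' by (intro C.additive_subgroup_generate) simp
  have incl: "s \<in> H" if "s \<in> ?S'" for s
    using that unfolding H_def by (rule generate.incl)
  interpret H: additive_subgroup H R
    using sub corner_subgroup_iff by blast
  let ?P = "{y \<in> carrier R. cut y \<in> H}"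
  have P: "additive_subgroup ?P R"
  proof (rule additive_subgroup_criterion)
    fix x y assume "x \<in> ?P" "y \<in> ?P"
    then show "x \<oplus> y \<in> ?P" using cut_add H.a_closed by simp
  next
    fix x assume "x \<in> ?P"
    then show "\<ominus> x \<in> ?P" using cut_minus H.a_inv_closed by simp
  qed auto
  have "?S \<subseteq> ?P"
  proof
    fix s assume s: "s \<in> ?S"
    then have sc: "s \<in> carrier R" using J.simple_elems_carrier by auto
    have "cut s \<in> H"
    proof (cases "s \<in> gr_rad \<Gamma> R A")
      case True
      then have "cut s \<in> gr_rad G C A"
        using J.K_l J.K_r cut_corner sc corner_rad by simp
      then show ?thesis using incl by blast
    next
      case False
      then have "s \<in> homog \<Gamma> A" using s by (simp add: simple_elems_def)
      then obtain \<gamma> where \<gamma>: "\<gamma> \<in> arr \<Gamma>" "s \<in> A \<gamma>" by (auto simp: homog_def)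
      show ?thesis
      proof (cases "\<gamma> \<in> arr G")
        case True
        then have "cut s = s" "s \<in> ?S'"
          using cut_component[OF \<gamma>] component_corner[OF True] \<gamma>(2) s S' by auto
        then show ?thesis using incl by simp
      next
        case False
        then show ?thesis unfolding cut_component[OF \<gamma>] using H.zero_closed by (simp only: if_False)
      qed
    qed
    then show "s \<in> ?P" using sc by simp
  qed
  from generate_le[OF P this] have "carrier R \<subseteq> ?P"
    using assms unfolding gr_semilocal_iff by blast
  then have "carrier C \<subseteq> H"
    using cut_eq corner_carrierD by fastforce
  then show ?thesis
    unfolding C.gr_semilocal_iff H_def[symmetric] using additive_subgroup.a_subset[OF sub] by blast
qed

text \<open>The generators available in the corner are generators in \<open>R\<close>, so the whole
  corner lies in the socle.\<close>

lemma obj_in_socle: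
  assumes "gr_semilocal G C A"
  shows "w \<in> J.socle"
proof -
  let ?S' = "simple_elems G C A (gr_rad G C A) \<union> gr_rad G C A"
  have "additive_subgroup (J.socle \<inter> carrier C) C"
    by (rule corner_inter_subgroup[OF J.socle_subgroup])
  moreover have "?S' \<subseteq> J.socle \<inter> carrier C"
    using corner_simple_elems corner_rad by (auto intro: generate.incl)
  ultimately have "generate (add_monoid C) ?S' \<subseteq> J.socle \<inter> carrier C" by (rule C.generate_le)
  moreover have "w \<in> carrier C" by (simp add: corner_carrier w_idem)
  ultimately show ?thesis using assms unfolding C.gr_semilocal_iff by blast
qed

end

section \<open>Nilpotency\<close>

context nonunital_ring
begin

lemma foldl_mult_closed:
  "x \<in> carrier R \<Longrightarrow> set ws \<subseteq> carrier R \<Longrightarrow> foldl (\<otimes>) x ws \<in> carrier R"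
  by (induction ws arbitrary: x) (auto simp: m_closed)

lemma foldl_mult_zero: "set ws \<subseteq> carrier R \<Longrightarrow> foldl (\<otimes>) \<zero> ws = \<zero>"
  by (induction ws) auto

lemma foldl_mult_add:
  "x \<in> carrier R \<Longrightarrow> y \<in> carrier R \<Longrightarrow> set ws \<subseteq> carrier R \<Longrightarrow>
    foldl (\<otimes>) (x \<oplus> y) ws = foldl (\<otimes>) x ws \<oplus> foldl (\<otimes>) y ws"
  by (induction ws arbitrary: x y) (auto simp: m_closed l_distr)

lemma foldl_mult_minus:
  "x \<in> carrier R \<Longrightarrow> set ws \<subseteq> carrier R \<Longrightarrow> foldl (\<otimes>) (\<ominus> x) ws = \<ominus> foldl (\<otimes>) x ws"
  by (induction ws arbitrary: x) (auto simp: m_closed l_minus)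

lemma foldl_mult_assoc:
  "x \<in> carrier R \<Longrightarrow> y \<in> carrier R \<Longrightarrow> set ws \<subseteq> carrier R \<Longrightarrow>
    foldl (\<otimes>) (x \<otimes> y) ws = x \<otimes> foldl (\<otimes>) y ws"
  by (induction ws arbitrary: y) (auto simp: m_closed m_assoc)

text \<open>The start value is a factor too, so the exponent exceeds the length of the list by one.
  Induction is from the right because \<open>ideal_pow\<close> adds its factors there.\<close>

lemma foldl_mult_ideal_pow:
  "x \<in> U \<Longrightarrow> set ws \<subseteq> U \<Longrightarrow> foldl (\<otimes>) x ws \<in> ideal_pow R U (Suc (length ws))"
  by (induction ws rule: rev_induct) (auto intro: ideal_prod.prod)

lemma ideal_pow_zero_mem: "\<zero> \<in> U \<Longrightarrow> \<zero> \<in> ideal_pow R U (Suc n)"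
proof (induction n)
  case (Suc n)
  then have "\<zero> \<otimes> \<zero> \<in> ideal_prod R (ideal_pow R U (Suc n)) U" by (intro ideal_prod.prod)
  then show ?case by simp
qed simp

text \<open>The total number of factors is fixed while the induction shortens the power: the last
  factor \<open>y\<close> of a product \<open>x y\<close> moves to the front of \<open>ws\<close>.
  Membership in the carrier is carried along for distributivity in the case of sums.\<close>

lemma foldl_ideal_pow_eq_zero:
  assumes U: "U \<subseteq> carrier R"
    and words: "\<And>x ws. x \<in> U \<Longrightarrow> set ws \<subseteq> U \<Longrightarrow> length ws = N \<Longrightarrow> foldl (\<otimes>) x ws = \<zero>"
  shows "p \<in> ideal_pow R U (Suc n) \<Longrightarrow> set ws \<subseteq> U \<Longrightarrow> n + length ws = N \<Longrightarrow>
    p \<in> carrier R \<and> foldl (\<otimes>) p ws = \<zero>"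
proof (induction n arbitrary: p ws)
  case 0
  then show ?case using words U by auto
next
  case (Suc n)
  from Suc.prems(1) have "p \<in> ideal_prod R (ideal_pow R U (Suc n)) U" by simp
  then show ?case
  proof induction
    case (prod x y)
    then have "x \<in> carrier R \<and> foldl (\<otimes>) x (y # ws) = \<zero>"
      using Suc.prems by (intro Suc.IH) auto
    then show ?case using prod U by (auto simp: m_closed)
  next
    case (sum s t)
    moreover have "set ws \<subseteq> carrier R" using Suc.prems U by blast
    ultimately show ?case by (simp add: foldl_mult_add)
  qed
qed

lemma ideal_pow_eq_zero_iff:
  assumes U: "additive_subgroup U R"
  shows "ideal_pow R U (Suc n) = {\<zero>} \<longleftrightarrow>
    (\<forall>x\<in>U. \<forall>ws. set ws \<subseteq> U \<longrightarrow> length ws = n \<longrightarrow> foldl (\<otimes>) x ws = \<zero>)"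
proof
  assume "ideal_pow R U (Suc n) = {\<zero>}"
  then show "\<forall>x\<in>U. \<forall>ws. set ws \<subseteq> U \<longrightarrow> length ws = n \<longrightarrow> foldl (\<otimes>) x ws = \<zero>"
    using foldl_mult_ideal_pow by blast
next
  assume words: "\<forall>x\<in>U. \<forall>ws. set ws \<subseteq> U \<longrightarrow> length ws = n \<longrightarrow> foldl (\<otimes>) x ws = \<zero>"
  have "p = \<zero>" if "p \<in> ideal_pow R U (Suc n)" for p
    using foldl_ideal_pow_eq_zero[OF additive_subgroup.a_subset[OF U], of n p n "[]"] words that by simp
  then show "ideal_pow R U (Suc n) = {\<zero>}"
    using ideal_pow_zero_mem[OF additive_subgroup.zero_closed[OF U], of n] by blast
qed

lemma nilpotent_ideal_iff:
  assumes "additive_subgroup U R"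
  shows "nilpotent_ideal R U \<longleftrightarrow>
    (\<exists>n. \<forall>x\<in>U. \<forall>ws. set ws \<subseteq> U \<longrightarrow> length ws = n \<longrightarrow> foldl (\<otimes>) x ws = \<zero>)"
  unfolding nilpotent_ideal_def ideal_pow_eq_zero_iff[OF assms, symmetric]
  by (metis gr0_conv_Suc zero_less_Suc)

end

section \<open>Local identities and generation by objects\<close>

context graded_ring
begin

lemma nilpotent_imp_objectwise:
  assumes "nilpotent_ideal R U"
  shows "objectwise_nilpotent \<Gamma> R A U"
  using assms unfolding nilpotent_ideal_def objectwise_nilpotent_def l_coset_def r_coset_def
  by fastforce

lemma objectwise_nilpotent_words:
  assumes nil: "objectwise_nilpotent \<Gamma> R A U" and e: "e \<in> ids \<Gamma>"
  shows "\<exists>n. \<forall>x\<in>U. \<forall>ws. set ws \<subseteq> U \<longrightarrow> length ws = n \<longrightarrow> obj e \<otimes> foldl (\<otimes>) x ws = \<zero>"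
proof -
  obtain n where n: "n > 0" "obj e <# ideal_pow R U n = {\<zero>}"
    using nil e unfolding objectwise_nilpotent_def by blast
  \<comment> \<open>The start value and \<open>n - 1\<close> list entries make up the
    \<open>n\<close> factors.\<close>
  have "obj e \<otimes> foldl (\<otimes>) x ws = \<zero>" if "x \<in> U" "set ws \<subseteq> U" "length ws = n - 1" for x ws
  proof -
    have "foldl (\<otimes>) x ws \<in> ideal_pow R U n"
      using foldl_mult_ideal_pow[OF that(1,2)] that(3) n(1) by simp
    then have "obj e \<otimes> foldl (\<otimes>) x ws \<in> obj e <# ideal_pow R U n" by (auto simp: l_coset_def)
    then show ?thesis using n(2) by simp
  qed
  then show ?thesis by blast
qed

text \<open>Turns \<open>R = \<Sum>R 1_e R\<close> into an induction principle. In applications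
  \<open>H\<close> is the socle, or the set of factors \<open>t\<close> for which a product
  containing \<open>t\<close> vanishes.\<close>

lemma d_generated_induct:
  assumes gen: "d_generated_by R A \<Delta>" and H: "additive_subgroup H R"
    and mem: "\<And>e r s. e \<in> \<Delta> \<Longrightarrow> r \<in> carrier R \<Longrightarrow> s \<in> carrier R \<Longrightarrow> r \<otimes> obj e \<otimes> s \<in> H"
  shows "carrier R \<subseteq> H"
proof -
  interpret H: additive_subgroup H R by (rule H)
  let ?I = "\<lambda>e. ideal_prod R (carrier R #> obj e) (carrier R)"
  have "?I e \<subseteq> H" if "e \<in> \<Delta>" for e
  proof
    fix t assume "t \<in> ?I e"
    then show "t \<in> H"
      by induction (use mem[OF that] in \<open>auto simp: r_coset_def\<close>)
  qed
  then have "generate (add_monoid R) (\<Union>(?I ` \<Delta>)) \<subseteq> H" by (intro generate_le H) blast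
  then show ?thesis using gen unfolding d_generated_by_def subgroups_sum_def by blast
qed

text \<open>Each component of \<open>x\<close> is unchanged by the local identity at its target, so
  annihilation by all of them kills every component.\<close>

lemma eq_zero_if_obj_mult_left:
  assumes "x \<in> carrier R" "\<And>e. e \<in> ids \<Gamma> \<Longrightarrow> obj e \<otimes> x = \<zero>"
  shows "x = \<zero>"
proof (rule eq_if_pr_eq[OF assms(1)])
  fix \<gamma> assume \<gamma>: "\<gamma> \<in> arr \<Gamma>"
  show "pr \<gamma> x = pr \<gamma> \<zero>"
    using pr_obj_mult[OF tgt_ids[OF \<gamma>] \<gamma> assms(1)]
    unfolding assms(2)[OF tgt_ids[OF \<gamma>]] by simp
qed simp

lemma eq_zero_if_obj_mult_right:
  assumes "x \<in> carrier R" "\<And>e. e \<in> ids \<Gamma> \<Longrightarrow> x \<otimes> obj e = \<zero>"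
  shows "x = \<zero>"
proof (rule eq_if_pr_eq[OF assms(1)])
  fix \<gamma> assume \<gamma>: "\<gamma> \<in> arr \<Gamma>"
  show "pr \<gamma> x = pr \<gamma> \<zero>"
    using pr_mult_obj[OF src_ids[OF \<gamma>] \<gamma> assms(1)]
    unfolding assms(2)[OF src_ids[OF \<gamma>]] by simp
qed simp

lemma zero_subgroup: "additive_subgroup {\<zero>} R"
  by (rule additive_subgroup_criterion) auto

end

context graded_ring_ideal
begin

text \<open>In front of a long product \<open>p\<close>, the factor \<open>s\<close> of
  \<open>r 1_e s\<close> is absorbed into the first element of \<open>K\<close>, and
  \<open>1_e\<close> annihilates what follows. So \<open>R p = 0\<close>, and local identities give
  \<open>p = 0\<close>.\<close>

lemma nilpotent_if_objectwise_nilpotent: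
  assumes fin: "finite \<Delta>" and ids: "\<Delta> \<subseteq> ids \<Gamma>" and gen: "d_generated_by R A \<Delta>"
    and nil: "objectwise_nilpotent \<Gamma> R A K"
  shows "nilpotent_ideal R K"
proof -
  have "\<forall>e\<in>\<Delta>. \<exists>n. \<forall>x\<in>K. \<forall>ws. set ws \<subseteq> K \<longrightarrow> length ws = n \<longrightarrow> obj e \<otimes> foldl (\<otimes>) x ws = \<zero>"
    using objectwise_nilpotent_words[OF nil] ids by blast
  then obtain n where n: "\<And>e x ws. e \<in> \<Delta> \<Longrightarrow> x \<in> K \<Longrightarrow> set ws \<subseteq> K \<Longrightarrow> length ws = n e \<Longrightarrow>
      obj e \<otimes> foldl (\<otimes>) x ws = \<zero>"
    by metis
  have "foldl (\<otimes>) x ws = \<zero>" if x: "x \<in> K" and ws: "set ws \<subseteq> K" "length ws = sum n \<Delta>" for x ws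
  proof -
    let ?p = "foldl (\<otimes>) x ws"
    have wc: "set ws \<subseteq> carrier R" using ws(1) K.a_subset by blast
    have pc: "?p \<in> carrier R" using foldl_mult_closed x wc by simp
    have zero: "obj e \<otimes> foldl (\<otimes>) y ws = \<zero>" if e: "e \<in> \<Delta>" and y: "y \<in> K" for e y
    proof -
      have ec: "obj e \<in> carrier R" using e ids by auto
      \<comment> \<open>The sum over the finite set \<open>\<Delta>\<close> is a common bound for
        all \<open>n e\<close>; surplus factors are split off on the right.\<close>
      have len: "n e \<le> length ws" using member_le_sum[OF e _ fin, of n] ws(2) by simp
      let ?u = "take (n e) ws" and ?v = "drop (n e) ws"
      have u: "set ?u \<subseteq> K" "set ?u \<subseteq> carrier R" "length ?u = n e" and v: "set ?v \<subseteq> carrier R"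
        using ws(1) wc len set_take_subset[of "n e" ws] set_drop_subset[of "n e" ws] by auto
      have "foldl (\<otimes>) y ws = foldl (\<otimes>) (foldl (\<otimes>) y ?u) ?v"
        by (metis append_take_drop_id foldl_append)
      then have "obj e \<otimes> foldl (\<otimes>) y ws = foldl (\<otimes>) (obj e \<otimes> foldl (\<otimes>) y ?u) ?v"
        using foldl_mult_assoc[OF ec foldl_mult_closed[OF _ u(2)] v, of y] y by simp
      then show ?thesis using n[OF e y u(1,3)] foldl_mult_zero[OF v] by simp
    qed
    have "carrier R \<subseteq> {t \<in> carrier R. t \<otimes> ?p \<in> {\<zero>}}"
    proof (rule d_generated_induct[OF gen right_quotient_subgroup[OF zero_subgroup pc]])
      fix e r s assume e: "e \<in> \<Delta>" and rs: "r \<in> carrier R" "s \<in> carrier R"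
      have ec: "obj e \<in> carrier R" using e ids by auto
      have "r \<otimes> obj e \<otimes> s \<otimes> ?p = r \<otimes> (obj e \<otimes> (s \<otimes> ?p))"
        using rs ec pc by (simp add: m_assoc m_closed)
      also have "s \<otimes> ?p = foldl (\<otimes>) (s \<otimes> x) ws"
        using foldl_mult_assoc rs x wc by simp
      finally have "r \<otimes> obj e \<otimes> s \<otimes> ?p = \<zero>"
        using zero[OF e K_l[OF x rs(2)]] rs by simp
      then show "r \<otimes> obj e \<otimes> s \<in> {t \<in> carrier R. t \<otimes> ?p \<in> {\<zero>}}" using rs ec by (simp add: m_closed)
    qed
    then have "t \<otimes> ?p = \<zero>" if "t \<in> carrier R" for t using that by blast
    then show ?thesis by (rule eq_zero_if_obj_mult_left[OF pc]) simp
  qed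
  then show ?thesis unfolding nilpotent_ideal_iff[OF K.is_additive_subgroup] by blast
qed

text \<open>
  \<open>b e\<close> counts how many more factors from \<open>1\<^sub>e K 1\<^sub>e\<close> annihilate the prefix
  \<open>p\<close>. Since \<open>R = \<Sum>R 1\<^sub>e R\<close>, an element \<open>1\<^sub>e\<close> with \<open>e \<in> \<Delta>\<close> can be
  inserted before each further factor from \<open>K\<close>, which lowers one of these numbers.
\<close>

lemma foldl_eq_zero_if_budget:
  assumes fin: "finite \<Delta>" and ids: "\<Delta> \<subseteq> ids \<Gamma>" and gen: "d_generated_by R A \<Delta>"
  shows "p \<in> carrier R \<Longrightarrow>
    (\<And>e r vs. e \<in> \<Delta> \<Longrightarrow> r \<in> carrier R \<Longrightarrow> set vs \<subseteq> (\<lambda>k. obj e \<otimes> k \<otimes> obj e) ` K \<Longrightarrow>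
      length vs = b e \<Longrightarrow> foldl (\<otimes>) (p \<otimes> r \<otimes> obj e) vs = \<zero>) \<Longrightarrow>
    set ws \<subseteq> K \<Longrightarrow> length ws = sum b \<Delta> \<Longrightarrow> foldl (\<otimes>) p ws = \<zero>"
proof (induction ws arbitrary: p b)
  case Nil
  have pc: "p \<in> carrier R" by (rule Nil.prems)
  \<comment> \<open>The budgets sum to zero, so each is zero and \<open>p r 1_e\<close> vanishes
    outright; hence \<open>p R = 0\<close>.\<close>
  have "carrier R \<subseteq> {t \<in> carrier R. p \<otimes> t \<in> {\<zero>}}"
  proof (rule d_generated_induct[OF gen left_quotient_subgroup[OF zero_subgroup pc]])
    fix e r s assume e: "e \<in> \<Delta>" and rs: "r \<in> carrier R" "s \<in> carrier R"
    have ec: "obj e \<in> carrier R" using e ids by auto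
    have "b e = 0" using Nil.prems(4) fin e by simp
    then have "p \<otimes> r \<otimes> obj e = \<zero>" using Nil.prems(2)[OF e rs(1), of "[]"] by simp
    moreover have "p \<otimes> (r \<otimes> obj e \<otimes> s) = p \<otimes> r \<otimes> obj e \<otimes> s"
      using pc rs ec by (simp add: m_assoc m_closed)
    ultimately show "r \<otimes> obj e \<otimes> s \<in> {t \<in> carrier R. p \<otimes> t \<in> {\<zero>}}"
      using rs ec by (simp add: m_closed)
  qed
  then have "p \<otimes> t = \<zero>" if "t \<in> carrier R" for t using that by blast
  then have "p = \<zero>" by (rule eq_zero_if_obj_mult_right[OF pc]) simp
  then show ?case by simp
next
  case (Cons x ws)
  have pc: "p \<in> carrier R" by (rule Cons.prems)
  have xK: "x \<in> K" and ws: "set ws \<subseteq> K" using Cons.prems(3) by auto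
  have wc: "set ws \<subseteq> carrier R" using ws K.a_subset by blast
  let ?H = "{t \<in> carrier R. foldl (\<otimes>) t ws \<in> {\<zero>}}"
  have H: "additive_subgroup ?H R"
    by (rule additive_subgroup_criterion)
      (use wc in \<open>auto simp: foldl_mult_zero foldl_mult_add foldl_mult_minus\<close>)
  \<comment> \<open>The extra factor \<open>t\<close> is the place where \<open>1_e\<close> gets
    inserted, by expanding \<open>t\<close> into terms \<open>r 1_e s\<close>.\<close>
  have main: "p \<otimes> t \<otimes> y \<in> ?H" if t: "t \<in> carrier R" and y: "y \<in> K" for t y
  proof -
    have yc: "y \<in> carrier R" using y by simp
    let ?L = "{t \<in> carrier R. p \<otimes> t \<in> {u \<in> carrier R. u \<otimes> y \<in> ?H}}"
    have "carrier R \<subseteq> ?L"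
    proof (rule d_generated_induct[OF gen left_quotient_subgroup[OF right_quotient_subgroup[OF H yc] pc]])
      fix e r s assume e: "e \<in> \<Delta>" and rs: "r \<in> carrier R" "s \<in> carrier R"
      have ei: "e \<in> ids \<Gamma>" using e ids by auto
      then have ec: "obj e \<in> carrier R" by simp
      \<comment> \<open>Absorbing \<open>s\<close> into the ideal element leaves
        \<open>p r 1_e\<close>, the prefix that the hypothesis on \<open>b\<close> speaks
        of.\<close>
      let ?y = "s \<otimes> y"
      have yK: "?y \<in> K" "?y \<in> carrier R" using K_l y rs by auto
      let ?q = "p \<otimes> r \<otimes> obj e"
      have qc: "?q \<in> carrier R" using pc rs ec by (simp add: m_closed)
      have eq: "p \<otimes> (r \<otimes> obj e \<otimes> s) \<otimes> y = ?q \<otimes> ?y"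
        using pc rs ec yc by (simp add: m_assoc m_closed)
      have "foldl (\<otimes>) (?q \<otimes> ?y) ws = \<zero>"
      proof (cases "b e = 0")
        case True
        then have "?q = \<zero>" using Cons.prems(2)[OF e rs(1), of "[]"] by simp
        then show ?thesis using yK foldl_mult_zero[OF wc] by simp
      next
        case False
        let ?b = "b(e := b e - 1)"
        have "sum b \<Delta> = b e + sum b (\<Delta> - {e})" "sum ?b \<Delta> = ?b e + sum ?b (\<Delta> - {e})"
          by (rule sum.remove[OF fin e])+
        moreover have "sum ?b (\<Delta> - {e}) = sum b (\<Delta> - {e})" by (rule sum.cong) auto
        ultimately have len: "length ws = sum ?b \<Delta>" using Cons.prems(4) False by simp
        show ?thesis
        proof (rule Cons.IH[OF _ _ ws len])
          show "?q \<otimes> ?y \<in> carrier R" using qc yK by (simp add: m_closed)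
          fix e' r' vs
          assume e': "e' \<in> \<Delta>" and r': "r' \<in> carrier R"
            and vs: "set vs \<subseteq> (\<lambda>k. obj e' \<otimes> k \<otimes> obj e') ` K" "length vs = ?b e'"
          show "foldl (\<otimes>) (?q \<otimes> ?y \<otimes> r' \<otimes> obj e') vs = \<zero>"
          proof (cases "e' = e")
            case True
            \<comment> \<open>What stands between two occurrences of \<open>1_e\<close> becomes, by
              idempotence, a factor from \<open>1_e K 1_e\<close>. Put in front of
              \<open>vs\<close>, it restores the length \<open>b e\<close>.\<close>
            let ?v = "obj e \<otimes> (?y \<otimes> r') \<otimes> obj e"
            have "?q \<otimes> ?v = p \<otimes> r \<otimes> (obj e \<otimes> obj e) \<otimes> ?y \<otimes> r' \<otimes> obj e"
              using pc rs ec r' yK by (simp add: m_assoc m_closed)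
            then have "?q \<otimes> ?v = ?q \<otimes> ?y \<otimes> r' \<otimes> obj e" using obj_idem[OF ei] by simp
            moreover have "foldl (\<otimes>) ?q (?v # vs) = \<zero>"
              using vs True False K_r[OF yK(1) r'] by (intro Cons.prems(2)[OF e rs(1)]) auto
            ultimately show ?thesis using True by simp
          next
            case False
            \<comment> \<open>At another object the budget is unchanged, and the new factors
              disappear into the arbitrary ring element after \<open>p\<close>.\<close>
            let ?r = "r \<otimes> obj e \<otimes> ?y \<otimes> r'"
            have e'c: "obj e' \<in> carrier R" using e' ids by auto
            have "foldl (\<otimes>) (p \<otimes> ?r \<otimes> obj e') vs = \<zero>"
              using vs False rs ec yK r' by (intro Cons.prems(2)[OF e']) (auto simp: m_closed)
            moreover have "p \<otimes> ?r \<otimes> obj e' = ?q \<otimes> ?y \<otimes> r' \<otimes> obj e'"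
              using pc rs ec yK r' e'c by (simp add: m_assoc m_closed)
            ultimately show ?thesis by simp
          qed
        qed
      qed
      then show "r \<otimes> obj e \<otimes> s \<in> ?L"
        using eq rs ec pc yc by (simp add: m_closed)
    qed
    then show ?thesis using t by blast
  qed
  have xc: "x \<in> carrier R" using xK by simp
  \<comment> \<open>On a single component of \<open>x\<close> some \<open>obj\<close> acts as left
    identity, which provides the \<open>t\<close> required by \<open>main\<close>.\<close>
  have "x \<in> {t \<in> carrier R. p \<otimes> t \<in> ?H}"
  proof (rule in_subgroup_if_pr[OF left_quotient_subgroup[OF H pc] xc])
    fix \<gamma> assume \<gamma>: "\<gamma> \<in> arr \<Gamma>"
    let ?x = "pr \<gamma> x"
    have x: "?x \<in> K" "?x \<in> carrier R" using gr_right_ideal_pr[OF K_right_ideal xK \<gamma>] by auto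
    have oc: "obj (tgt \<Gamma> \<gamma>) \<in> carrier R" using tgt_ids[OF \<gamma>] by simp
    have "p \<otimes> ?x = p \<otimes> obj (tgt \<Gamma> \<gamma>) \<otimes> ?x"
      using obj_tgt_mult[OF \<gamma> pr_mem[OF xc \<gamma>]] pc oc x by (simp add: m_assoc)
    then have "p \<otimes> ?x \<in> ?H" using main[OF oc x(1)] by simp
    then show "?x \<in> {t \<in> carrier R. p \<otimes> t \<in> ?H}" using x by simp
  qed
  then show ?case by simp
qed

text \<open>The budget at \<open>e\<close> is \<open>Suc (n e)\<close>: a vanishing word in the
  corner has a start value and \<open>n e\<close> list entries, whereas after the prefix
  \<open>p r 1_e\<close> all of these factors are list entries.\<close>

lemma nilpotent_if_corners_nilpotent:
  assumes fin: "finite \<Delta>" and ids: "\<Delta> \<subseteq> ids \<Gamma>" and gen: "d_generated_by R A \<Delta>"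
    and nil: "\<And>e. e \<in> \<Delta> \<Longrightarrow> \<exists>n. \<forall>x vs. set (x # vs) \<subseteq> (\<lambda>k. obj e \<otimes> k \<otimes> obj e) ` K \<longrightarrow>
      length vs = n \<longrightarrow> foldl (\<otimes>) x vs = \<zero>"
  shows "nilpotent_ideal R K"
proof -
  obtain n where n: "\<And>e x vs. e \<in> \<Delta> \<Longrightarrow> set (x # vs) \<subseteq> (\<lambda>k. obj e \<otimes> k \<otimes> obj e) ` K \<Longrightarrow>
      length vs = n e \<Longrightarrow> foldl (\<otimes>) x vs = \<zero>"
    using nil by metis
  have "foldl (\<otimes>) p ws = \<zero>"
    if p: "p \<in> K" and ws: "set ws \<subseteq> K" "length ws = (\<Sum>e\<in>\<Delta>. Suc (n e))" for p ws
  proof (rule foldl_eq_zero_if_budget[OF fin ids gen _ _ ws])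
    show pc: "p \<in> carrier R" using p by simp
    fix e r vs
    assume e: "e \<in> \<Delta>" and r: "r \<in> carrier R"
      and vs: "set vs \<subseteq> (\<lambda>k. obj e \<otimes> k \<otimes> obj e) ` K" "length vs = Suc (n e)"
    obtain x us where v: "vs = x # us" "length us = n e" using vs(2) by (auto simp: length_Suc_conv)
    have ec: "obj e \<in> carrier R" using e ids by auto
    then have "(\<lambda>k. obj e \<otimes> k \<otimes> obj e) ` K \<subseteq> carrier R" by (auto simp: m_closed)
    then have "x \<in> carrier R" "set us \<subseteq> carrier R" using vs(1) v by auto
    then have "foldl (\<otimes>) (p \<otimes> r \<otimes> obj e) vs = p \<otimes> r \<otimes> obj e \<otimes> foldl (\<otimes>) x us"
      using foldl_mult_assoc[of "p \<otimes> r \<otimes> obj e" x us] pc r ec v by (simp add: m_closed)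
    then show "foldl (\<otimes>) (p \<otimes> r \<otimes> obj e) vs = \<zero>"
      using n[OF e, of x us] vs(1) v pc r ec by (simp add: m_closed)
  qed
  then show ?thesis unfolding nilpotent_ideal_iff[OF K.is_additive_subgroup] by blast
qed

end

section \<open>Nilpotency of the radical in a ring and in its corner\<close>

context graded_corner
begin

text \<open>Products in the corner are products in \<open>R\<close>, so words in the smaller radical
  vanish at the same length.\<close>

lemma corner_objectwise_nilpotent:
  assumes "nilpotent_ideal R (gr_rad \<Gamma> R A)"
  shows "objectwise_nilpotent G C A (gr_rad G C A)"
proof (rule C.nilpotent_imp_objectwise)
  have "additive_subgroup (gr_rad G C A) C"
    by (rule C.gr_right_ideal_subgroup[OF C.rad_right_ideal])
  moreover obtain n where "\<forall>x\<in>gr_rad \<Gamma> R A. \<forall>ws. set ws \<subseteq> gr_rad \<Gamma> R A \<longrightarrow> length ws = n \<longrightarrow>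
      foldl (\<otimes>) x ws = \<zero>"
    using assms nilpotent_ideal_iff[OF J.K.is_additive_subgroup] by blast
  ultimately show "nilpotent_ideal C (gr_rad G C A)"
    using corner_rad by (subst C.nilpotent_ideal_iff) (auto intro!: exI[of _ n])
qed

text \<open>Since \<open>w\<close> is the identity of the corner, annihilation of a product by
  \<open>w\<close> already means that the product is zero.\<close>

lemma corner_nilpotent_words:
  assumes "objectwise_nilpotent G C A (gr_rad G C A)"
  shows "\<exists>n. \<forall>x vs. set (x # vs) \<subseteq> (\<lambda>k. w \<otimes> k \<otimes> w) ` gr_rad \<Gamma> R A \<longrightarrow>
      length vs = n \<longrightarrow> foldl (\<otimes>) x vs = \<zero>"
proof -
  obtain n where n: "\<forall>x\<in>gr_rad G C A. \<forall>vs. set vs \<subseteq> gr_rad G C A \<longrightarrow> length vs = n \<longrightarrow>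
      w \<otimes> foldl (\<otimes>) x vs = \<zero>"
    using C.objectwise_nilpotent_words[OF assms, of e] unfolding isotropy_ids corner_obj corner_ops
    by blast
  have sub: "(\<lambda>k. w \<otimes> k \<otimes> w) ` gr_rad \<Gamma> R A \<subseteq> gr_rad G C A"
    using J.K_l J.K_r cut_corner corner_rad by auto
  have sub': "gr_rad G C A \<subseteq> carrier C" using corner_rad by blast
  have "foldl (\<otimes>) x vs = \<zero>" if "set (x # vs) \<subseteq> gr_rad G C A" "length vs = n" for x vs
  proof -
    have "foldl (\<otimes>) x vs \<in> carrier C"
      using C.foldl_mult_closed[of x vs] that(1) sub' by auto
    then show ?thesis using corner_carrierD[of "foldl (\<otimes>) x vs"] n that by auto
  qed
  then show ?thesis using sub by (meson order_trans)
qed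

end


section \<open>Semiprimary rings and their corners\<close>

theorem corollary8p9:
  fixes \<Gamma> :: "('g, 'x) groupoid_scheme"
    and R :: "('a, 'm) ring_scheme"
    and A :: "'g \<Rightarrow> 'a set"
    and \<Delta>\<^sub>0 :: "'g set"
  assumes "graded_ring \<Gamma> R A"
    and "d_finitely_generated \<Gamma> R A"
    and "finite \<Delta>\<^sub>0" and "\<Delta>\<^sub>0 \<subseteq> ids \<Gamma>" and "d_generated_by R A \<Delta>\<^sub>0"
  shows "(gr_semiprimary \<Gamma> R A \<longleftrightarrow>
            gr_semilocal \<Gamma> R A \<and> nilpotent_ideal R (gr_rad \<Gamma> R A)) \<and>
         (gr_semiprimary \<Gamma> R A \<longleftrightarrow>
            (\<forall>e\<in>\<Delta>\<^sub>0. gr_semiprimary (isotropy \<Gamma> e) (corner R A e) A))"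
proof -
  interpret graded_ring \<Gamma> R A by fact
  interpret J: graded_ring_ideal \<Gamma> R A "gr_rad \<Gamma> R A"
    by unfold_locales (rule rad_ideal)
  have corner: "graded_corner \<Gamma> R A e" if "e \<in> \<Delta>\<^sub>0" for e
    using that assms(4) by unfold_locales blast
  \<comment> \<open>This is the first equivalence up to semilocality, and it lets both directions of
    the second work with plain nilpotency in \<open>R\<close>.\<close>
  have nil: "objectwise_nilpotent \<Gamma> R A (gr_rad \<Gamma> R A) \<longleftrightarrow> nilpotent_ideal R (gr_rad \<Gamma> R A)"
    using nilpotent_imp_objectwise J.nilpotent_if_objectwise_nilpotent[OF assms(3-5)] by blast
  have "gr_semiprimary (isotropy \<Gamma> e) (corner R A e) A"
    if "gr_semiprimary \<Gamma> R A" "e \<in> \<Delta>\<^sub>0" for e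
    using that nil graded_corner.corner_semilocal[OF corner]
      graded_corner.corner_objectwise_nilpotent[OF corner]
    unfolding gr_semiprimary_def by blast
  moreover have "gr_semiprimary \<Gamma> R A"
    if corners: "\<forall>e\<in>\<Delta>\<^sub>0. gr_semiprimary (isotropy \<Gamma> e) (corner R A e) A"
  proof -
    have "nilpotent_ideal R (gr_rad \<Gamma> R A)"
      using corners graded_corner.corner_nilpotent_words[OF corner]
      unfolding gr_semiprimary_def by (intro J.nilpotent_if_corners_nilpotent[OF assms(3-5)]) blast
    moreover have "carrier R \<subseteq> J.socle"
    proof (rule d_generated_induct[OF assms(5) J.socle_subgroup])
      fix e r s assume e: "e \<in> \<Delta>\<^sub>0" and rs: "r \<in> carrier R" "s \<in> carrier R"
      have "obj_one R A e \<in> J.socle"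
        using corners e graded_corner.obj_in_socle[OF corner] unfolding gr_semiprimary_def by blast
      then show "r \<otimes>\<^bsub>R\<^esub> obj_one R A e \<otimes>\<^bsub>R\<^esub> s \<in> J.socle" using J.socle_mult rs by simp
    qed
    then have "gr_semilocal \<Gamma> R A"
      unfolding gr_semilocal_iff using additive_subgroup.a_subset[OF J.socle_subgroup] by blast
    ultimately show ?thesis using nil unfolding gr_semiprimary_def by blast
  qed
  ultimately show ?thesis using nil unfolding gr_semiprimary_def by blast
qed

end
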